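(* Let $g$ satisfy (KPP$_g$) and $f$ satisfy (KPP$_f$). For every continuous, bounded, non-negative initial datum $(u_0,v_0)\not\equiv(0,0)$, the solution $(u,v)$ of problem (H) satisfies $\lim_{t\to+\infty}(u,v)=(U,V)$ locally uniformly in each domain, where $(U,V)$ is the unique positive bounded steady state of (H) depending only on $x_N$.
   Context: Problem (H) ($N\geq2$, $D,d,\mu,\nu>0$): $u_t-D\Delta u=g(u)$ in $\{x_N<0\}\times(0,\infty)$, $v_t-d\Delta v=f(v)$ in $\{x_N>0\}\times(0,\infty)$, $D\partial_{x_N}u=\nu v-\mu u$ and $-d\partial_{x_N}v=\mu u-\nu v$ on $\{x_N=0\}\times(0,\infty)$. (KPP$_g$): $g$ locally Lipschitz, differentiable at $0$, $g(0)=g(1)=0$, $0<g(s)\leq g'(0)s$ on $(0,1)$, $g(s)<0$ for $s>1$. (KPP$_f$): for some $S>0$, $f$ locally Lipschitz, differentiable at $0$, $f(0)=f(S)=0$, $0<f(s)\leq f'(0)s$ on $(0,S)$, $f(s)<0$ for $s>S$. *)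

theory Defs
  imports "HOL-Analysis.Analysis"
begin

text \<open>Space: R^N = real^'n, N = CARD('n). The distinguished coordinate x_N is x $ k.\<close>

definition loc_lipschitz :: "(real \<Rightarrow> real) \<Rightarrow> bool" where
  "loc_lipschitz h \<longleftrightarrow> (\<forall>a b. \<exists>L. L-lipschitz_on {a..b} h)"

definition KPP_g :: "(real \<Rightarrow> real) \<Rightarrow> bool" where
  "KPP_g g \<longleftrightarrow> loc_lipschitz g \<and> g differentiable (at 0) \<and> g 0 = 0 \<and> g 1 = 0 \<and>
     (\<forall>s. 0 < s \<and> s < 1 \<longrightarrow> 0 < g s \<and> g s \<le> deriv g 0 * s) \<and>
     (\<forall>s. s > 1 \<longrightarrow> g s < 0)"

definition KPP_f :: "(real \<Rightarrow> real) \<Rightarrow> real \<Rightarrow> bool" where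
  "KPP_f f S \<longleftrightarrow> S > 0 \<and> loc_lipschitz f \<and> f differentiable (at 0) \<and> f 0 = 0 \<and> f S = 0 \<and>
     (\<forall>s. 0 < s \<and> s < S \<longrightarrow> 0 < f s \<and> f s \<le> deriv f 0 * s) \<and>
     (\<forall>s. s > S \<longrightarrow> f s < 0)"

definition dpt :: "(real^'n \<Rightarrow> real \<Rightarrow> real) \<Rightarrow> real^'n \<Rightarrow> real \<Rightarrow> real" where
  "dpt w x t = deriv (\<lambda>s. w x s) t"

definition dxx :: "(real^'n \<Rightarrow> real \<Rightarrow> real) \<Rightarrow> 'n \<Rightarrow> real^'n \<Rightarrow> real \<Rightarrow> real" where
  "dxx w i x t = deriv (deriv (\<lambda>r. w (x + r *\<^sub>R axis i 1) t)) 0"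

definition lap :: "(real^'n \<Rightarrow> real \<Rightarrow> real) \<Rightarrow> real^'n \<Rightarrow> real \<Rightarrow> real" where
  "lap w x t = (\<Sum>i\<in>UNIV. dxx w i x t)"

definition C21_on :: "(real^'n \<Rightarrow> real \<Rightarrow> real) \<Rightarrow> (real^'n) set \<Rightarrow> bool" where
  "C21_on w \<Omega> \<longleftrightarrow>
     (\<forall>x\<in>\<Omega>. \<forall>t>0. (\<lambda>s. w x s) differentiable (at t) \<and>
        (\<forall>i. (\<forall>\<^sub>F r in nhds 0. (\<lambda>r. w (x + r *\<^sub>R axis i 1) t) differentiable (at r)) \<and>
             deriv (\<lambda>r. w (x + r *\<^sub>R axis i 1) t) differentiable (at 0))) \<and>
     continuous_on (\<Omega> \<times> {0<..}) (\<lambda>(x,t). dpt w x t) \<and>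
     (\<forall>i. continuous_on (\<Omega> \<times> {0<..}) (\<lambda>(x,t). dxx w i x t))"

definition solves_H :: "real \<Rightarrow> real \<Rightarrow> real \<Rightarrow> real \<Rightarrow> (real \<Rightarrow> real) \<Rightarrow> (real \<Rightarrow> real) \<Rightarrow> 'n::finite
    \<Rightarrow> (real^'n \<Rightarrow> real \<Rightarrow> real) \<Rightarrow> (real^'n \<Rightarrow> real \<Rightarrow> real) \<Rightarrow> bool" where
  "solves_H D d \<mu> \<nu> g f k u v \<longleftrightarrow>
     C21_on u {x. x $ k < 0} \<and> C21_on v {x. x $ k > 0} \<and>
     (\<forall>x t. x $ k < 0 \<longrightarrow> t > 0 \<longrightarrow> dpt u x t - D * lap u x t = g (u x t)) \<and>
     (\<forall>x t. x $ k > 0 \<longrightarrow> t > 0 \<longrightarrow> dpt v x t - d * lap v x t = f (v x t)) \<and>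
     continuous_on ({x. x $ k \<le> 0} \<times> {0<..}) (\<lambda>(x,t). u x t) \<and>
     continuous_on ({x. x $ k \<ge> 0} \<times> {0<..}) (\<lambda>(x,t). v x t) \<and>
     (\<forall>x t. x $ k = 0 \<longrightarrow> t > 0 \<longrightarrow>
        (\<exists>ux vx. ((\<lambda>s. u (x + s *\<^sub>R axis k 1) t) has_real_derivative ux) (at 0 within {..0}) \<and>
                 ((\<lambda>s. v (x + s *\<^sub>R axis k 1) t) has_real_derivative vx) (at 0 within {0..}) \<and>
                 D * ux = \<nu> * v x t - \<mu> * u x t \<and>
                 - d * vx = \<mu> * u x t - \<nu> * v x t))"

definition solves_H_init :: "real \<Rightarrow> real \<Rightarrow> real \<Rightarrow> real \<Rightarrow> (real \<Rightarrow> real) \<Rightarrow> (real \<Rightarrow> real) \<Rightarrow> 'n::finite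
    \<Rightarrow> (real^'n \<Rightarrow> real) \<Rightarrow> (real^'n \<Rightarrow> real)
    \<Rightarrow> (real^'n \<Rightarrow> real \<Rightarrow> real) \<Rightarrow> (real^'n \<Rightarrow> real \<Rightarrow> real) \<Rightarrow> bool" where
  "solves_H_init D d \<mu> \<nu> g f k u0 v0 u v \<longleftrightarrow>
     solves_H D d \<mu> \<nu> g f k u v \<and>
     continuous_on ({x. x $ k < 0} \<times> {0..}) (\<lambda>(x,t). u x t) \<and>
     continuous_on ({x. x $ k > 0} \<times> {0..}) (\<lambda>(x,t). v x t) \<and>
     (\<forall>x. x $ k < 0 \<longrightarrow> u x 0 = u0 x) \<and>
     (\<forall>x. x $ k > 0 \<longrightarrow> v x 0 = v0 x) \<and>
     (\<forall>T. bounded ((\<lambda>(x,t). u x t) ` ({x. x $ k \<le> 0} \<times> {0<..T})) \<and>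
          bounded ((\<lambda>(x,t). v x t) ` ({x. x $ k \<ge> 0} \<times> {0<..T})))"

definition steady_xN :: "real \<Rightarrow> real \<Rightarrow> real \<Rightarrow> real \<Rightarrow> (real \<Rightarrow> real) \<Rightarrow> (real \<Rightarrow> real) \<Rightarrow> 'n::finite
    \<Rightarrow> (real \<Rightarrow> real) \<Rightarrow> (real \<Rightarrow> real) \<Rightarrow> bool" where
  "steady_xN D d \<mu> \<nu> g f k \<Phi> \<Psi> \<longleftrightarrow>
     solves_H D d \<mu> \<nu> g f k (\<lambda>x t. \<Phi> (x $ k)) (\<lambda>x t. \<Psi> (x $ k)) \<and>
     (\<forall>z\<le>0. \<Phi> z > 0) \<and> (\<forall>z\<ge>0. \<Psi> z > 0) \<and>
     bounded (\<Phi> ` {..0}) \<and> bounded (\<Psi> ` {0..})"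

end

theory Submission
  imports Defs
begin

text \<open>The proof uses comparison principles only. The upper half-space and the reflection of the lower one are
  treated alike, so that both components live on \<open>0 \<le> x $ k\<close>. Global bounds come from barriers, and a moving
  bump shows that a nontrivial solution ends up uniformly above a positive constant on large sets.

  Let \<open>n y\<close> be the infimum of all \<open>c\<close> which, up to \<open>\<epsilon>\<close> and on bounded sets, eventually bound the solution on the
  hyperplane \<open>x $ k = y\<close>. Comparison on thin slabs makes \<open>n\<close> a subsolution of \<open>- D n'' = g n\<close>, in a
  sense that needs no regularity of \<open>n\<close>. Sweeping with solutions of perturbed first order equations \<open>w' = - P w\<close>
  gives \<open>n y \<le> \<Phi> y\<close>, where \<open>\<Phi>\<close> is the exact profile with \<open>\<Phi> 0 = n 0\<close>, and the flux condition gives an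
  inequality between \<open>n 0\<close>, the corresponding value for the other component, and the slope of \<open>\<Phi>\<close> at \<open>0\<close>. Since
  that slope is strictly decreasing in \<open>\<Phi> 0\<close>, the interface values are bounded by those of the steady state.
  Applied to \<open>(-u, -v)\<close> this also yields the lower bound. The steady state exists by the intermediate value
  theorem for its interface values, and is unique because another one, viewed as a solution, converges to it.\<close>

section \<open>Touching from above\<close>

text \<open>The obstacle is the lack of compactness: limits of translated or time-shifted solutions
  are not formed, so the steady state has to be reached through inequalities alone. Hence the
  envelope is tested only against functions with two derivatives, on intervals so short
  (\<open>L * (y2 - y1)\<^sup>2 \<le> D / 2\<close>) that diffusion outweighs the reaction and
  comparison holds whatever the monotonicity of \<open>g\<close>. On the unbounded half-line a sweep
  advances only if each member of the family leaves a uniform gap, which requires a uniform margin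
  in its differential inequality. An exact profile has no margin; this is why it is perturbed, and
  why the perturbation has to be removed afterwards, by comparing travel times. The truncation of
  \<open>g\<close> and \<open>f\<close> to a compact range of positive values gives a global
  Lipschitz constant and a strict sign on either side of the zero. It changes nothing for large
  times only because a solution eventually stays above a positive constant, and that constant must
  not depend on the ball considered.\<close>

definition jet :: "(real^'n \<Rightarrow> real \<Rightarrow> real) \<Rightarrow> real^'n \<Rightarrow> real \<Rightarrow> real \<Rightarrow> ('n \<Rightarrow> real) \<Rightarrow> bool" where
  "jet w x t a b \<longleftrightarrow> ((\<lambda>s. w x s) has_real_derivative a) (at t) \<and>
     (\<forall>i. \<exists>q. (\<forall>\<^sub>F r in nhds 0. ((\<lambda>r. w (x + r *\<^sub>R axis i 1) t) has_real_derivative q r) (at r)) \<and>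
              (q has_real_derivative b i) (at 0))"

lemma jet_uminus:
  assumes "jet w x t a b"
  shows "jet (\<lambda>x t. - w x t) x t (- a) (\<lambda>i. - b i)"
  unfolding jet_def
proof (intro conjI allI)
  show "((\<lambda>s. - w x s) has_real_derivative - a) (at t)"
    using assms unfolding jet_def by (auto intro: DERIV_minus)
  fix i
  obtain q where q: "\<forall>\<^sub>F r in nhds 0. ((\<lambda>r. w (x + r *\<^sub>R axis i 1) t) has_real_derivative q r) (at r)"
    "(q has_real_derivative b i) (at 0)"
    using assms unfolding jet_def by blast
  have "\<forall>\<^sub>F r in nhds 0. ((\<lambda>r. - w (x + r *\<^sub>R axis i 1) t) has_real_derivative - q r) (at r)"
    using q(1) by eventually_elim (auto intro: DERIV_minus)
  moreover have "((\<lambda>r. - q r) has_real_derivative - b i) (at 0)"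
    using q(2) by (rule DERIV_minus)
  ultimately show "\<exists>q. (\<forall>\<^sub>F r in nhds 0. ((\<lambda>r. - w (x + r *\<^sub>R axis i 1) t) has_real_derivative q r) (at r)) \<and>
              (q has_real_derivative - b i) (at 0)" by (intro exI[of _ "\<lambda>r. - q r"] conjI)
qed

text \<open>No continuity of the second derivative is at hand, so a Taylor expansion is avoided: if
  \<open>c < 0\<close>, then \<open>q 0 = 0\<close> makes \<open>q\<close> negative just to the
  right of 0, and the mean value theorem pushes \<open>f\<close> below \<open>f 0\<close>.\<close>

lemma second_derivative_nonneg_at_min:
  fixes f q :: "real \<Rightarrow> real"
  assumes d: "\<forall>\<^sub>F r in nhds 0. (f has_real_derivative q r) (at r)"
    and q: "(q has_real_derivative c) (at 0)"
    and "e > 0" and ge: "\<And>r. \<bar>r\<bar> < e \<Longrightarrow> f 0 \<le> f r"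
  shows "0 \<le> c"
proof (rule ccontr)
  assume "\<not> 0 \<le> c"
  then have "c < 0" by simp
  obtain e1 where e1: "e1 > 0" "\<And>r. \<bar>r\<bar> < e1 \<Longrightarrow> (f has_real_derivative q r) (at r)"
    using d unfolding eventually_nhds_metric dist_real_def by auto
  have q0: "q 0 = 0"
    using DERIV_local_min[OF e1(2)[of 0] \<open>e > 0\<close>] ge e1(1) by simp
  obtain e2 where e2: "e2 > 0" "\<And>h. 0 < h \<Longrightarrow> h < e2 \<Longrightarrow> q h < 0"
    using DERIV_neg_dec_right[OF q \<open>c < 0\<close>] q0 by auto
  define h where "h = min e (min e1 e2) / 2"
  have h: "0 < h" "h < e" "h < e1" "h < e2"
    using \<open>e > 0\<close> e1(1) e2(1) unfolding h_def by auto
  have "\<exists>z. 0 < z \<and> z < h \<and> f h - f 0 = (h - 0) * q z"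
    by (rule MVT2) (use h e1(2) in auto)
  then obtain z where z: "0 < z" "z < h" "f h - f 0 = (h - 0) * q z"
    by auto
  have "q z < 0" using e2(2)[of z] z h by auto
  then have "f h < f 0" using z h by (smt (verit) mult_pos_neg)
  with ge[of h] h show False by auto
qed

text \<open>One-sided, because in a parabolic maximum principle the ordering is known only up to the
  touching time.\<close>

lemma derivative_nonneg_left:
  fixes f :: "real \<Rightarrow> real"
  assumes "(f has_real_derivative a) (at t)" "e > 0"
    and "\<And>s. t - e < s \<Longrightarrow> s \<le> t \<Longrightarrow> f s \<le> f t"
  shows "0 \<le> a"
proof (rule ccontr)
  assume "\<not> 0 \<le> a"
  then obtain d where d: "d > 0" "\<And>h. h > 0 \<Longrightarrow> h < d \<Longrightarrow> f t < f (t - h)"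
    using DERIV_neg_dec_left[OF assms(1)] by auto
  have "f t < f (t - min d e / 2)" using d assms(2) by (intro d(2)) auto
  moreover have "f (t - min d e / 2) \<le> f t" using d assms(2) by (intro assms(3)) auto
  ultimately show False by simp
qed

lemma derivative_nonpos_right_within:
  fixes f :: "real \<Rightarrow> real"
  assumes "(f has_real_derivative a) (at 0 within {0..})" "e > 0"
    and "\<And>s. 0 \<le> s \<Longrightarrow> s < e \<Longrightarrow> f s \<le> f 0"
  shows "a \<le> 0"
proof -
  have lim: "((\<lambda>y. (f y - f 0) / (y - 0)) \<longlongrightarrow> a) (at 0 within {0..})"
    using assms(1) unfolding has_field_derivative_iff by simp
  have "at (0::real) within {0..} \<noteq> bot"
    using trivial_limit_at_right_real[of 0] at_within_Ici_at_right[of "0::real"] by simp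
  moreover have "\<forall>\<^sub>F y in at 0 within {0..}. (f y - f 0) / (y - 0) \<le> 0"
    unfolding eventually_at
    using assms(2,3) by (intro exI[of _ e]) (auto simp: dist_real_def divide_nonpos_pos)
  ultimately show ?thesis by (rule tendsto_upperbound[OF lim _ , rotated])
qed

text \<open>The parabolic maximum principle reduced to lines: a jet contains no mixed derivatives,
  so the ordering matters only backwards in time and along the coordinate axes.\<close>

lemma jet_touch:
  assumes "jet w x t a b" "jet \<omega> x t a' b'" "e > 0" "w x t = \<omega> x t"
    and "\<And>s. t - e < s \<Longrightarrow> s \<le> t \<Longrightarrow> w x s \<le> \<omega> x s"
    and "\<And>i r. \<bar>r\<bar> < e \<Longrightarrow> w (x + r *\<^sub>R axis i 1) t \<le> \<omega> (x + r *\<^sub>R axis i 1) t"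
  shows "a' \<le> a" "b i \<le> b' i"
proof -
  have "((\<lambda>s. w x s - \<omega> x s) has_real_derivative a - a') (at t)"
    using assms(1,2) unfolding jet_def by (intro DERIV_diff) auto
  from derivative_nonneg_left[OF this \<open>e > 0\<close>] show "a' \<le> a"
    using assms(4,5) by auto
  obtain q q' where q: "\<forall>\<^sub>F r in nhds 0. ((\<lambda>r. w (x + r *\<^sub>R axis i 1) t) has_real_derivative q r) (at r)"
    "(q has_real_derivative b i) (at 0)"
    "\<forall>\<^sub>F r in nhds 0. ((\<lambda>r. \<omega> (x + r *\<^sub>R axis i 1) t) has_real_derivative q' r) (at r)"
    "(q' has_real_derivative b' i) (at 0)"
    using assms(1,2) unfolding jet_def by blast
  have "\<forall>\<^sub>F r in nhds 0. ((\<lambda>r. \<omega> (x + r *\<^sub>R axis i 1) t - w (x + r *\<^sub>R axis i 1) t) has_real_derivative q' r - q r) (at r)"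
    using q(1,3) by eventually_elim (rule DERIV_diff)
  moreover have "((\<lambda>r. q' r - q r) has_real_derivative b' i - b i) (at 0)"
    using q by (intro DERIV_diff)
  ultimately have "0 \<le> b' i - b i"
    by (rule second_derivative_nonneg_at_min[OF _ _ \<open>e > 0\<close>]) (use assms(4,6) in auto)
  then show "b i \<le> b' i" by simp
qed

section \<open>Tangential distance and barriers quadratic in it\<close>

definition perp :: "'n \<Rightarrow> real^'n \<Rightarrow> real" where
  "perp k x = (norm x)\<^sup>2 - (x $ k)\<^sup>2"

lemma norm_sq_add_axis:
  "(norm (x + r *\<^sub>R axis i 1 :: real^'n))\<^sup>2 = (norm x)\<^sup>2 + 2 * r * x $ i + r\<^sup>2"
  unfolding power2_norm_eq_inner
  by (simp add: inner_add_left inner_add_right inner_axis inner_axis'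
      power2_eq_square algebra_simps)

lemma perp_add_axis:
  "perp k (x + r *\<^sub>R axis i 1 :: real^'n) = (if i = k then perp k x else perp k x + 2 * r * x $ i + r\<^sup>2)"
  unfolding perp_def norm_sq_add_axis
  by (auto simp: axis_def power2_eq_square algebra_simps)

lemma perp_nonneg: "0 \<le> perp k x"
  unfolding perp_def using component_le_norm_cart[of x k]
  by (simp add: abs_le_square_iff[symmetric])

lemma continuous_on_perp [continuous_intros]:
  "continuous_on A f \<Longrightarrow> continuous_on A (\<lambda>z. perp k (f z))"
  unfolding perp_def by (intro continuous_intros)

lemma eventually_nhds_add:
  fixes y :: real
  assumes "\<forall>\<^sub>F r in nhds y. P r"
  shows "\<forall>\<^sub>F r in nhds 0. P (y + r)"
proof -
  obtain e where "e > 0" "\<And>r. \<bar>r - y\<bar> < e \<Longrightarrow> P r"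
    using assms unfolding eventually_nhds_metric dist_real_def by auto
  then show ?thesis unfolding eventually_nhds_metric dist_real_def
    by (intro exI[of _ e]) auto
qed

lemma DERIV_add_arg:
  fixes F :: "real \<Rightarrow> real"
  assumes "(F has_real_derivative c) (at (y + r))"
  shows "((\<lambda>r. F (y + r)) has_real_derivative c) (at r)"
  using DERIV_shift[of F c r y] assms by (simp add: add.commute)

text \<open>The common shape of the barriers for the slab comparison and for the global bounds: the
  dependence on \<open>x $ k\<close> is free, and growth along the hyperplanes costs only
  \<open>2 * G\<close> in each tangential direction.\<close>

lemma jet_perp:
  fixes F G :: "real \<Rightarrow> real \<Rightarrow> real" and x :: "real^'n"
  assumes "((\<lambda>s. F (x $ k) s) has_real_derivative Ft) (at t)"
    and "((\<lambda>s. G (x $ k) s) has_real_derivative Gt) (at t)"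
    and F1: "\<forall>\<^sub>F r in nhds (x $ k). ((\<lambda>r. F r t) has_real_derivative F1 r) (at r)"
    and F2: "(F1 has_real_derivative F2) (at (x $ k))"
    and G1: "\<forall>\<^sub>F r in nhds (x $ k). ((\<lambda>r. G r t) has_real_derivative G1 r) (at r)"
    and G2: "(G1 has_real_derivative G2) (at (x $ k))"
  shows "jet (\<lambda>x t. F (x $ k) t + G (x $ k) t * perp k x) x t (Ft + Gt * perp k x)
           (\<lambda>i. if i = k then F2 + G2 * perp k x else 2 * G (x $ k) t)"
  unfolding jet_def
proof (intro conjI allI)
  show "((\<lambda>s. F (x $ k) s + G (x $ k) s * perp k x) has_real_derivative Ft + Gt * perp k x) (at t)"
    using assms(1,2) by (auto intro!: derivative_eq_intros)
  fix i
  show "\<exists>q. (\<forall>\<^sub>F r in nhds 0. ((\<lambda>r. F ((x + r *\<^sub>R axis i 1) $ k) t + G ((x + r *\<^sub>R axis i 1) $ k) t * perp k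
      (x + r *\<^sub>R axis i 1)) has_real_derivative q r) (at r)) \<and>
              (q has_real_derivative (if i = k then F2 + G2 * perp k x else 2 * G (x $ k) t)) (at 0)"
  proof (cases "i = k")
    case True
    have "\<forall>\<^sub>F r in nhds 0. ((\<lambda>r. F (x $ k + r) t + G (x $ k + r) t * perp k x) has_real_derivative
        F1 (x $ k + r) + G1 (x $ k + r) * perp k x) (at r)"
      using eventually_nhds_add[OF F1] eventually_nhds_add[OF G1]
    proof eventually_elim
      case (elim r)
      from DERIV_add_arg[OF elim(1)] DERIV_add_arg[OF elim(2)] show ?case
        by (auto intro!: derivative_eq_intros)
    qed
    moreover have "((\<lambda>r. F1 (x $ k + r) + G1 (x $ k + r) * perp k x) has_real_derivative F2 + G2 * perp k x) (at 0)"
      using DERIV_add_arg[of F1 F2 "x $ k" 0] DERIV_add_arg[of G1 G2 "x $ k" 0] F2 G2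
      by (auto intro!: derivative_eq_intros)
    ultimately show ?thesis using True
      by (intro exI[of _ "\<lambda>r. F1 (x $ k + r) + G1 (x $ k + r) * perp k x"]) (simp add: perp_add_axis)
  next
    case False
    have e: "(axis i (1::real)) $ k = 0" using False by (simp add: axis_def)
    show ?thesis using False
      by (intro exI[of _ "\<lambda>r. G (x $ k) t * (2 * x $ i + 2 * r)"] conjI always_eventually allI)
        (auto simp: perp_add_axis e intro!: derivative_eq_intros)
  qed
qed

lemma sum_if_eq_le:
  fixes p q :: real and k :: "'n::finite"
  assumes "0 \<le> q"
  shows "(\<Sum>i\<in>UNIV. if i = k then p else q) \<le> p + CARD('n) * q"
proof -
  have "(\<Sum>i\<in>UNIV. if i = k then p else q) = p + (\<Sum>i\<in>UNIV - {k}. if i = k then p else q)"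
    by (subst sum.remove[of _ k]) auto
  also have "(\<Sum>i\<in>UNIV - {k}. if i = k then p else q) = (\<Sum>i\<in>UNIV - {k}. q)"
    by (intro sum.cong) auto
  also have "\<dots> \<le> (\<Sum>i\<in>(UNIV::'n set). q)" using assms by (intro sum_mono2) auto
  finally show ?thesis by simp
qed

section \<open>Comparison on thin slabs\<close>

definition half_cont :: "'n \<Rightarrow> (real^'n \<Rightarrow> real \<Rightarrow> real) \<Rightarrow> bool" where
  "half_cont k w \<longleftrightarrow> continuous_on ({x. 0 \<le> x $ k} \<times> {0<..}) (\<lambda>(x, t). w x t)"

text \<open>Written for a component living on \<open>0 \<le> x $ k\<close>. Exchanging \<mu> with
  \<nu> and \<open>u\<close> with \<open>v\<close> gives the condition of the other component, so
  that every later lemma serves both.\<close>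

definition flux :: "'n \<Rightarrow> real \<Rightarrow> real \<Rightarrow> real \<Rightarrow> (real^'n \<Rightarrow> real \<Rightarrow> real) \<Rightarrow> (real^'n \<Rightarrow> real \<Rightarrow> real) \<Rightarrow> bool" where
  "flux k D \<mu> \<nu> u v \<longleftrightarrow> (\<forall>x t. x $ k = 0 \<longrightarrow> 0 < t \<longrightarrow>
     (\<exists>p. ((\<lambda>s. u (x + s *\<^sub>R axis k 1) t) has_real_derivative p) (at 0 within {0..}) \<and>
          - D * p = \<nu> * v x t - \<mu> * u x t))"

text \<open>The starting time may depend on the ball: a solution enters the range on which a
  truncated reaction is exact at a time depending on the ball.\<close>

definition evpde :: "'n::finite \<Rightarrow> real \<Rightarrow> (real \<Rightarrow> real) \<Rightarrow> (real^'n \<Rightarrow> real \<Rightarrow> real) \<Rightarrow> bool" where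
  "evpde k D g w \<longleftrightarrow> (\<forall>R. \<exists>T. \<forall>x t. 0 < x $ k \<longrightarrow> norm x \<le> R \<longrightarrow> T \<le> t \<longrightarrow>
     (\<exists>a b. jet w x t a b \<and> a - D * sum b UNIV = g (w x t)))"

text \<open>The slack \<epsilon> makes the set of admissible \<open>c\<close> closed, so that its
  infimum is again admissible.\<close>

definition ub :: "'n::finite \<Rightarrow> (real^'n \<Rightarrow> real \<Rightarrow> real) \<Rightarrow> real \<Rightarrow> real \<Rightarrow> bool" where
  "ub k w c y \<longleftrightarrow> (\<forall>R. \<forall>\<epsilon>>0. \<exists>T. \<forall>x t. x $ k = y \<longrightarrow> norm x \<le> R \<longrightarrow> T \<le> t \<longrightarrow> w x t \<le> c + \<epsilon>)"

lemma compact_strip: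
  assumes "0 \<le> y1"
  shows "compact {x::real^'n. y1 \<le> x $ k \<and> x $ k \<le> y2 \<and> perp k x \<le> \<rho>}" (is "compact ?S")
proof -
  have "closed ?S"
    by (intro closed_Collect_conj closed_Collect_le continuous_intros)
  moreover have "norm x \<le> sqrt (\<rho> + y2\<^sup>2)" if "x \<in> ?S" for x
  proof (rule real_le_rsqrt)
    have "(x $ k)\<^sup>2 \<le> y2\<^sup>2" using that assms by (intro power_mono) auto
    then show "(norm x)\<^sup>2 \<le> \<rho> + y2\<^sup>2" using that unfolding perp_def by auto
  qed
  then have "bounded ?S" unfolding bounded_iff by blast
  ultimately show ?thesis by (rule compact_eq_bounded_closed[THEN iffD2, OF conjI, rotated])
qed

lemma dist_add_axis [simp]: "dist (x + r *\<^sub>R axis i 1) (x::real^'n) = \<bar>r\<bar>"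
  by (simp add: dist_norm norm_axis_1)

lemma open_axis_nbhd:
  assumes "open U" "x \<in> U"
  obtains e where "e > 0" "\<And>i r. \<bar>r\<bar> < e \<Longrightarrow> x + r *\<^sub>R axis i 1 \<in> (U :: (real^'n) set)"
  using assms unfolding open_dist by (metis dist_add_axis)

text \<open>The barrier is \<phi> plus a concave factor \<open>c\<close> times a quantity
  \<open>P\<close> which decays in time to \<epsilon> and grows along the slab. In a thin slab the
  curvature of \<open>c\<close> yields more than the reaction can consume. The inequality for
  \<open>g\<close> is one-sided and has its own constant \<open>L\<close>; for affine \<phi> and a
  reaction of constant sign, \<open>L = 0\<close> lifts the restriction on the width.\<close>

lemma slab_comparison:
  fixes w v :: "real^'n::finite \<Rightarrow> real \<Rightarrow> real" and \<phi> \<phi>1 \<phi>2 g :: "real \<Rightarrow> real"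
  assumes "0 < D" and cont: "half_cont k w" and pde: "evpde k D g w"
    and bd: "\<And>x t. 0 \<le> x $ k \<Longrightarrow> 0 < t \<Longrightarrow> w x t \<le> C"
    and y: "0 \<le> y1" "y1 < y2"
    and d1: "\<And>y. y1 \<le> y \<Longrightarrow> y \<le> y2 \<Longrightarrow> (\<phi> has_real_derivative \<phi>1 y) (at y)"
    and d2: "\<And>y. y1 \<le> y \<Longrightarrow> y \<le> y2 \<Longrightarrow> (\<phi>1 has_real_derivative \<phi>2 y) (at y)"
    and L: "0 \<le> L" "L * (y2 - y1)\<^sup>2 \<le> D / 2"
    and super: "\<And>y s. y1 < y \<Longrightarrow> y < y2 \<Longrightarrow> \<phi> y \<le> s \<Longrightarrow> g s \<le> - D * \<phi>2 y + L * (s - \<phi> y)"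
    and right: "ub k w (\<phi> y2) y2"
    and left: "ub k w (\<phi> y1) y1 \<or>
      (y1 = 0 \<and> 0 < \<mu> \<and> 0 < \<nu> \<and> flux k D \<mu> \<nu> w v \<and> ub k v b 0 \<and> \<nu> * b - \<mu> * \<phi> 0 \<le> - D * \<phi>1 0)"
    and "0 < \<epsilon>0"
  shows "\<exists>T. \<forall>x t. y1 \<le> x $ k \<longrightarrow> x $ k \<le> y2 \<longrightarrow> norm x \<le> R0 \<longrightarrow> T \<le> t \<longrightarrow> w x t \<le> \<phi> (x $ k) + \<epsilon>0"
proof -
  define len where "len = y2 - y1"
  \<comment> \<open>Concave, between 1 and 2, with slope 0 at \<open>y1\<close>: the correction does
    not disturb the flux condition when \<open>y1 = 0\<close>.\<close>
  define c where "c = (\<lambda>y. 2 - ((y - y1) / len)\<^sup>2)"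
  \<comment> \<open>Thinness of the slab now reads \<open>L \<le> \<beta>\<close>; the same \<beta>
    is used as rate of decay in time.\<close>
  define \<beta> where "\<beta> = D / (2 * len\<^sup>2)"
  \<comment> \<open>At late times \<open>P \<le> 4 * \<epsilon>\<close>, and
    \<open>c \<le> 2\<close>; hence the 8.\<close>
  define \<epsilon> where "\<epsilon> = \<epsilon>0 / 8"
  define N where "N = real CARD('n)"
  have "len > 0" "\<epsilon> > 0" "N > 0" "\<beta> > 0"
    using y assms(1) \<open>0 < \<epsilon>0\<close> by (auto simp: len_def \<epsilon>_def N_def \<beta>_def)
  have c: "1 \<le> c y" "c y \<le> 2" if "y1 \<le> y" "y \<le> y2" for y
  proof -
    have "((y - y1) / len)\<^sup>2 \<le> 1"
      using that \<open>len > 0\<close> by (intro power_le_one) (auto simp: len_def)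
    then show "1 \<le> c y" "c y \<le> 2" by (auto simp: c_def)
  qed
  have "continuous_on {y1..y2} \<phi>"
    by (intro continuous_at_imp_continuous_on ballI) (meson DERIV_isCont d1 atLeastAtMost_iff)
  then have contphi: "continuous_on {y1..y2} \<phi>" .
  have "\<exists>M. \<forall>z\<in>{y1..y2}. M \<le> \<phi> z"
    using continuous_attains_inf[OF compact_Icc _ contphi] y by fastforce
  then obtain M where M: "\<And>z. y1 \<le> z \<Longrightarrow> z \<le> y2 \<Longrightarrow> M \<le> \<phi> z" by (metis atLeastAtMost_iff)
  define A where "A = max 1 (C - M)"
  have "A > 0" by (auto simp: A_def)
  \<comment> \<open>The first bound keeps the tangential Laplacian below the gain
    \<open>\<beta> * \<epsilon>\<close>. The second places the ball of radius \<open>R0\<close>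
    inside \<open>perp k x \<le> \<rho>\<close> and keeps the tangential term below \<epsilon> on
    it.\<close>
  define \<kappa> where "\<kappa> = min (\<beta> * \<epsilon> / (4 * N * D)) (min 1 \<epsilon> / (R0\<^sup>2 + 1))"
  have "\<kappa> > 0" unfolding \<kappa>_def using \<open>\<epsilon> > 0\<close> \<open>\<beta> > 0\<close> \<open>N > 0\<close> \<open>D > 0\<close>
    by (auto intro!: divide_pos_pos add_nonneg_pos)
  have \<kappa>1: "2 * N * D * \<kappa> < \<beta> * \<epsilon>"
  proof -
    have "2 * N * D * \<kappa> \<le> 2 * N * D * (\<beta> * \<epsilon> / (4 * N * D))"
      using \<open>N > 0\<close> \<open>D > 0\<close> by (intro mult_left_mono) (auto simp: \<kappa>_def)
    also have "\<dots> = \<beta> * \<epsilon> / 2" using \<open>N > 0\<close> \<open>D > 0\<close> by simp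
    also have "\<dots> < \<beta> * \<epsilon>" using \<open>\<beta> > 0\<close> \<open>\<epsilon> > 0\<close> by simp
    finally show ?thesis .
  qed
  have \<kappa>2: "\<kappa> * R0\<^sup>2 \<le> min 1 \<epsilon>"
  proof -
    have pos: "R0\<^sup>2 + 1 > 0" by (simp add: add_nonneg_pos)
    have "\<kappa> * R0\<^sup>2 \<le> (min 1 \<epsilon> / (R0\<^sup>2 + 1)) * (R0\<^sup>2 + 1)"
      using \<open>\<epsilon> > 0\<close> by (intro mult_mono) (auto simp: \<kappa>_def)
    also have "\<dots> = min 1 \<epsilon>" using pos by simp
    finally show ?thesis .
  qed
  \<comment> \<open>On \<open>perp k x = \<rho>\<close> the tangential term alone equals
    \<open>A\<close>, which bounds \<open>w - \<phi>\<close>, so no touching can occur there. In the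
    same way the exponential excludes the initial time.\<close>
  define \<rho> where "\<rho> = A / \<kappa>"
  define Rx where "Rx = sqrt (\<rho> + y2\<^sup>2)"
  have Rx: "norm x \<le> Rx" if "0 \<le> x $ k" "x $ k \<le> y2" "perp k x \<le> \<rho>" for x :: "real^'n"
  proof (unfold Rx_def, rule real_le_rsqrt)
    have "(x $ k)\<^sup>2 \<le> y2\<^sup>2" using that by (intro power_mono) auto
    then show "(norm x)\<^sup>2 \<le> \<rho> + y2\<^sup>2" using that(3) unfolding perp_def by linarith
  qed
  obtain T1 where T1: "\<And>x t. 0 < x $ k \<Longrightarrow> norm x \<le> Rx \<Longrightarrow> T1 \<le> t \<Longrightarrow>
     \<exists>a b. jet w x t a b \<and> a - D * sum b UNIV = g (w x t)"
    using pde unfolding evpde_def by meson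
  obtain T2 where T2: "\<And>x t. x $ k = y2 \<Longrightarrow> norm x \<le> Rx \<Longrightarrow> T2 \<le> t \<Longrightarrow> w x t \<le> \<phi> y2 + \<epsilon> / 2"
    using right \<open>\<epsilon> > 0\<close> unfolding ub_def by (meson half_gt_zero)
  have "\<exists>T3. \<forall>x t. x $ k = y1 \<longrightarrow> norm x \<le> Rx \<longrightarrow> T3 \<le> t \<longrightarrow> w x t \<le> \<phi> y1 + \<epsilon> / 2 \<or>
      (y1 = 0 \<and> 0 < \<mu> \<and> 0 < \<nu> \<and> flux k D \<mu> \<nu> w v \<and> v x t \<le> b + \<mu> * \<epsilon> / (2 * \<nu>) \<and> \<nu> * b - \<mu> * \<phi> 0 \<le> - D * \<phi>1 0)"
    using left
  proof
    assume "ub k w (\<phi> y1) y1"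
    then show ?thesis using \<open>\<epsilon> > 0\<close> unfolding ub_def by (meson half_gt_zero)
  next
    assume l: "y1 = 0 \<and> 0 < \<mu> \<and> 0 < \<nu> \<and> flux k D \<mu> \<nu> w v \<and> ub k v b 0 \<and> \<nu> * b - \<mu> * \<phi> 0 \<le> - D * \<phi>1 0"
    then have "\<mu> * \<epsilon> / (2 * \<nu>) > 0" using \<open>\<epsilon> > 0\<close> by simp
    with l obtain T3 where "\<And>x t. x $ k = 0 \<Longrightarrow> norm x \<le> Rx \<Longrightarrow> T3 \<le> t \<Longrightarrow> v x t \<le> b + \<mu> * \<epsilon> / (2 * \<nu>)"
      unfolding ub_def by meson
    with l show ?thesis by blast
  qed
  then obtain T3 where T3: "\<And>x t. x $ k = y1 \<Longrightarrow> norm x \<le> Rx \<Longrightarrow> T3 \<le> t \<Longrightarrow> w x t \<le> \<phi> y1 + \<epsilon> / 2 \<or>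
      (y1 = 0 \<and> 0 < \<mu> \<and> 0 < \<nu> \<and> flux k D \<mu> \<nu> w v \<and> v x t \<le> b + \<mu> * \<epsilon> / (2 * \<nu>) \<and> \<nu> * b - \<mu> * \<phi> 0 \<le> - D * \<phi>1 0)"
    by blast
  define T where "T = max 1 (max T1 (max T2 T3))"
  have T: "1 \<le> T" "T1 \<le> T" "T2 \<le> T" "T3 \<le> T" by (auto simp: T_def)
  define P where "P = (\<lambda>x t. A * exp (- \<beta> * (t - T)) + \<epsilon> + \<kappa> * perp k (x::real^'n))"
  have Pge: "\<epsilon> \<le> P x t" for x t
    using \<open>A > 0\<close> \<open>\<kappa> > 0\<close> perp_nonneg[of k x] by (auto simp: P_def)
  have main: "w x1 t1 \<le> \<phi> (x1 $ k) + c (x1 $ k) * P x1 t1"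
    if x1: "y1 \<le> x1 $ k" "x1 $ k \<le> y2" "perp k x1 \<le> \<rho>" and t1: "T \<le> t1" for x1 t1
  proof (rule ccontr)
    assume viol: "\<not> w x1 t1 \<le> \<phi> (x1 $ k) + c (x1 $ k) * P x1 t1"
    define S where "S = {x::real^'n. y1 \<le> x $ k \<and> x $ k \<le> y2 \<and> perp k x \<le> \<rho>}"
    \<comment> \<open>Maximising the quotient instead of the difference lifts the barrier by
      \<theta> times \<open>c\<close>, so it keeps its form with \<open>P + \<theta>\<close> in
      place of \<open>P\<close>.\<close>
    define H where "H = (\<lambda>(x, t). (w x t - \<phi> (x $ k)) / c (x $ k) - P x t)"
    have inS: "x \<in> S \<longleftrightarrow> y1 \<le> x $ k \<and> x $ k \<le> y2 \<and> perp k x \<le> \<rho>" for x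
      by (simp add: S_def)
    have "compact (S \<times> {T..t1})"
      unfolding S_def by (intro compact_Times compact_strip y compact_Icc)
    moreover have "(x1, t1) \<in> S \<times> {T..t1}" using x1 t1 by (auto simp: inS)
    moreover have "continuous_on (S \<times> {T..t1}) H"
    proof -
      have "continuous_on (S \<times> {T..t1}) (\<lambda>z. w (fst z) (snd z))"
        by (rule continuous_on_subset[OF cont[unfolded half_cont_def case_prod_beta]])
          (use y T in \<open>auto simp: S_def\<close>)
      moreover have "continuous_on (S \<times> {T..t1}) (\<lambda>z. \<phi> (fst z $ k))"
        by (rule continuous_on_compose2[OF contphi]) (auto simp: S_def intro!: continuous_intros)
      moreover have "c (fst z $ k) \<noteq> 0" if "z \<in> S \<times> {T..t1}" for z
        using that c(1)[of "fst z $ k"] by (auto simp: S_def)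
      ultimately show ?thesis
        unfolding H_def case_prod_beta P_def
        using \<open>len > 0\<close> by (intro continuous_intros) (auto simp: c_def intro!: continuous_intros)
    qed
    ultimately obtain xs ts where s: "xs \<in> S" "T \<le> ts" "ts \<le> t1"
      and mx: "\<And>x t. x \<in> S \<Longrightarrow> T \<le> t \<Longrightarrow> t \<le> t1 \<Longrightarrow> H (x, t) \<le> H (xs, ts)"
      using continuous_attains_sup[of "S \<times> {T..t1}" H] by fastforce
    define \<theta> where "\<theta> = H (xs, ts)"
    have "0 < H (x1, t1)"
      using viol c(1)[OF x1(1,2)] by (auto simp: H_def field_simps)
    also have "H (x1, t1) \<le> \<theta>" unfolding \<theta>_def using x1 t1 by (intro mx) (auto simp: inS)
    finally have "\<theta> > 0" .
    have le: "w x t \<le> \<phi> (x $ k) + c (x $ k) * (P x t + \<theta>)" if "x \<in> S" "T \<le> t" "t \<le> t1" for x t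
    proof -
      have "H (x, t) \<le> \<theta>" using mx[OF that] by (simp add: \<theta>_def)
      then have "(w x t - \<phi> (x $ k)) / c (x $ k) \<le> P x t + \<theta>" by (simp add: H_def)
      moreover have "0 < c (x $ k)" using c(1)[of "x $ k"] that by (auto simp: inS)
      ultimately show ?thesis by (simp add: pos_divide_le_eq mult.commute)
    qed
    have eq: "w xs ts = \<phi> (xs $ k) + c (xs $ k) * (P xs ts + \<theta>)"
      using c(1)[of "xs $ k"] s unfolding \<theta>_def H_def by (auto simp: inS field_simps)
    define X where "X = P xs ts + \<theta>"
    have X: "\<epsilon> < X" using Pge[of xs ts] \<open>\<theta> > 0\<close> by (auto simp: X_def)
    have "0 < ts" using s T by auto
    have w_le: "w xs ts - \<phi> (xs $ k) \<le> A"
      using bd[of xs ts] M[of "xs $ k"] s y \<open>0 < ts\<close> unfolding A_def inS by auto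
    have cX: "X \<le> c (xs $ k) * X"
      using c(1)[of "xs $ k"] s X \<open>\<epsilon> > 0\<close> by (simp add: inS)
    have XA: "X < A + \<epsilon>" using w_le cX \<open>\<epsilon> > 0\<close> eq by (auto simp: X_def[symmetric])
    have ts: "T < ts"
    proof (rule ccontr)
      assume "\<not> T < ts"
      then have "ts = T" using s by simp
      then have "A + \<epsilon> \<le> X" using \<open>\<theta> > 0\<close> \<open>\<kappa> > 0\<close> perp_nonneg[of k xs] by (auto simp: X_def P_def)
      with XA show False by simp
    qed
    have px: "perp k xs < \<rho>"
    proof (rule ccontr)
      assume "\<not> perp k xs < \<rho>"
      then have "perp k xs = \<rho>" using s by (simp add: inS)
      then have "A + \<epsilon> \<le> X" using \<open>\<theta> > 0\<close> \<open>\<kappa> > 0\<close> \<open>A > 0\<close> by (auto simp: X_def P_def \<rho>_def)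
      with XA show False by simp
    qed
    have nx: "norm xs \<le> Rx" using s y by (intro Rx) (auto simp: inS)
    have not_small: "\<not> w xs ts \<le> \<phi> (xs $ k) + \<epsilon> / 2"
      using eq cX X \<open>\<epsilon> > 0\<close> unfolding X_def[symmetric] by linarith
    have "xs $ k \<noteq> y2" using T2[of xs ts] nx not_small s T by auto
    then have y2: "xs $ k < y2" using s by (auto simp: inS)
    have dc: "(c has_real_derivative (- 2 / len\<^sup>2 * (y - y1))) (at y)" for y
      unfolding c_def using \<open>len > 0\<close> by (auto intro!: derivative_eq_intros simp: power2_eq_square field_simps)
    have dlin: "((\<lambda>r. q * (r - y1)) has_real_derivative q) (at y)" for q y
      by (auto intro!: derivative_eq_intros)
    show False
    proof (cases "xs $ k = y1")
      case True
      with T3[of xs ts] nx not_small s T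
      have r: "y1 = 0" "0 < \<mu>" "0 < \<nu>" "flux k D \<mu> \<nu> w v" "v xs ts \<le> b + \<mu> * \<epsilon> / (2 * \<nu>)"
        "\<nu> * b - \<mu> * \<phi> 0 \<le> - D * \<phi>1 0" by auto
      from r(4) True r(1) \<open>0 < ts\<close> obtain p where
        p: "((\<lambda>s. w (xs + s *\<^sub>R axis k 1) ts) has_real_derivative p) (at 0 within {0..})"
           "- D * p = \<nu> * v xs ts - \<mu> * w xs ts"
        unfolding flux_def by blast
      have "((\<lambda>s. w (xs + s *\<^sub>R axis k 1) ts - (\<phi> s + c s * X)) has_real_derivative p - (\<phi>1 0 + 0 * X)) (at 0 within {0..})"
        using d1[of 0] dc[of 0] r(1) y
        by (intro DERIV_diff DERIV_add p DERIV_cmult_right) (auto intro: has_field_derivative_at_within)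
      then have "p - (\<phi>1 0 + 0 * X) \<le> 0"
      proof (rule derivative_nonpos_right_within[OF _ y(2)[unfolded r(1)]])
        fix s assume "0 \<le> s" "s < y2"
        then have "xs + s *\<^sub>R axis k 1 \<in> S"
          using True r(1) px by (auto simp: inS perp_add_axis)
        then have "w (xs + s *\<^sub>R axis k 1) ts \<le> \<phi> s + c s * (P (xs + s *\<^sub>R axis k 1) ts + \<theta>)"
          using le[of "xs + s *\<^sub>R axis k 1" ts] s ts True r(1) by (auto simp: axis_def)
        moreover have "P (xs + s *\<^sub>R axis k 1) ts + \<theta> = X" by (simp add: X_def P_def perp_add_axis)
        ultimately show "w (xs + s *\<^sub>R axis k 1) ts - (\<phi> s + c s * X) \<le> w (xs + 0 *\<^sub>R axis k 1) ts - (\<phi> 0 + c 0 * X)"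
          using eq True r(1) by (auto simp: X_def)
      qed
      \<comment> \<open>Touching at the interface: the slope bounds the flux from below, whereas the
        value \<open>\<phi> 0 + 2 * X\<close> lowers it by \<open>2 * \<mu> * X\<close>, which
        exceeds the \<open>\<mu> * \<epsilon> / 2\<close> contributed by the slack in
        \<open>v\<close>.\<close>
      then have "D * p \<le> D * \<phi>1 0" using \<open>D > 0\<close> by simp
      moreover have "w xs ts = \<phi> 0 + 2 * X" using eq True r(1) by (simp add: X_def c_def)
      moreover have "\<nu> * v xs ts \<le> \<nu> * b + \<mu> * \<epsilon> / 2"
        using mult_left_mono[OF r(5), of \<nu>] r(3) by (simp add: distrib_left)
      moreover have "\<mu> * \<epsilon> / 2 < \<mu> * (2 * X)" using r(2) X \<open>\<epsilon> > 0\<close> by simp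
      ultimately show False using p(2) r(6) by (simp add: algebra_simps)
    next
      case False
      then have y1: "y1 < xs $ k" using s by (auto simp: inS)
      obtain a b where ab: "jet w xs ts a b" "a - D * sum b UNIV = g (w xs ts)"
        using T1[of xs ts] nx s T y y1 by fastforce
      define E where "E = A * exp (- \<beta> * (ts - T))"
      define F where "F = (\<lambda>y t. \<phi> y + c y * (A * exp (- \<beta> * (t - T)) + \<epsilon> + \<theta>))"
      define G where "G = (\<lambda>y (t::real). c y * \<kappa>)"
      have ev: "\<forall>\<^sub>F r in nhds (xs $ k). y1 < r \<and> r < y2"
        by (intro eventually_conj order_tendstoD[OF filterlim_ident]) (use y1 y2 in auto)
      have J: "jet (\<lambda>x t. F (x $ k) t + G (x $ k) t * perp k x) xs ts
         (c (xs $ k) * (- \<beta> * E) + 0 * perp k xs)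
         (\<lambda>i. if i = k then (\<phi>2 (xs $ k) + (- 2 / len\<^sup>2) * (E + \<epsilon> + \<theta>)) + (- 2 / len\<^sup>2 * \<kappa>) * perp k xs else 2 * G
             (xs $ k) ts)"
      proof (rule jet_perp)
        show "((\<lambda>s. F (xs $ k) s) has_real_derivative c (xs $ k) * (- \<beta> * E)) (at ts)"
          unfolding F_def E_def by (auto intro!: derivative_eq_intros)
        show "((\<lambda>s. G (xs $ k) s) has_real_derivative 0) (at ts)"
          unfolding G_def by auto
        show "\<forall>\<^sub>F r in nhds (xs $ k). ((\<lambda>r. F r ts) has_real_derivative
            \<phi>1 r + (- 2 / len\<^sup>2 * (r - y1)) * (E + \<epsilon> + \<theta>)) (at r)"
          using ev
        proof eventually_elim
          case (elim r)
          then show ?case unfolding F_def E_def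
            by (intro DERIV_add DERIV_cmult_right d1 dc) auto
        qed
        show "((\<lambda>r. \<phi>1 r + (- 2 / len\<^sup>2 * (r - y1)) * (E + \<epsilon> + \<theta>)) has_real_derivative
            \<phi>2 (xs $ k) + (- 2 / len\<^sup>2) * (E + \<epsilon> + \<theta>)) (at (xs $ k))"
          using y1 y2 by (intro DERIV_add d2 DERIV_cmult_right dlin) auto
        show "\<forall>\<^sub>F r in nhds (xs $ k). ((\<lambda>r. G r ts) has_real_derivative (- 2 / len\<^sup>2 * (r - y1)) * \<kappa>) (at r)"
          unfolding G_def by (intro always_eventually allI DERIV_cmult_right dc)
        show "((\<lambda>r. (- 2 / len\<^sup>2 * (r - y1)) * \<kappa>) has_real_derivative - 2 / len\<^sup>2 * \<kappa>) (at (xs $ k))"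
          by (intro DERIV_cmult_right dlin)
      qed
      have FG: "F (x $ k) t + G (x $ k) t * perp k x = \<phi> (x $ k) + c (x $ k) * (P x t + \<theta>)" for x t
        by (simp add: F_def G_def P_def algebra_simps)
      have op: "open {x::real^'n. y1 < x $ k \<and> x $ k < y2 \<and> perp k x < \<rho>}"
        by (intro open_Collect_conj open_Collect_less continuous_intros)
      have mem: "xs \<in> {x::real^'n. y1 < x $ k \<and> x $ k < y2 \<and> perp k x < \<rho>}"
        using y1 y2 px by simp
      obtain e where e: "e > 0" "\<And>i r. \<bar>r\<bar> < e \<Longrightarrow>
          xs + r *\<^sub>R axis i 1 \<in> {x::real^'n. y1 < x $ k \<and> x $ k < y2 \<and> perp k x < \<rho>}"
        using open_axis_nbhd[OF op mem] by blast
      define e' where "e' = min e (ts - T)"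
      have "e' > 0" using e(1) ts by (simp add: e'_def)
      have tl: "w xs t \<le> F (xs $ k) t + G (xs $ k) t * perp k xs" if "ts - e' < t" "t \<le> ts" for t
        unfolding FG using that s by (intro le) (auto simp: e'_def)
      have xl: "w (xs + r *\<^sub>R axis i 1) ts \<le> F ((xs + r *\<^sub>R axis i 1) $ k) ts + G ((xs + r *\<^sub>R axis i 1) $ k) ts *
          perp k (xs + r *\<^sub>R axis i 1)"
        if "\<bar>r\<bar> < e'" for r i
        unfolding FG using that s e(2)[of r i] by (intro le) (auto simp: e'_def inS)
      note touch = jet_touch[OF ab(1) J \<open>e' > 0\<close> _ tl xl]
      have a: "c (xs $ k) * (- \<beta> * E) \<le> a"
        using touch(1) eq unfolding FG by auto
      have "sum b UNIV \<le> (\<Sum>i\<in>UNIV. if i = k then (\<phi>2 (xs $ k) + (- 2 / len\<^sup>2) * (E + \<epsilon> + \<theta>)) + (- 2 / len\<^sup>2 * \<kappa>) *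
          perp k xs else 2 * G (xs $ k) ts)"
        by (intro sum_mono touch(2)) (use eq FG in auto)
      also have "\<dots> \<le> (\<phi>2 (xs $ k) + (- 2 / len\<^sup>2) * (E + \<epsilon> + \<theta>)) + (- 2 / len\<^sup>2 * \<kappa>) * perp k xs + N * (2 * G (xs $ k) ts)"
        unfolding N_def using c(1)[of "xs $ k"] y1 y2 \<open>\<kappa> > 0\<close>
        by (intro sum_if_eq_le) (auto simp: G_def)
      also have "\<dots> = \<phi>2 (xs $ k) - 2 / len\<^sup>2 * X + 2 * N * (c (xs $ k) * \<kappa>)"
        by (simp add: X_def P_def E_def G_def algebra_simps add_divide_distrib)
      finally have "D * sum b UNIV \<le> D * (\<phi>2 (xs $ k) - 2 / len\<^sup>2 * X + 2 * N * (c (xs $ k) * \<kappa>))"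
        using \<open>D > 0\<close> by simp
      also have "\<dots> = D * \<phi>2 (xs $ k) - 4 * \<beta> * X + c (xs $ k) * (2 * N * D * \<kappa>)"
        using \<open>len > 0\<close> by (simp add: \<beta>_def field_simps)
      finally have S: "D * sum b UNIV \<le> D * \<phi>2 (xs $ k) - 4 * \<beta> * X + c (xs $ k) * (2 * N * D * \<kappa>)" .
      have "g (w xs ts) \<le> - D * \<phi>2 (xs $ k) + L * (w xs ts - \<phi> (xs $ k))"
        using eq cX X \<open>\<epsilon> > 0\<close> by (intro super y1 y2) (auto simp: X_def[symmetric])
      also have "w xs ts - \<phi> (xs $ k) = c (xs $ k) * X" using eq by (simp add: X_def)
      also have "L * (c (xs $ k) * X) \<le> \<beta> * (c (xs $ k) * X)"
      proof (rule mult_right_mono)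
        show "L \<le> \<beta>" using L \<open>len > 0\<close> by (simp add: \<beta>_def field_simps len_def)
        show "0 \<le> c (xs $ k) * X" using cX X \<open>\<epsilon> > 0\<close> by simp
      qed
      finally have G1: "g (w xs ts) \<le> - D * \<phi>2 (xs $ k) + c (xs $ k) * (\<beta> * X)" by (simp add: algebra_simps)
      \<comment> \<open>Concavity gained \<open>4 * \<beta> * X\<close> and the reaction takes at
        most \<open>2 * \<beta> * X\<close>. What remains still exceeds the losses from time decay
        and tangential growth.\<close>
      have "c (xs $ k) * (\<beta> * X) \<le> 2 * (\<beta> * X)"
        using c(2)[of "xs $ k"] y1 y2 X \<open>\<epsilon> > 0\<close> \<open>\<beta> > 0\<close> by (intro mult_right_mono) auto
      with a S G1 ab(2) have "c (xs $ k) * (\<beta> * X) \<le> c (xs $ k) * (\<beta> * E) + c (xs $ k) * (2 * N * D * \<kappa>)"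
        by (simp add: algebra_simps)
      then have "c (xs $ k) * (\<beta> * X) \<le> c (xs $ k) * (\<beta> * E + 2 * N * D * \<kappa>)"
        by (simp add: algebra_simps)
      then have "\<beta> * X \<le> \<beta> * E + 2 * N * D * \<kappa>"
        using c(1)[of "xs $ k"] y1 y2 by simp
      moreover have "E + \<epsilon> \<le> X"
        using \<open>\<theta> > 0\<close> \<open>\<kappa> > 0\<close> perp_nonneg[of k xs] by (simp add: X_def P_def E_def)
      then have "\<beta> * E + \<beta> * \<epsilon> \<le> \<beta> * X" using \<open>\<beta> > 0\<close> by (simp add: distrib_left[symmetric])
      ultimately show False using \<kappa>1 by simp
    qed
  qed
  have "((\<lambda>t. A * exp (- \<beta> * (t - T))) \<longlongrightarrow> A * 0) at_top"
    using \<open>\<beta> > 0\<close>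
    by (intro tendsto_intros filterlim_compose[OF exp_at_bot] filterlim_tendsto_neg_mult_at_bot[OF tendsto_const])
      (auto intro: filterlim_tendsto_add_at_top[where c = "-T", OF tendsto_const filterlim_ident, simplified])
  then have "\<forall>\<^sub>F t in at_top. A * exp (- \<beta> * (t - T)) < \<epsilon>"
    using \<open>\<epsilon> > 0\<close> by (auto dest: order_tendstoD(2))
  then obtain T4 where T4: "\<And>t. T4 \<le> t \<Longrightarrow> A * exp (- \<beta> * (t - T)) < \<epsilon>"
    unfolding eventually_at_top_linorder by auto
  show ?thesis
  proof (intro exI[of _ "max T T4"] allI impI)
    fix x :: "real^'n" and t
    assume h: "y1 \<le> x $ k" "x $ k \<le> y2" "norm x \<le> R0" "max T T4 \<le> t"
    have "perp k x \<le> (norm x)\<^sup>2" by (simp add: perp_def)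
    also have "\<dots> \<le> R0\<^sup>2" using h by (intro power_mono) auto
    finally have \<kappa>p: "\<kappa> * perp k x \<le> min 1 \<epsilon>"
      using \<kappa>2 \<open>\<kappa> > 0\<close> by (meson dual_order.trans less_eq_real_def mult_left_mono)
    then have "perp k x \<le> \<rho>"
      using \<open>\<kappa> > 0\<close> by (auto simp: \<rho>_def A_def field_simps)
    then have "w x t \<le> \<phi> (x $ k) + c (x $ k) * P x t" using h by (intro main) auto
    also have "c (x $ k) * P x t \<le> 2 * (4 * \<epsilon>)"
      using T4[of t] h \<kappa>p c[of "x $ k"] Pge[of x t] \<open>\<epsilon> > 0\<close> by (intro mult_mono) (auto simp: P_def)
    finally show "w x t \<le> \<phi> (x $ k) + \<epsilon>0" by (simp add: \<epsilon>_def)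
  qed
qed

section \<open>Global bounds\<close>

definition pde :: "'n::finite \<Rightarrow> real \<Rightarrow> (real \<Rightarrow> real) \<Rightarrow> (real^'n \<Rightarrow> real \<Rightarrow> real) \<Rightarrow> bool" where
  "pde k D g w \<longleftrightarrow> (\<forall>x t. 0 < x $ k \<longrightarrow> 0 < t \<longrightarrow> (\<exists>a b. jet w x t a b \<and> a - D * sum b UNIV = g (w x t)))"

definition init_cont :: "'n \<Rightarrow> (real^'n \<Rightarrow> real \<Rightarrow> real) \<Rightarrow> bool" where
  "init_cont k w \<longleftrightarrow> continuous_on ({x. 0 < x $ k} \<times> {0..}) (\<lambda>(x, t). w x t)"

text \<open>The initial datum need not extend continuously to the interface, so a solution is only bounded near
  the corner \<open>x $ k = 0\<close>, \<open>t = 0\<close>. The reflected heat kernel \<open>hk\<close> is a solution of the heat equation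
  with zero flux, is of order one in the corner for \<open>s\<close> small, and tends to \<open>0\<close> elsewhere as \<open>s \<rightarrow> 0\<close>.\<close>

definition hk :: "real \<Rightarrow> real \<Rightarrow> real \<Rightarrow> real \<Rightarrow> real" where
  "hk D s y t = sqrt s * exp (- y\<^sup>2 / (4 * D * (t + s)) - ln (t + s) / 2)"

lemma hk_t:
  assumes "0 < D" "0 < t + s"
  shows "((\<lambda>t. hk D s y t) has_real_derivative hk D s y t * (y\<^sup>2 / (4 * D * (t + s)\<^sup>2) - 1 / (2 * (t + s)))) (at t)"
proof -
  have "((\<lambda>r. - y\<^sup>2 / (4 * D * r) - ln r / 2) has_real_derivative y\<^sup>2 / (4 * D * r\<^sup>2) - 1 / (2 * r)) (at r)" if "0 < r" for r
    using that assms(1) by (auto intro!: derivative_eq_intros simp: field_simps power2_eq_square)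
  from DERIV_add_arg[OF this[of "s + t"]] assms(2)
  have "((\<lambda>t. - y\<^sup>2 / (4 * D * (t + s)) - ln (t + s) / 2) has_real_derivative y\<^sup>2 / (4 * D * (t + s)\<^sup>2) - 1 /
      (2 * (t + s))) (at t)"
    by (simp add: add.commute)
  from DERIV_cmult[OF DERIV_fun_exp[OF this], of "sqrt s"] show ?thesis
    unfolding hk_def by (simp add: mult.assoc)
qed

lemma hk_y:
  assumes "0 < D" "0 < t + s"
  shows "((\<lambda>y. hk D s y t) has_real_derivative hk D s y t * (- y / (2 * D * (t + s)))) (at y)"
proof -
  define r where "r = t + s"
  have "0 < r" using assms by (simp add: r_def)
  then have "((\<lambda>y. - y\<^sup>2 / (4 * D * r) - ln r / 2) has_real_derivative - y / (2 * D * r)) (at y)"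
    using assms(1) by (auto intro!: derivative_eq_intros simp: field_simps power2_eq_square)
  from DERIV_cmult[OF DERIV_fun_exp[OF this], of "sqrt s"] show ?thesis
    unfolding hk_def r_def by (simp add: mult.assoc)
qed

lemma hk_yy:
  assumes "0 < D" "0 < t + s"
  shows "((\<lambda>y. hk D s y t * (- y / (2 * D * (t + s)))) has_real_derivative
           hk D s y t * (y\<^sup>2 / (4 * D * (t + s)\<^sup>2) - 1 / (2 * (t + s))) / D) (at y)"
proof -
  define r where "r = t + s"
  have "0 < r" using assms by (simp add: r_def)
  have "((\<lambda>y. - y / (2 * D * r)) has_real_derivative - 1 / (2 * D * r)) (at y)"
    by (rule DERIV_cdivide[OF DERIV_minus[OF DERIV_ident]])
  from DERIV_mult[OF hk_y[OF assms] this]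
  have "((\<lambda>y. hk D s y t * (- y / (2 * D * r))) has_real_derivative
     hk D s y t * (- y / (2 * D * r)) * (- y / (2 * D * r)) + - 1 / (2 * D * r) * hk D s y t) (at y)"
    unfolding r_def .
  also have "hk D s y t * (- y / (2 * D * r)) * (- y / (2 * D * r)) + - 1 / (2 * D * r) * hk D s y t =
     hk D s y t * (y\<^sup>2 / (4 * D * r\<^sup>2) - 1 / (2 * r)) / D"
    using \<open>0 < r\<close> assms(1) by (simp add: field_simps power2_eq_square)
  finally show ?thesis unfolding r_def .
qed

lemma hk_nonneg: "0 < s \<Longrightarrow> 0 \<le> hk D s y t"
  by (simp add: hk_def)

lemma exp_minus_half_ln: "0 < x \<Longrightarrow> exp (- ln x / 2) = 1 / sqrt x"
  by (simp add: ln_sqrt[symmetric] exp_minus inverse_eq_divide)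

lemma hk_upper:
  assumes "0 < D" "0 < s" "0 < t"
  shows "hk D s y t \<le> sqrt s / sqrt t"
proof -
  have "exp (- y\<^sup>2 / (4 * D * (t + s)) - ln (t + s) / 2) \<le> exp (- ln t / 2)"
  proof -
    have "ln t \<le> ln (t + s)" using assms by simp
    moreover have "0 \<le> y\<^sup>2 / (4 * D * (t + s))" using assms by simp
    ultimately show ?thesis by simp
  qed
  then show ?thesis using assms exp_minus_half_ln[of t]
    unfolding hk_def by (metis mult_left_mono real_sqrt_ge_zero less_imp_le times_divide_eq_right mult.right_neutral)
qed

lemma hk_lower:
  assumes "0 < D" "0 < s" "0 \<le> t" "t \<le> s" "y\<^sup>2 \<le> s"
  shows "exp (- 1 / (4 * D)) / sqrt 2 \<le> hk D s y t"
proof -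
  have "y\<^sup>2 / (4 * D * (t + s)) \<le> s / (4 * D * s)"
    using assms by (intro frac_le mult_left_mono) auto
  also have "\<dots> = 1 / (4 * D)" using assms by simp
  finally have 1: "y\<^sup>2 / (4 * D * (t + s)) \<le> 1 / (4 * D)" .
  have "ln (t + s) \<le> ln (2 * s)" using assms by simp
  then have "- 1 / (4 * D) - ln (2 * s) / 2 \<le> - y\<^sup>2 / (4 * D * (t + s)) - ln (t + s) / 2"
    using 1 by simp
  then have "sqrt s * exp (- 1 / (4 * D) - ln (2 * s) / 2) \<le> hk D s y t"
    unfolding hk_def using assms by (intro mult_left_mono) auto
  moreover have "exp (- 1 / (4 * D) - ln (2 * s) / 2) = exp (- 1 / (4 * D)) * (1 / sqrt (2 * s))"
    using exp_minus_half_ln[of "2 * s"] assms exp_add[of "- 1 / (4 * D)" "- ln (2 * s) / 2"] by simp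
  ultimately show ?thesis using assms by (simp add: real_sqrt_mult)
qed

text \<open>The two barriers have to agree on the interface although the diffusion constants differ;
  this is why \<open>hk\<close> is normalised without a factor depending on
  \<open>D\<close>.\<close>

lemma hk_at_0: "hk D s 0 t = hk d s 0 t"
  by (simp add: hk_def)

text \<open>The square of \<open>x $ k - 1\<close> has slope -2 at the interface and makes the flux
  inequality strict, \<open>c0 * t\<close> pays for the Laplacian of the quadratic terms, and the
  kernel covers the corner.\<close>

definition bar :: "real \<Rightarrow> real \<Rightarrow> real \<Rightarrow> real \<Rightarrow> real \<Rightarrow> 'n \<Rightarrow> real^'n \<Rightarrow> real \<Rightarrow> real" where
  "bar D \<epsilon> c0 M s k x t = \<epsilon> * (perp k x + (x $ k - 1)\<^sup>2 + 1 + c0 * t) + M * hk D s (x $ k) t"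

text \<open>The constants \<open>\<nu> * A\<close> and \<open>\<mu> * A\<close> balance the flux,
  and so do \<nu> and \<mu> times the common interface value of the two barriers. At the interface
  only the negative slope of \<open>bar\<close> is left over, which is a contradiction. In the
  interior the factor \<open>exp (K * t)\<close> absorbs the reaction.\<close>

lemma global_touch:
  fixes u v :: "real^'n::finite \<Rightarrow> real \<Rightarrow> real"
  assumes pos: "0 < D" "0 < \<mu>" "0 < \<nu>" "0 < \<epsilon>" "0 < \<theta>" "0 \<le> M" "0 < s" "0 \<le> K"
    and c0: "2 * D * (real CARD('n) + 1) < c0"
    and pde: "pde k D g u" and flux: "flux k D \<mu> \<nu> u v"
    and g: "\<And>r. \<nu> * A \<le> r \<Longrightarrow> r \<le> C \<Longrightarrow> g r \<le> K * (r - \<nu> * A)"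
    and xs: "0 \<le> xs $ k" "xs $ k < Y" "perp k xs < \<rho>" "0 < \<tau>" "\<tau> < ts" "ts \<le> T" and uC: "u xs ts \<le> C"
    and le: "\<And>x t. 0 \<le> x $ k \<Longrightarrow> x $ k \<le> Y \<Longrightarrow> perp k x \<le> \<rho> \<Longrightarrow> \<tau> \<le> t \<Longrightarrow> t \<le> T \<Longrightarrow>
        u x t \<le> \<nu> * A + \<nu> * exp (K * t) * (bar D \<epsilon> c0 M s k x t + \<theta>)"
    and lev: "v xs ts \<le> \<mu> * A + \<mu> * exp (K * ts) * (bar d \<epsilon> c0 M s k xs ts + \<theta>)"
    and eq: "u xs ts = \<nu> * A + \<nu> * exp (K * ts) * (bar D \<epsilon> c0 M s k xs ts + \<theta>)"
  shows False
proof -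
  have tpos: "0 < ts" using xs by simp
  have "0 < 2 * D * (real CARD('n) + 1)" using pos by (simp add: add_nonneg_pos)
  then have c0pos: "0 < c0" using c0 by linarith
  show ?thesis
  proof (cases "xs $ k = 0")
    case True
    obtain p where p: "((\<lambda>r. u (xs + r *\<^sub>R axis k 1) ts) has_real_derivative p) (at 0 within {0..})"
       "- D * p = \<nu> * v xs ts - \<mu> * u xs ts"
      using flux True tpos unfolding flux_def by blast
    define \<omega> where "\<omega> = (\<lambda>r. \<nu> * A + \<nu> * exp (K * ts) * (\<epsilon> * (perp k xs + (r - 1)\<^sup>2 + 1 + c0 * ts) + M * hk D s r ts + \<theta>))"
    have "((\<lambda>r. hk D s r ts) has_real_derivative 0) (at 0)"
      using hk_y[of D ts s 0] pos xs by simp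
    then have "(\<omega> has_real_derivative \<nu> * exp (K * ts) * (\<epsilon> * (- 2))) (at 0)"
      unfolding \<omega>_def by (auto intro!: derivative_eq_intros)
    then have "((\<lambda>r. u (xs + r *\<^sub>R axis k 1) ts - \<omega> r) has_real_derivative p - \<nu> * exp (K * ts) * (\<epsilon> * (- 2)))
        (at 0 within {0..})"
      by (intro DERIV_diff p) (rule has_field_derivative_at_within)
    then have "p - \<nu> * exp (K * ts) * (\<epsilon> * (- 2)) \<le> 0"
    proof (rule derivative_nonpos_right_within)
      show "0 < Y" using xs by simp
      fix r assume r: "0 \<le> r" "r < Y"
      have "u (xs + r *\<^sub>R axis k 1) ts \<le> \<omega> r"
        using le[of "xs + r *\<^sub>R axis k 1" ts] True xs r by (simp add: perp_add_axis bar_def \<omega>_def)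
      moreover have "u xs ts = \<omega> 0" using eq True by (simp add: bar_def \<omega>_def)
      ultimately show "u (xs + r *\<^sub>R axis k 1) ts - \<omega> r \<le> u (xs + 0 *\<^sub>R axis k 1) ts - \<omega> 0" by simp
    qed
    moreover have "0 < \<nu> * exp (K * ts) * (\<epsilon> * 2)" using pos by simp
    ultimately have "p < 0" by linarith
    then have "0 < - D * p" using pos by (simp add: mult_pos_neg)
    moreover have "bar d \<epsilon> c0 M s k xs ts = bar D \<epsilon> c0 M s k xs ts"
      using True hk_at_0[of d s ts D] by (simp add: bar_def)
    then have "\<nu> * v xs ts \<le> \<mu> * u xs ts"
      using mult_left_mono[OF lev, of \<nu>] pos unfolding eq by (simp add: algebra_simps)
    ultimately show False using p by simp
  next
    case False
    then have y: "0 < xs $ k" using xs by simp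
    then obtain a b where ab: "jet u xs ts a b" "a - D * sum b UNIV = g (u xs ts)"
      using pde tpos unfolding pde_def by blast
    define E where "E = exp (K * ts)"
    define h where "h = hk D s (xs $ k) ts * ((xs $ k)\<^sup>2 / (4 * D * (ts + s)\<^sup>2) - 1 / (2 * (ts + s)))"
    define F where "F = (\<lambda>y t. \<nu> * A + \<nu> * exp (K * t) * (\<epsilon> * ((y - 1)\<^sup>2 + 1 + c0 * t) + M * hk D s y t + \<theta>))"
    define G where "G = (\<lambda>(y::real) t. \<nu> * exp (K * t) * \<epsilon>)"
    define FF where "FF = \<epsilon> * ((xs $ k - 1)\<^sup>2 + 1 + c0 * ts) + M * hk D s (xs $ k) ts + \<theta>"
    have tp: "0 < ts + s" using pos xs by simp
    have J: "jet (\<lambda>x t. F (x $ k) t + G (x $ k) t * perp k x) xs ts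
       ((\<nu> * E * (K * FF + (\<epsilon> * c0 + M * h))) + (\<nu> * E * K * \<epsilon>) * perp k xs)
       (\<lambda>i. if i = k then \<nu> * E * (\<epsilon> * 2 + M * (h / D)) + 0 * perp k xs else 2 * G (xs $ k) ts)"
    proof (rule jet_perp)
      show "((\<lambda>t. F (xs $ k) t) has_real_derivative \<nu> * E * (K * FF + (\<epsilon> * c0 + M * h))) (at ts)"
        unfolding F_def E_def FF_def h_def
        by (rule derivative_eq_intros hk_t[OF pos(1) tp] refl)+ (simp add: algebra_simps)
      show "((\<lambda>t. G (xs $ k) t) has_real_derivative (\<nu> * E * K * \<epsilon>)) (at ts)"
        unfolding G_def E_def by (auto intro!: derivative_eq_intros)
      show "\<forall>\<^sub>F r in nhds (xs $ k). ((\<lambda>r. F r ts) has_real_derivative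
          \<nu> * E * (\<epsilon> * (2 * (r - 1)) + M * (hk D s r ts * (- r / (2 * D * (ts + s)))))) (at r)"
        unfolding F_def E_def
        by (intro always_eventually allI) (rule derivative_eq_intros hk_y[OF pos(1) tp] refl | simp)+
      show "((\<lambda>r. \<nu> * E * (\<epsilon> * (2 * (r - 1)) + M * (hk D s r ts * (- r / (2 * D * (ts + s)))))) has_real_derivative
          \<nu> * E * (\<epsilon> * 2 + M * (h / D))) (at (xs $ k))"
        unfolding h_def
        by (rule derivative_eq_intros hk_yy[OF pos(1) tp] refl | simp)+
      show "\<forall>\<^sub>F r in nhds (xs $ k). ((\<lambda>r. G r ts) has_real_derivative 0) (at r)"
        unfolding G_def by simp
      show "((\<lambda>r. 0) has_real_derivative 0) (at (xs $ k))" by simp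
    qed
    have FG: "F (x $ k) t + G (x $ k) t * perp k x = \<nu> * A + \<nu> * exp (K * t) * (bar D \<epsilon> c0 M s k x t + \<theta>)" for x t
      by (simp add: F_def G_def bar_def algebra_simps)
    have op: "open {x::real^'n. 0 < x $ k \<and> x $ k < Y \<and> perp k x < \<rho>}"
      by (intro open_Collect_conj open_Collect_less continuous_intros)
    have mem: "xs \<in> {x::real^'n. 0 < x $ k \<and> x $ k < Y \<and> perp k x < \<rho>}" using y xs by simp
    obtain e where e: "e > 0" "\<And>i r. \<bar>r\<bar> < e \<Longrightarrow>
        xs + r *\<^sub>R axis i 1 \<in> {x::real^'n. 0 < x $ k \<and> x $ k < Y \<and> perp k x < \<rho>}"
      using open_axis_nbhd[OF op mem] by blast
    define e' where "e' = min e (ts - \<tau>)"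
    have "e' > 0" using e(1) xs by (simp add: e'_def)
    have tl: "u xs t \<le> F (xs $ k) t + G (xs $ k) t * perp k xs" if "ts - e' < t" "t \<le> ts" for t
      unfolding FG using that xs by (intro le) (auto simp: e'_def)
    have xl: "u (xs + r *\<^sub>R axis i 1) ts \<le> F ((xs + r *\<^sub>R axis i 1) $ k) ts + G ((xs + r *\<^sub>R axis i 1) $ k) ts * perp
        k (xs + r *\<^sub>R axis i 1)"
      if "\<bar>r\<bar> < e'" for r i
      unfolding FG using that xs e(2)[of r i] by (intro le) (auto simp: e'_def)
    note touch = jet_touch[OF ab(1) J \<open>e' > 0\<close> _ tl xl]
    have a: "(\<nu> * E * (K * FF + (\<epsilon> * c0 + M * h))) + (\<nu> * E * K * \<epsilon>) * perp k xs \<le> a"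
      using touch(1) eq unfolding FG by auto
    have "sum b UNIV \<le> (\<Sum>i\<in>UNIV. if i = k then \<nu> * E * (\<epsilon> * 2 + M * (h / D)) + 0 * perp k xs else 2 * G (xs $ k) ts)"
      by (intro sum_mono touch(2)) (use eq FG in auto)
    also have "\<dots> \<le> \<nu> * E * (\<epsilon> * 2 + M * (h / D)) + 0 * perp k xs + CARD('n) * (2 * G (xs $ k) ts)"
      using pos by (intro sum_if_eq_le) (auto simp: G_def)
    finally have "D * sum b UNIV \<le> D * (\<nu> * E * (\<epsilon> * 2 + M * (h / D)) + CARD('n) * (2 * G (xs $ k) ts))"
      using pos by simp
    also have "\<dots> = \<nu> * E * (\<epsilon> * (2 * D * (real CARD('n) + 1)) + M * h)"
      using pos by (simp add: G_def E_def algebra_simps)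
    finally have S: "D * sum b UNIV \<le> \<nu> * E * (\<epsilon> * (2 * D * (real CARD('n) + 1)) + M * h)" .
    have uA: "u xs ts - \<nu> * A = \<nu> * E * (FF + \<epsilon> * perp k xs)"
      unfolding eq by (simp add: bar_def FF_def E_def algebra_simps)
    have "0 \<le> c0 * ts" using c0pos tpos by simp
    then have "0 \<le> FF + \<epsilon> * perp k xs"
      unfolding FF_def using pos perp_nonneg[of k xs] hk_nonneg[of s D "xs $ k" ts] by simp
    then have "0 \<le> \<nu> * E * (FF + \<epsilon> * perp k xs)" using pos by (simp add: E_def)
    then have "g (u xs ts) \<le> K * (u xs ts - \<nu> * A)" using uC uA by (intro g) auto
    also have "\<dots> = \<nu> * E * K * FF + (\<nu> * E * K * \<epsilon>) * perp k xs" unfolding uA by (simp add: algebra_simps)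
    finally have G1: "g (u xs ts) \<le> \<nu> * E * K * FF + (\<nu> * E * K * \<epsilon>) * perp k xs" .
    \<comment> \<open>The kernel solves the heat equation, so its terms cancel. Left over are
      \<open>c0\<close> and the Laplacian: \<open>2 * CARD('n)\<close> from \<open>perp\<close>
      (counted generously) and 2 from the square in \<open>x $ k\<close>.\<close>
    have "\<nu> * E * (\<epsilon> * c0) \<le> \<nu> * E * (\<epsilon> * (2 * D * (real CARD('n) + 1)))"
      using a S G1 ab(2) by (simp add: algebra_simps)
    then show False using c0 pos by (simp add: E_def)
  qed
qed

lemma initial_layer:
  fixes u :: "real^'n::finite \<Rightarrow> real \<Rightarrow> real"
  assumes "init_cont k u" and init: "\<And>x. 0 < x $ k \<Longrightarrow> u x 0 \<le> B" and "0 < \<sigma>" "0 < \<eta>"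
  shows "\<exists>\<delta>>0. \<forall>x t. \<sigma> \<le> x $ k \<longrightarrow> x $ k \<le> Y \<longrightarrow> perp k x \<le> \<rho> \<longrightarrow> 0 \<le> t \<longrightarrow> t \<le> \<delta> \<longrightarrow> u x t \<le> B + \<eta>"
proof -
  define S where "S = {x::real^'n. \<sigma> \<le> x $ k \<and> x $ k \<le> Y \<and> perp k x \<le> \<rho>}"
  have "compact (S \<times> {0..1::real})"
    unfolding S_def using \<open>0 < \<sigma>\<close> by (intro compact_Times compact_strip compact_Icc) simp
  moreover have "continuous_on (S \<times> {0..1}) (\<lambda>(x, t). u x t)"
    by (rule continuous_on_subset[OF assms(1)[unfolded init_cont_def]])
      (use \<open>0 < \<sigma>\<close> in \<open>auto simp: S_def\<close>)
  ultimately have "uniformly_continuous_on (S \<times> {0..1}) (\<lambda>(x, t). u x t)"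
    by (rule compact_uniformly_continuous[rotated])
  then obtain d where d: "d > 0" "\<And>z z'. z \<in> S \<times> {0..1} \<Longrightarrow> z' \<in> S \<times> {0..1} \<Longrightarrow> dist z' z < d \<Longrightarrow>
      dist ((\<lambda>(x, t). u x t) z') ((\<lambda>(x, t). u x t) z) < \<eta>"
    using \<open>0 < \<eta>\<close> unfolding uniformly_continuous_on_def by meson
  show ?thesis
  proof (intro exI[of _ "min 1 d / 2"] conjI allI impI)
    show "0 < min 1 d / 2" using d by simp
    fix x :: "real^'n" and t
    assume h: "\<sigma> \<le> x $ k" "x $ k \<le> Y" "perp k x \<le> \<rho>" "0 \<le> t" "t \<le> min 1 d / 2"
    then have "dist (u x t) (u x 0) < \<eta>"
      using d(2)[of "(x, 0)" "(x, t)"] d(1) by (auto simp: S_def dist_Pair_Pair dist_real_def)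
    moreover have "u x 0 \<le> B" using h \<open>0 < \<sigma>\<close> by (intro init) simp
    ultimately show "u x t \<le> B + \<eta>" by (simp add: dist_real_def)
  qed
qed

text \<open>The slice splits at \<open>sqrt s\<close>: farther out the solution is still close to
  its initial values and \<epsilon> suffices; nearer to the interface the kernel is bounded below,
  and \<open>M\<close> lifts it above \<open>B\<close>.\<close>

lemma bar_slice:
  fixes u :: "real^'n::finite \<Rightarrow> real \<Rightarrow> real"
  assumes "0 < D" "0 < \<nu>" "0 < \<epsilon>" "0 < s" "0 \<le> M" "0 \<le> K" "0 \<le> c0" "0 < \<tau>" "\<tau> \<le> s" "0 \<le> x $ k"
    and M: "B \<le> M * (exp (- 1 / (4 * D)) / sqrt 2)"
    and bd: "u x \<tau> - \<nu> * A \<le> \<nu> * B"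
    and far: "sqrt s \<le> x $ k \<Longrightarrow> u x \<tau> \<le> \<nu> * A + \<nu> * \<epsilon>"
  shows "u x \<tau> \<le> \<nu> * A + \<nu> * exp (K * \<tau>) * bar D \<epsilon> c0 M s k x \<tau>"
proof -
  have hk: "0 \<le> M * hk D s (x $ k) \<tau>" using hk_nonneg assms by simp
  have q: "\<epsilon> * 1 \<le> \<epsilon> * (perp k x + (x $ k - 1)\<^sup>2 + 1 + c0 * \<tau>)"
    using assms perp_nonneg[of k x] by (intro mult_left_mono) auto
  have b: "0 \<le> bar D \<epsilon> c0 M s k x \<tau>" unfolding bar_def using hk q assms by linarith
  have "u x \<tau> - \<nu> * A \<le> \<nu> * bar D \<epsilon> c0 M s k x \<tau>"
  proof (cases "sqrt s \<le> x $ k")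
    case True
    have "\<epsilon> \<le> bar D \<epsilon> c0 M s k x \<tau>" unfolding bar_def using hk q by linarith
    then have "\<nu> * \<epsilon> \<le> \<nu> * bar D \<epsilon> c0 M s k x \<tau>" using assms by simp
    then show ?thesis using far[OF True] by linarith
  next
    case False
    then have "(x $ k)\<^sup>2 \<le> s"
      using assms by (metis less_imp_le linorder_not_le power_mono real_sqrt_pow2)
    then have "M * (exp (- 1 / (4 * D)) / sqrt 2) \<le> M * hk D s (x $ k) \<tau>"
      using assms by (intro mult_left_mono hk_lower) auto
    then have "B \<le> bar D \<epsilon> c0 M s k x \<tau>" unfolding bar_def using M q \<open>0 < \<epsilon>\<close> by linarith
    then have "\<nu> * B \<le> \<nu> * bar D \<epsilon> c0 M s k x \<tau>" using assms by simp
    then show ?thesis using bd by linarith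
  qed
  also have "\<dots> \<le> \<nu> * exp (K * \<tau>) * bar D \<epsilon> c0 M s k x \<tau>"
  proof -
    have "1 * (\<nu> * bar D \<epsilon> c0 M s k x \<tau>) \<le> exp (K * \<tau>) * (\<nu> * bar D \<epsilon> c0 M s k x \<tau>)"
      using b assms by (intro mult_right_mono) auto
    then show ?thesis by (simp add: algebra_simps)
  qed
  finally show ?thesis by simp
qed

text \<open>The flux couples the components, so both are compared at once: \<theta> is the larger of
  the two maxima, and at a point where one component attains it the other is still below its own
  lifted barrier.\<close>

lemma global_upper_aux:
  fixes u v :: "real^'n::finite \<Rightarrow> real \<Rightarrow> real"
  assumes pos: "0 < D" "0 < d" "0 < \<mu>" "0 < \<nu>" "0 < \<epsilon>" "0 < s" "0 \<le> K" "0 \<le> M"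
    and c0: "2 * D * (real CARD('n) + 1) < c0" "2 * d * (real CARD('n) + 1) < c0"
    and pde: "pde k D g u" "pde k d f v" and flux: "flux k D \<mu> \<nu> u v" "flux k d \<nu> \<mu> v u"
    and cont: "half_cont k u" "half_cont k v" "init_cont k u" "init_cont k v"
    and init: "\<And>x. 0 < x $ k \<Longrightarrow> u x 0 \<le> \<nu> * A" "\<And>x. 0 < x $ k \<Longrightarrow> v x 0 \<le> \<mu> * A"
    and bd: "\<And>x t. 0 \<le> x $ k \<Longrightarrow> 0 < t \<Longrightarrow> t \<le> T \<Longrightarrow> u x t \<le> C"
       "\<And>x t. 0 \<le> x $ k \<Longrightarrow> 0 < t \<Longrightarrow> t \<le> T \<Longrightarrow> v x t \<le> C"
    and g: "\<And>r. \<nu> * A \<le> r \<Longrightarrow> r \<le> C \<Longrightarrow> g r \<le> K * (r - \<nu> * A)"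
    and f: "\<And>r. \<mu> * A \<le> r \<Longrightarrow> r \<le> C \<Longrightarrow> f r \<le> K * (r - \<mu> * A)"
    and B: "C - \<nu> * A \<le> \<nu> * B" "C - \<mu> * A \<le> \<mu> * B" "0 < B"
    and M: "B \<le> M * (exp (- 1 / (4 * D)) / sqrt 2)" "B \<le> M * (exp (- 1 / (4 * d)) / sqrt 2)"
    and x1: "0 \<le> x1 $ k" "0 < t1" "t1 \<le> T"
  shows "u x1 t1 \<le> \<nu> * A + \<nu> * exp (K * t1) * bar D \<epsilon> c0 M s k x1 t1"
proof (rule ccontr)
  assume viol: "\<not> ?thesis"
  have "0 < 2 * D * (real CARD('n) + 1)" using pos by (simp add: add_nonneg_pos)
  then have "0 \<le> c0" using c0(1) by linarith
  \<comment> \<open>Beyond \<open>Y\<close> or \<rho> the quadratic part of \<open>bar\<close>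
    exceeds \<open>B\<close>; the added terms put \<open>x1\<close> inside the region.\<close>
  define Y where "Y = max (x1 $ k) (1 + B / \<epsilon> + 1) + 1"
  define \<rho> where "\<rho> = max (perp k x1) (B / \<epsilon>) + 1"
  have "0 < sqrt s" using pos by simp
  obtain \<delta>1 where \<delta>1: "0 < \<delta>1" "\<And>x t. sqrt s \<le> x $ k \<Longrightarrow> x $ k \<le> Y \<Longrightarrow> perp k x \<le> \<rho> \<Longrightarrow> 0 \<le> t \<Longrightarrow> t \<le> \<delta>1 \<Longrightarrow> u x t \<le> \<nu> * A + \<nu> * \<epsilon>"
    using initial_layer[OF cont(3) init(1) \<open>0 < sqrt s\<close> mult_pos_pos[OF pos(4,5)], of Y \<rho>] by blast
  obtain \<delta>2 where \<delta>2: "0 < \<delta>2" "\<And>x t. sqrt s \<le> x $ k \<Longrightarrow> x $ k \<le> Y \<Longrightarrow> perp k x \<le> \<rho> \<Longrightarrow> 0 \<le> t \<Longrightarrow> t \<le> \<delta>2 \<Longrightarrow> v x t \<le> \<mu> * A + \<mu> * \<epsilon>"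
    using initial_layer[OF cont(4) init(2) \<open>0 < sqrt s\<close> mult_pos_pos[OF pos(3,5)], of Y \<rho>] by blast
  \<comment> \<open>The comparison starts at a positive time, since nothing is known on the
    interface at time 0; \<open>\<tau> \<le> s\<close> keeps the kernel of order one near the
    interface.\<close>
  define \<tau> where "\<tau> = min (min \<delta>1 \<delta>2) (min s t1) / 2"
  have \<tau>: "0 < \<tau>" "\<tau> \<le> \<delta>1" "\<tau> \<le> \<delta>2" "\<tau> \<le> s" "\<tau> < t1"
    using \<delta>1(1) \<delta>2(1) pos x1 by (auto simp: \<tau>_def)
  define S where "S = {x::real^'n. 0 \<le> x $ k \<and> x $ k \<le> Y \<and> perp k x \<le> \<rho>}"
  have inS: "x \<in> S \<longleftrightarrow> 0 \<le> x $ k \<and> x $ k \<le> Y \<and> perp k x \<le> \<rho>" for x by (simp add: S_def)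
  define H where "H = (\<lambda>\<nu> D (w :: real^'n \<Rightarrow> real \<Rightarrow> real) z. (w (fst z) (snd z) - \<nu> * A) / (\<nu> * exp (K * snd z)) - bar
      D \<epsilon> c0 M s k (fst z) (snd z))"
  have cS: "compact (S \<times> {\<tau>..T})" unfolding S_def by (intro compact_Times compact_strip compact_Icc) simp
  have x1S: "(x1, t1) \<in> S \<times> {\<tau>..T}" using x1 \<tau> by (auto simp: inS Y_def \<rho>_def)
  have cH: "continuous_on (S \<times> {\<tau>..T}) (H \<nu> D w)" if "half_cont k w" "0 < \<nu>" "0 < D" for w \<nu> D
  proof -
    have "continuous_on (S \<times> {\<tau>..T}) (\<lambda>z. w (fst z) (snd z))"
      by (rule continuous_on_subset[OF that(1)[unfolded half_cont_def case_prod_beta]])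
        (use \<tau> in \<open>auto simp: S_def\<close>)
    moreover have "snd z + s \<noteq> 0" "0 < snd z + s" if "z \<in> S \<times> {\<tau>..T}" for z
      using that \<tau> pos by (auto simp: less_imp_neq[symmetric])
    ultimately show ?thesis unfolding H_def bar_def hk_def
      using that pos by (intro continuous_intros) auto
  qed
  obtain z1 where z1: "z1 \<in> S \<times> {\<tau>..T}" "\<And>z. z \<in> S \<times> {\<tau>..T} \<Longrightarrow> H \<nu> D u z \<le> H \<nu> D u z1"
    using continuous_attains_sup[OF cS _ cH[OF cont(1) pos(4,1)]] x1S by blast
  obtain z2 where z2: "z2 \<in> S \<times> {\<tau>..T}" "\<And>z. z \<in> S \<times> {\<tau>..T} \<Longrightarrow> H \<mu> d v z \<le> H \<mu> d v z2"
    using continuous_attains_sup[OF cS _ cH[OF cont(2) pos(3,2)]] x1S by blast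
  define \<theta> where "\<theta> = max (H \<nu> D u z1) (H \<mu> d v z2)"
  have "0 < H \<nu> D u (x1, t1)"
    using viol pos by (simp add: H_def field_simps)
  also have "\<dots> \<le> \<theta>" using z1(2)[OF x1S] by (simp add: \<theta>_def)
  finally have "\<theta> > 0" .
  have conv: "w x t \<le> \<nu> * A + \<nu> * exp (K * t) * (bar D \<epsilon> c0 M s k x t + r) \<longleftrightarrow> H \<nu> D w (x, t) \<le> r"
       "w x t = \<nu> * A + \<nu> * exp (K * t) * (bar D \<epsilon> c0 M s k x t + r) \<longleftrightarrow> H \<nu> D w (x, t) = r"
    if "0 < \<nu>" for w \<nu> D x t r
  proof -
    define q where "q = \<nu> * exp (K * t)"
    have "0 < q" using that by (simp add: q_def)
    have 1: "(w x t - \<nu> * A) / q \<le> z \<longleftrightarrow> w x t \<le> \<nu> * A + q * z" for z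
      using pos_divide_le_eq[OF \<open>0 < q\<close>, of "w x t - \<nu> * A" z] by (auto simp: mult.commute)
    have 2: "(w x t - \<nu> * A) / q = z \<longleftrightarrow> w x t = \<nu> * A + q * z" for z
      using \<open>0 < q\<close> by (auto simp: divide_eq_eq mult.commute)
    show "w x t \<le> \<nu> * A + \<nu> * exp (K * t) * (bar D \<epsilon> c0 M s k x t + r) \<longleftrightarrow> H \<nu> D w (x, t) \<le> r"
      unfolding H_def fst_conv snd_conv diff_le_eq q_def[symmetric] 1 by (simp add: add.commute)
    show "w x t = \<nu> * A + \<nu> * exp (K * t) * (bar D \<epsilon> c0 M s k x t + r) \<longleftrightarrow> H \<nu> D w (x, t) = r"
      unfolding H_def fst_conv snd_conv diff_eq_eq q_def[symmetric] 2 by (simp add: add.commute)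
  qed
  have le: "u x t \<le> \<nu> * A + \<nu> * exp (K * t) * (bar D \<epsilon> c0 M s k x t + \<theta>)"
           "v x t \<le> \<mu> * A + \<mu> * exp (K * t) * (bar d \<epsilon> c0 M s k x t + \<theta>)"
    if "0 \<le> x $ k" "x $ k \<le> Y" "perp k x \<le> \<rho>" "\<tau> \<le> t" "t \<le> T" for x t
    using z1(2)[of "(x, t)"] z2(2)[of "(x, t)"] that unfolding conv[OF pos(4)] conv[OF pos(3)] \<theta>_def
    by (auto simp: inS le_max_iff_disj)
  \<comment> \<open>At a positive maximum \<open>bar\<close> is less than \<open>B\<close>, which
    excludes the outer boundary; \<open>sl\<close>, supplied by \<open>bar_slice\<close>, excludes
    the initial slice.\<close>
  have inner: "x $ k < Y \<and> perp k x < \<rho> \<and> \<tau> < t"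
    if "0 < \<nu>'" "0 < D'" "(x, t) \<in> S \<times> {\<tau>..T}" and eq: "H \<nu>' D' w (x, t) = \<theta>"
      and b: "w x t - \<nu>' * A \<le> \<nu>' * B" and sl: "t = \<tau> \<Longrightarrow> w x \<tau> \<le> \<nu>' * A + \<nu>' * exp (K * \<tau>) * bar D' \<epsilon> c0 M s k x \<tau>"
    for \<nu>' D' w x t
  proof -
    have t: "0 < t" using that \<tau> by auto
    have "1 * \<nu>' \<le> exp (K * t) * \<nu>'" using pos that(1) t by (intro mult_right_mono) auto
    then have "(w x t - \<nu>' * A) / (\<nu>' * exp (K * t)) \<le> B"
    proof -
      assume a: "1 * \<nu>' \<le> exp (K * t) * \<nu>'"
      then have "\<nu>' * B \<le> (exp (K * t) * \<nu>') * B" using B mult_right_mono[OF a, of B] by simp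
      with b have "w x t - \<nu>' * A \<le> B * (\<nu>' * exp (K * t))" by (simp add: algebra_simps)
      then show ?thesis using that(1) by (simp add: pos_divide_le_eq)
    qed
    then have bb: "bar D' \<epsilon> c0 M s k x t < B" using eq \<open>\<theta> > 0\<close> by (simp add: H_def)
    have hk0: "0 \<le> M * hk D' s (x $ k) t" using hk_nonneg pos by simp
    have "\<epsilon> * (perp k x + (x $ k - 1)\<^sup>2 + 1 + c0 * t) < B"
      using bb hk0 unfolding bar_def by linarith
    then have q: "perp k x + (x $ k - 1)\<^sup>2 + 1 + c0 * t < B / \<epsilon>"
      using pos by (simp add: pos_less_divide_eq mult.commute)
    have ct: "0 \<le> c0 * t" using \<open>0 \<le> c0\<close> t by simp
    have p: "perp k x < \<rho>" using q ct zero_le_power2[of "x $ k - 1"] unfolding \<rho>_def by linarith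
    have "(x $ k - 1)\<^sup>2 < B / \<epsilon>" using q ct perp_nonneg[of k x] by linarith
    also have "\<dots> \<le> (B / \<epsilon> + 1)\<^sup>2"
    proof -
      have "b \<le> (b + 1)\<^sup>2" if "0 \<le> b" for b :: real
        using that by (simp add: power2_eq_square algebra_simps)
      then show ?thesis using B pos by simp
    qed
    finally have "x $ k - 1 < B / \<epsilon> + 1" by (rule power2_less_imp_less) (use B pos in simp)
    then have "x $ k < Y" unfolding Y_def by linarith
    moreover have "t \<noteq> \<tau>"
      using sl conv(1)[OF that(1), of w x \<tau> D' 0] eq \<open>\<theta> > 0\<close> by auto
    ultimately show ?thesis using p that by auto
  qed
  show False
  proof (cases "H \<nu> D u z1 = \<theta>")
    case True
    obtain xs ts where z: "z1 = (xs, ts)" by fastforce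
    have s: "xs \<in> S" "\<tau> \<le> ts" "ts \<le> T" using z1 z by auto
    have "0 < ts" using s \<tau> by simp
    have b: "u xs ts \<le> C" using s \<open>0 < ts\<close> by (intro bd) (auto simp: inS)
    have "xs $ k < Y \<and> perp k xs < \<rho> \<and> \<tau> < ts"
    proof (rule inner[OF pos(4,1) _ True[unfolded z]])
      show "(xs, ts) \<in> S \<times> {\<tau>..T}" using s by simp
      show "u xs ts - \<nu> * A \<le> \<nu> * B" using b B by simp
      assume t: "ts = \<tau>"
      show "u xs \<tau> \<le> \<nu> * A + \<nu> * exp (K * \<tau>) * bar D \<epsilon> c0 M s k xs \<tau>"
        using b B s t by (intro bar_slice[where B = B] pos \<tau> M \<delta>1 \<open>0 \<le> c0\<close>) (use \<tau> in \<open>auto simp: inS\<close>)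
    qed
    then have fin: "xs $ k < Y" "perp k xs < \<rho>" "\<tau> < ts" by auto
    have xs0: "0 \<le> xs $ k" using s by (simp add: inS)
    show False
    proof (rule global_touch[OF pos(1,3,4,5) \<open>\<theta> > 0\<close> pos(8,6,7) c0(1) pde(1) flux(1), where A = A and C = C and Y = Y
        and \<rho> = \<rho> and \<tau> = \<tau> and xs = xs and ts = ts and T = T and d = d])
      show "u xs ts = \<nu> * A + \<nu> * exp (K * ts) * (bar D \<epsilon> c0 M s k xs ts + \<theta>)"
        using conv(2)[OF pos(4), of u xs ts D \<theta>] True z by simp
      show "v xs ts \<le> \<mu> * A + \<mu> * exp (K * ts) * (bar d \<epsilon> c0 M s k xs ts + \<theta>)"
        using s by (intro le) (auto simp: inS)
      show "g r \<le> K * (r - \<nu> * A)" if "\<nu> * A \<le> r" "r \<le> C" for r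
        using that by (rule g)
      show "u x t \<le> \<nu> * A + \<nu> * exp (K * t) * (bar D \<epsilon> c0 M s k x t + \<theta>)"
        if "0 \<le> x $ k" "x $ k \<le> Y" "perp k x \<le> \<rho>" "\<tau> \<le> t" "t \<le> T" for x t
        using that by (rule le(1))
    qed (use fin xs0 \<tau>(1) s(3) b in simp_all)
  next
    case False
    then have True: "H \<mu> d v z2 = \<theta>" by (metis \<theta>_def max_def)
    obtain xs ts where z: "z2 = (xs, ts)" by fastforce
    have s: "xs \<in> S" "\<tau> \<le> ts" "ts \<le> T" using z2 z by auto
    have "0 < ts" using s \<tau> by simp
    have b: "v xs ts \<le> C" using s \<open>0 < ts\<close> by (intro bd) (auto simp: inS)
    have "xs $ k < Y \<and> perp k xs < \<rho> \<and> \<tau> < ts"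
    proof (rule inner[OF pos(3,2) _ True[unfolded z]])
      show "(xs, ts) \<in> S \<times> {\<tau>..T}" using s by simp
      show "v xs ts - \<mu> * A \<le> \<mu> * B" using b B by simp
      assume t: "ts = \<tau>"
      show "v xs \<tau> \<le> \<mu> * A + \<mu> * exp (K * \<tau>) * bar d \<epsilon> c0 M s k xs \<tau>"
        using b B s t by (intro bar_slice[where B = B] pos \<tau> M \<delta>2 \<open>0 \<le> c0\<close>) (use \<tau> in \<open>auto simp: inS\<close>)
    qed
    then have fin: "xs $ k < Y" "perp k xs < \<rho>" "\<tau> < ts" by auto
    have xs0: "0 \<le> xs $ k" using s by (simp add: inS)
    show False
    proof (rule global_touch[OF pos(2,4,3,5) \<open>\<theta> > 0\<close> pos(8,6,7) c0(2) pde(2) flux(2), where A = A and C = C and Y = Y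
        and \<rho> = \<rho> and \<tau> = \<tau> and xs = xs and ts = ts and T = T and d = D])
      show "v xs ts = \<mu> * A + \<mu> * exp (K * ts) * (bar d \<epsilon> c0 M s k xs ts + \<theta>)"
        using conv(2)[OF pos(3), of v xs ts d \<theta>] True z by simp
      show "u xs ts \<le> \<nu> * A + \<nu> * exp (K * ts) * (bar D \<epsilon> c0 M s k xs ts + \<theta>)"
        using s by (intro le) (auto simp: inS)
      show "f r \<le> K * (r - \<mu> * A)" if "\<mu> * A \<le> r" "r \<le> C" for r
        using that by (rule f)
      show "v x t \<le> \<mu> * A + \<mu> * exp (K * t) * (bar d \<epsilon> c0 M s k x t + \<theta>)"
        if "0 \<le> x $ k" "x $ k \<le> Y" "perp k x \<le> \<rho>" "\<tau> \<le> t" "t \<le> T" for x t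
        using that by (rule le(2))
    qed (use fin xs0 \<tau>(1) s(3) b in simp_all)
  qed
qed

text \<open>The point is fixed first and the barrier is fitted to it afterwards, so that
  \<open>bar\<close> at this point falls below the assumed excess \<eta>.\<close>

lemma global_upper:
  fixes u v :: "real^'n::finite \<Rightarrow> real \<Rightarrow> real"
  assumes pos: "0 < D" "0 < d" "0 < \<mu>" "0 < \<nu>" "0 \<le> K"
    and pde: "pde k D g u" "pde k d f v" and flux: "flux k D \<mu> \<nu> u v" "flux k d \<nu> \<mu> v u"
    and cont: "half_cont k u" "half_cont k v" "init_cont k u" "init_cont k v"
    and init: "\<And>x. 0 < x $ k \<Longrightarrow> u x 0 \<le> \<nu> * A" "\<And>x. 0 < x $ k \<Longrightarrow> v x 0 \<le> \<mu> * A"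
    and bd: "\<And>x t. 0 \<le> x $ k \<Longrightarrow> 0 < t \<Longrightarrow> t \<le> T \<Longrightarrow> u x t \<le> C"
       "\<And>x t. 0 \<le> x $ k \<Longrightarrow> 0 < t \<Longrightarrow> t \<le> T \<Longrightarrow> v x t \<le> C"
    and g: "\<And>r. \<nu> * A \<le> r \<Longrightarrow> r \<le> C \<Longrightarrow> g r \<le> K * (r - \<nu> * A)"
    and f: "\<And>r. \<mu> * A \<le> r \<Longrightarrow> r \<le> C \<Longrightarrow> f r \<le> K * (r - \<mu> * A)"
    and x: "0 \<le> x $ k" "0 < t" "t \<le> T"
  shows "u x t \<le> \<nu> * A"
proof (rule ccontr)
  assume viol: "\<not> u x t \<le> \<nu> * A"
  define \<eta> where "\<eta> = (u x t - \<nu> * A) / (\<nu> * exp (K * t))"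
  have "\<eta> > 0" using viol pos by (simp add: \<eta>_def)
  define B where "B = max 1 (max ((C - \<nu> * A) / \<nu>) ((C - \<mu> * A) / \<mu>))"
  define m where "m = min (exp (- 1 / (4 * D)) / sqrt 2) (exp (- 1 / (4 * d)) / sqrt 2)"
  define M where "M = B / m"
  define c0 where "c0 = 2 * (D + d) * (real CARD('n) + 1)"
  have "m > 0" "B > 0" by (auto simp: m_def B_def)
  then have "M > 0" by (simp add: M_def)
  have "c0 > 0" using pos by (simp add: c0_def)
  define q where "q = perp k x + (x $ k - 1)\<^sup>2 + 1 + c0 * t"
  have "q > 0" unfolding q_def using perp_nonneg[of k x] \<open>c0 > 0\<close> x
    by (smt (verit) mult_pos_pos zero_le_power2)
  \<comment> \<open>Each part of \<open>bar\<close> at \<open>(x, t)\<close> is to be at most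
    \<open>\<eta> / 4\<close>: \<epsilon> achieves this for the quadratic part, and
    \<open>s\<close>, by \<open>hk_upper\<close>, for the kernel.\<close>
  define \<epsilon> where "\<epsilon> = \<eta> / (4 * q)"
  have "\<epsilon> > 0" using \<open>\<eta> > 0\<close> \<open>q > 0\<close> by (simp add: \<epsilon>_def)
  define s where "s = (\<eta> * sqrt t / (4 * M))\<^sup>2"
  have "s > 0" using \<open>\<eta> > 0\<close> \<open>M > 0\<close> x by (simp add: s_def)
  have sq: "sqrt s / sqrt t = \<eta> / (4 * M)" using \<open>\<eta> > 0\<close> \<open>M > 0\<close> x by (simp add: s_def)
  have "u x t \<le> \<nu> * A + \<nu> * exp (K * t) * bar D \<epsilon> c0 M s k x t"
  proof (rule global_upper_aux[OF pos(1-4) \<open>\<epsilon> > 0\<close> \<open>s > 0\<close> pos(5) _ _ _ pde flux cont init bd g f _ _ \<open>B > 0\<close>])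
    show "0 \<le> M" using \<open>M > 0\<close> by simp
    show "2 * D * (real CARD('n) + 1) < c0" "2 * d * (real CARD('n) + 1) < c0"
      unfolding c0_def using pos by (intro mult_strict_right_mono; simp)+
    have "(C - \<nu> * A) / \<nu> \<le> B" "(C - \<mu> * A) / \<mu> \<le> B" by (auto simp: B_def)
    then show "C - \<nu> * A \<le> \<nu> * B" "C - \<mu> * A \<le> \<mu> * B" using pos by (simp_all add: pos_divide_le_eq mult.commute)
    have "B = M * m" using \<open>m > 0\<close> by (simp add: M_def)
    moreover have "M * m \<le> M * (exp (- 1 / (4 * D)) / sqrt 2)" "M * m \<le> M * (exp (- 1 / (4 * d)) / sqrt 2)"
      using \<open>M > 0\<close> by (intro mult_left_mono; simp add: m_def)+
    ultimately show "B \<le> M * (exp (- 1 / (4 * D)) / sqrt 2)" "B \<le> M * (exp (- 1 / (4 * d)) / sqrt 2)" by simp_all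
  qed (use x in auto)
  then have "\<eta> \<le> bar D \<epsilon> c0 M s k x t"
    unfolding \<eta>_def using pos by (simp add: pos_divide_le_eq mult.commute)
  also have "\<dots> \<le> \<epsilon> * q + M * (sqrt s / sqrt t)"
    unfolding bar_def q_def using hk_upper[OF pos(1) \<open>s > 0\<close> x(2), of "x $ k"] \<open>M > 0\<close>
    by (intro add_mono order_refl mult_left_mono) auto
  also have "\<dots> = \<eta> / 2" unfolding sq \<epsilon>_def using \<open>q > 0\<close> \<open>M > 0\<close> by (simp add: field_simps)
  finally show False using \<open>\<eta> > 0\<close> by simp
qed

section \<open>Hair-trigger effect\<close>

lemma norm_sq_diff_scaleR_deriv:
  fixes z c :: "'a::real_inner"
  shows "((\<lambda>t. (norm (z - (t - t0) *\<^sub>R c))\<^sup>2) has_real_derivative - 2 * (c \<bullet> (z - (t - t0) *\<^sub>R c))) (at t)"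
proof -
  have "(\<lambda>t. (norm (z - (t - t0) *\<^sub>R c))\<^sup>2) = (\<lambda>t. z \<bullet> z - 2 * (t - t0) * (c \<bullet> z) + (t - t0)\<^sup>2 * (c \<bullet> c))"
    unfolding power2_norm_eq_inner
    by (auto simp: inner_diff_left inner_diff_right inner_commute power2_eq_square algebra_simps)
  then show ?thesis
    by (auto intro!: derivative_eq_intros simp: inner_diff_right algebra_simps)
qed

text \<open>Squaring makes the bump vanish to second order on the sphere, where its Laplacian is
  positive; near the edge it is therefore a subsolution whatever the reaction. The term with
  \<delta> provides strictness in the touching argument.\<close>

lemma jet_ball:
  fixes h c x :: "real^'n::finite" and t t0 R \<kappa> l K \<delta> :: real
  defines "y \<equiv> x - h - (t - t0) *\<^sub>R c"
  defines "Y \<equiv> R\<^sup>2 - (norm y)\<^sup>2"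
  shows "jet (\<lambda>x t. \<kappa> * exp (l * (t - t0)) * (R\<^sup>2 - (norm (x - h - (t - t0) *\<^sub>R c))\<^sup>2)\<^sup>2 - \<delta> * exp (K * (t - t0))) x t
    (\<kappa> * exp (l * (t - t0)) * (l * Y\<^sup>2 + 4 * Y * (c \<bullet> y)) - \<delta> * K * exp (K * (t - t0)))
    (\<lambda>i. \<kappa> * exp (l * (t - t0)) * (8 * (y $ i)\<^sup>2 - 4 * Y))"
  unfolding jet_def
proof (intro conjI allI)
  show "((\<lambda>s. \<kappa> * exp (l * (s - t0)) * (R\<^sup>2 - (norm (x - h - (s - t0) *\<^sub>R c))\<^sup>2)\<^sup>2 - \<delta> * exp (K * (s - t0)))
    has_real_derivative (\<kappa> * exp (l * (t - t0)) * (l * Y\<^sup>2 + 4 * Y * (c \<bullet> y)) - \<delta> * K * exp (K * (t - t0)))) (at t)"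
    by (rule derivative_eq_intros norm_sq_diff_scaleR_deriv refl)+
      (simp add: Y_def y_def algebra_simps power2_eq_square)
  fix i
  have e: "x + r *\<^sub>R axis i 1 - h - (t - t0) *\<^sub>R c = y + r *\<^sub>R axis i 1" for r
    by (simp add: y_def)
  have n: "R\<^sup>2 - (norm (y + r *\<^sub>R axis i 1))\<^sup>2 = Y - 2 * r * y $ i - r\<^sup>2" for r
    by (simp add: norm_sq_add_axis Y_def)
  show "\<exists>q. (\<forall>\<^sub>F r in nhds 0. ((\<lambda>r. \<kappa> * exp (l * (t - t0)) *
      (R\<^sup>2 - (norm (x + r *\<^sub>R axis i 1 - h - (t - t0) *\<^sub>R c))\<^sup>2)\<^sup>2 - \<delta> * exp (K * (t - t0))) has_real_derivative q r)
      (at r)) \<and>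
     (q has_real_derivative \<kappa> * exp (l * (t - t0)) * (8 * (y $ i)\<^sup>2 - 4 * Y)) (at 0)"
    unfolding e n
  proof (intro exI[of _ "\<lambda>r. \<kappa> * exp (l * (t - t0)) * (2 * (Y - 2 * r * y $ i - r\<^sup>2) * (- 2 * y $ i - 2 * r))"] conjI
      always_eventually allI)
    show "((\<lambda>r. \<kappa> * exp (l * (t - t0)) * (Y - 2 * r * y $ i - r\<^sup>2)\<^sup>2 - \<delta> * exp (K * (t - t0))) has_real_derivative
       \<kappa> * exp (l * (t - t0)) * (2 * (Y - 2 * r * y $ i - r\<^sup>2) * (- 2 * y $ i - 2 * r))) (at r)" for r
      by (rule derivative_eq_intros refl)+ (simp add: algebra_simps)
    show "((\<lambda>r. \<kappa> * exp (l * (t - t0)) * (2 * (Y - 2 * r * y $ i - r\<^sup>2) * (- 2 * y $ i - 2 * r))) has_real_derivative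
       \<kappa> * exp (l * (t - t0)) * (8 * (y $ i)\<^sup>2 - 4 * Y)) (at 0)"
      by (rule derivative_eq_intros refl)+ (simp add: algebra_simps power2_eq_square)
  qed
qed

text \<open>With \<open>Y\<close> the squared radius minus the squared distance to the moving
  centre, the bump is a subsolution as soon as a quadratic polynomial in \<open>Y\<close> is
  nonnegative, and \<open>cond\<close> says that its discriminant is not positive. A very negative
  rate \<open>l\<close> admits small and fast balls, while \<open>l = 0\<close> asks for large and
  slow ones.\<close>

lemma moving_ball:
  fixes u :: "real^'n::finite \<Rightarrow> real \<Rightarrow> real" and h c :: "real^'n"
  assumes "0 < D" and pde: "pde k D g u" and cont: "init_cont k u"
    and "0 \<le> t0" "0 < R" "0 < \<kappa>" "l < m"
    and cond: "(8 * D + 4 * real CARD('n) * D + 4 * norm c * R)\<^sup>2 \<le> 32 * (m - l) * D * R\<^sup>2"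
    and inside: "\<And>x t. t0 \<le> t \<Longrightarrow> t \<le> t1 \<Longrightarrow> norm (x - h - (t - t0) *\<^sub>R c) \<le> R \<Longrightarrow> 0 < x $ k"
    and nonneg: "\<And>x t. 0 < x $ k \<Longrightarrow> 0 \<le> t \<Longrightarrow> 0 \<le> u x t"
    and g: "\<And>r. 0 \<le> r \<Longrightarrow> r \<le> s0 \<Longrightarrow> m * r \<le> g r"
    and small: "\<And>t. t0 \<le> t \<Longrightarrow> t \<le> t1 \<Longrightarrow> \<kappa> * exp (l * (t - t0)) * (R\<^sup>2)\<^sup>2 \<le> s0"
    and start: "\<And>x. norm (x - h) \<le> R \<Longrightarrow> \<kappa> * (R\<^sup>2 - (norm (x - h))\<^sup>2)\<^sup>2 \<le> u x t0"
    and x: "t0 \<le> t" "t \<le> t1" "norm (x - h - (t - t0) *\<^sub>R c) \<le> R"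
  shows "\<kappa> * exp (l * (t - t0)) * (R\<^sup>2 - (norm (x - h - (t - t0) *\<^sub>R c))\<^sup>2)\<^sup>2 \<le> u x t"
proof (rule ccontr)
  assume viol: "\<not> ?thesis"
  define w where "w = (\<lambda>x t. \<kappa> * exp (l * (t - t0)) * (R\<^sup>2 - (norm (x - h - (t - t0) *\<^sub>R c))\<^sup>2)\<^sup>2)"
  \<comment> \<open>Any rate above \<open>m\<close> makes the \<delta>-term decide against the
    linear lower bound of \<open>g\<close>.\<close>
  define K where "K = \<bar>m\<bar> + 1"
  define Q where "Q = (\<lambda>(z, t). (z + h + (t - t0) *\<^sub>R c, t)) ` (cball 0 R \<times> {t0..t1})"
  have inQ: "(x, t) \<in> Q \<longleftrightarrow> t0 \<le> t \<and> t \<le> t1 \<and> norm (x - h - (t - t0) *\<^sub>R c) \<le> R" for x t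
  proof
    assume "t0 \<le> t \<and> t \<le> t1 \<and> norm (x - h - (t - t0) *\<^sub>R c) \<le> R"
    then show "(x, t) \<in> Q" unfolding Q_def
      by (intro image_eqI[of _ _ "(x - h - (t - t0) *\<^sub>R c, t)"]) (auto simp: algebra_simps)
  qed (auto simp: Q_def)
  have "compact Q" unfolding Q_def case_prod_beta
    by (intro compact_continuous_image compact_Times compact_cball compact_Icc continuous_intros)
  \<comment> \<open>With this weight a negative minimum means that \<open>w\<close> minus
    \<open>\<delta> * exp (K * (t - t0))\<close> touches \<open>u\<close> from below. On the moving
    sphere and at \<open>t0\<close> one has \<open>w \<le> u\<close>, so the touching point is
    interior.\<close>
  define H where "H = (\<lambda>z. exp (- K * (snd z - t0)) * (u (fst z) (snd z) - w (fst z) (snd z)))"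
  have "continuous_on Q (\<lambda>z. u (fst z) (snd z))"
  proof (rule continuous_on_subset[OF cont[unfolded init_cont_def case_prod_beta]], rule subsetI)
    fix z assume "z \<in> Q"
    obtain x t where z: "z = (x, t)" by fastforce
    with \<open>z \<in> Q\<close> have "t0 \<le> t" "0 < x $ k" using inQ inside by blast+
    then show "z \<in> {x. 0 < x $ k} \<times> {0..}" using z \<open>0 \<le> t0\<close> by simp
  qed
  then have cH: "continuous_on Q H" unfolding H_def w_def by (intro continuous_intros)
  have "(x, t) \<in> Q" using x inQ by simp
  obtain xs ts where s: "(xs, ts) \<in> Q" and mn: "\<And>z. z \<in> Q \<Longrightarrow> H (xs, ts) \<le> H z"
    using continuous_attains_inf[OF \<open>compact Q\<close> _ cH] \<open>(x, t) \<in> Q\<close> by fastforce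
  define \<delta> where "\<delta> = - H (xs, ts)"
  have "H (x, t) < 0" using viol by (simp add: H_def w_def mult_pos_neg)
  then have "0 < \<delta>" using mn[OF \<open>(x, t) \<in> Q\<close>] by (simp add: \<delta>_def)
  have EE: "exp (K * (t - t0)) * exp (- K * (t - t0)) = 1" for t
    by (simp add: exp_add[symmetric])
  have le: "w x t - \<delta> * exp (K * (t - t0)) \<le> u x t" if "(x, t) \<in> Q" for x t
  proof -
    have "exp (K * (t - t0)) * (- \<delta>) \<le> exp (K * (t - t0)) * H (x, t)"
      using mn[OF that] by (intro mult_left_mono) (auto simp: \<delta>_def)
    also have "\<dots> = u x t - w x t" unfolding H_def by (simp only: fst_conv snd_conv mult.assoc[symmetric] EE) simp
    finally show ?thesis by (simp add: algebra_simps)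
  qed
  have eq: "w xs ts - \<delta> * exp (K * (ts - t0)) = u xs ts"
  proof -
    have "exp (K * (ts - t0)) * (- \<delta>) = exp (K * (ts - t0)) * H (xs, ts)" by (simp add: \<delta>_def)
    also have "\<dots> = u xs ts - w xs ts" unfolding H_def by (simp only: fst_conv snd_conv mult.assoc[symmetric] EE) simp
    finally show ?thesis by (simp add: algebra_simps)
  qed
  define y where "y = xs - h - (ts - t0) *\<^sub>R c"
  define Y where "Y = R\<^sup>2 - (norm y)\<^sup>2"
  define E where "E = exp (K * (ts - t0))"
  define e1 where "e1 = \<kappa> * exp (l * (ts - t0))"
  have "e1 > 0" "E > 0" using \<open>0 < \<kappa>\<close> by (auto simp: e1_def E_def)
  have st: "t0 \<le> ts" "ts \<le> t1" "norm y \<le> R" using s inQ by (auto simp: y_def)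
  have xk: "0 < xs $ k" using inside st by (auto simp: y_def)
  have u0: "0 \<le> u xs ts" using nonneg xk st \<open>0 \<le> t0\<close> by simp
  have wu: "u xs ts < w xs ts" using eq \<open>\<delta> > 0\<close> by (smt (verit) exp_gt_zero mult_pos_pos)
  have wY: "w xs ts = e1 * Y\<^sup>2" by (simp add: w_def Y_def y_def e1_def)
  have "norm y \<noteq> R" using wu u0 wY by (auto simp: Y_def)
  then have nR: "norm y < R" using st by simp
  have "ts \<noteq> t0" using wu start[of xs] st by (auto simp: w_def y_def)
  then have t0ts: "t0 < ts" using st by simp
  obtain a b where ab: "jet u xs ts a b" "a - D * sum b UNIV = g (u xs ts)"
    using pde xk t0ts \<open>0 \<le> t0\<close> unfolding pde_def by (meson order.strict_trans1)
  have J: "jet (\<lambda>x t. w x t - \<delta> * exp (K * (t - t0))) xs ts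
    (e1 * (l * Y\<^sup>2 + 4 * Y * (c \<bullet> y)) - \<delta> * K * E) (\<lambda>i. e1 * (8 * (y $ i)\<^sup>2 - 4 * Y))"
    unfolding w_def y_def Y_def e1_def E_def by (rule jet_ball)
  have opx: "open {x. norm (x - h - (ts - t0) *\<^sub>R c) < R}"
    by (intro open_Collect_less continuous_intros)
  obtain e2 where e2: "e2 > 0" "\<And>i r. \<bar>r\<bar> < e2 \<Longrightarrow> xs + r *\<^sub>R axis i 1 \<in> {x. norm (x - h - (ts - t0) *\<^sub>R c) < R}"
    using open_axis_nbhd[OF opx] nR unfolding y_def by blast
  have "open {t. norm (xs - h - (t - t0) *\<^sub>R c) < R}"
    by (intro open_Collect_less continuous_intros)
  then have "\<exists>e3>0. \<forall>t. dist t ts < e3 \<longrightarrow> t \<in> {t. norm (xs - h - (t - t0) *\<^sub>R c) < R}"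
    using nR unfolding y_def open_dist by blast
  then obtain e3 where e3: "e3 > 0" "\<And>t. \<bar>t - ts\<bar> < e3 \<Longrightarrow> norm (xs - h - (t - t0) *\<^sub>R c) < R"
    unfolding dist_real_def by blast
  define e where "e = min e2 (min e3 (ts - t0))"
  have "e > 0" using e2 e3 t0ts by (simp add: e_def)
  have tl: "w xs t - \<delta> * exp (K * (t - t0)) \<le> u xs t" if "ts - e < t" "t \<le> ts" for t
    using that st e3(2)[of t] unfolding e_def by (intro le inQ[THEN iffD2]) (auto simp: less_imp_le)
  have xl: "w (xs + r *\<^sub>R axis i 1) ts - \<delta> * exp (K * (ts - t0)) \<le> u (xs + r *\<^sub>R axis i 1) ts" if "\<bar>r\<bar> < e" for r i
    using that st e2(2)[of r i] unfolding e_def by (intro le inQ[THEN iffD2]) (auto simp: less_imp_le)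
  note touch = jet_touch[OF J ab(1) \<open>e > 0\<close> _ tl xl]
  have a: "a \<le> e1 * (l * Y\<^sup>2 + 4 * Y * (c \<bullet> y)) - \<delta> * K * E"
    using touch(1) eq by simp
  have "(\<Sum>i\<in>UNIV. e1 * (8 * (y $ i)\<^sup>2 - 4 * Y)) \<le> sum b UNIV"
    by (intro sum_mono touch(2)) (use eq in auto)
  also have "(\<Sum>i\<in>UNIV. e1 * (8 * (y $ i)\<^sup>2 - 4 * Y)) = e1 * (8 * (\<Sum>i\<in>UNIV. (y $ i)\<^sup>2) - real CARD('n) * (4 * Y))"
    by (simp add: sum_distrib_left[symmetric] sum_subtractf)
  also have "(\<Sum>i\<in>UNIV. (y $ i)\<^sup>2) = R\<^sup>2 - Y"
    unfolding Y_def power2_norm_eq_inner inner_vec_def by (simp add: power2_eq_square)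
  finally have "D * (e1 * (8 * (R\<^sup>2 - Y) - real CARD('n) * (4 * Y))) \<le> D * sum b UNIV"
    using \<open>0 < D\<close> by simp
  then have gu: "g (u xs ts) \<le> e1 * (l * Y\<^sup>2 + 4 * Y * (c \<bullet> y) - D * (8 * (R\<^sup>2 - Y) - real CARD('n) * (4 * Y))) - \<delta> * K * E"
    using a ab(2) by (simp add: algebra_simps)
  have Y0: "0 \<le> Y" using st \<open>0 < R\<close> unfolding Y_def by (simp add: power_mono)
  have "c \<bullet> y \<le> norm c * R"
    using norm_cauchy_schwarz[of c y] mult_left_mono[OF st(3), of "norm c"] by simp
  then have "4 * Y * (c \<bullet> y) \<le> 4 * Y * (norm c * R)" using Y0 by (intro mult_left_mono) auto
  moreover have "l * Y\<^sup>2 + 4 * Y * (norm c * R) - D * (8 * (R\<^sup>2 - Y) - real CARD('n) * (4 * Y)) \<le> m * Y\<^sup>2"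
  proof -
    define BB where "BB = 8 * D + 4 * real CARD('n) * D + 4 * norm c * R"
    define p where "p = m - l"
    have "0 < p" using \<open>l < m\<close> by (simp add: p_def)
    have "0 \<le> (2 * p * Y - BB)\<^sup>2 + (32 * p * D * R\<^sup>2 - BB\<^sup>2)"
      using cond by (simp add: BB_def p_def)
    also have "\<dots> = 4 * p * (p * Y\<^sup>2 - BB * Y + 8 * D * R\<^sup>2)"
      by (simp add: power2_eq_square algebra_simps)
    finally have "0 \<le> p * Y\<^sup>2 - BB * Y + 8 * D * R\<^sup>2" using \<open>0 < p\<close> by (simp add: zero_le_mult_iff)
    then show ?thesis by (simp add: p_def BB_def algebra_simps)
  qed
  ultimately have "l * Y\<^sup>2 + 4 * Y * (c \<bullet> y) - D * (8 * (R\<^sup>2 - Y) - real CARD('n) * (4 * Y)) \<le> m * Y\<^sup>2" by linarith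
  then have "e1 * (l * Y\<^sup>2 + 4 * Y * (c \<bullet> y) - D * (8 * (R\<^sup>2 - Y) - real CARD('n) * (4 * Y))) \<le> e1 * (m * Y\<^sup>2)"
    using \<open>e1 > 0\<close> by simp
  with gu have "g (u xs ts) \<le> m * w xs ts - \<delta> * K * E" by (simp add: wY algebra_simps)
  moreover have "m * u xs ts \<le> g (u xs ts)"
  proof (rule g[OF u0])
    have "Y\<^sup>2 \<le> (R\<^sup>2)\<^sup>2" using Y0 by (intro power_mono) (auto simp: Y_def)
    then have "w xs ts \<le> s0"
      using small[OF st(1,2)] \<open>e1 > 0\<close> unfolding wY e1_def[symmetric] by (meson less_imp_le mult_left_mono order_trans)
    then show "u xs ts \<le> s0" using wu by simp
  qed
  ultimately have "\<delta> * E * K \<le> \<delta> * E * m" using eq[symmetric] by (simp add: E_def algebra_simps)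
  then have "K \<le> m" using \<open>\<delta> > 0\<close> \<open>E > 0\<close> by simp
  then show False by (simp add: K_def)
qed

section \<open>Change of sign of a solution\<close>

lemma flux_uminus:
  fixes u v :: "real^'n::finite \<Rightarrow> real \<Rightarrow> real"
  shows "flux k D \<mu> \<nu> u v \<Longrightarrow> flux k D \<mu> \<nu> (\<lambda>x t. - u x t) (\<lambda>x t. - v x t)"
  unfolding flux_def
proof (intro allI impI)
  fix x :: "real^'n" and t :: real
  assume "\<forall>x t. x $ k = 0 \<longrightarrow> 0 < t \<longrightarrow> (\<exists>p. ((\<lambda>s. u (x + s *\<^sub>R axis k 1) t) has_real_derivative p) (at 0 within {0..}) \<and>
      - D * p = \<nu> * v x t - \<mu> * u x t)"
    "x $ k = 0" "0 < t"
  then obtain p where "((\<lambda>s. u (x + s *\<^sub>R axis k 1) t) has_real_derivative p) (at 0 within {0..})"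
    "- D * p = \<nu> * v x t - \<mu> * u x t" by blast
  then show "\<exists>p. ((\<lambda>s. - u (x + s *\<^sub>R axis k 1) t) has_real_derivative p) (at 0 within {0..}) \<and> - D * p = \<nu> * - v x t
      - \<mu> * - u x t"
    by (intro exI[of _ "- p"]) (auto intro: DERIV_minus)
qed

lemma half_cont_uminus: "half_cont k u \<Longrightarrow> half_cont k (\<lambda>x t. - u x t)"
  unfolding half_cont_def case_prod_beta by (rule continuous_on_minus)

lemma init_cont_uminus: "init_cont k u \<Longrightarrow> init_cont k (\<lambda>x t. - u x t)"
  unfolding init_cont_def case_prod_beta by (rule continuous_on_minus)

lemma jet_pde_uminus:
  assumes "\<exists>a b. jet u x t a b \<and> a - D * sum b UNIV = g (u x t)"
  shows "\<exists>a b. jet (\<lambda>x t. - u x t) x t a b \<and> a - D * sum b UNIV = - g (- (- u x t))"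
proof -
  obtain a b where "jet u x t a b" "a - D * sum b UNIV = g (u x t)" using assms by blast
  then show ?thesis
    by (intro exI[of _ "- a"] exI[of _ "\<lambda>i. - b i"]) (auto intro: jet_uminus simp: sum_negf)
qed

lemma evpde_uminus:
  assumes "evpde k D g u"
  shows "evpde k D (\<lambda>s. - g (- s)) (\<lambda>x t. - u x t)"
  unfolding evpde_def
proof
  fix R
  obtain T where T: "\<And>x t. 0 < x $ k \<Longrightarrow> norm x \<le> R \<Longrightarrow> T \<le> t \<Longrightarrow> \<exists>a b. jet u x t a b \<and> a - D * sum b UNIV = g (u x t)"
    using assms unfolding evpde_def by meson
  show "\<exists>T. \<forall>x t. 0 < x $ k \<longrightarrow> norm x \<le> R \<longrightarrow> T \<le> t \<longrightarrow>
      (\<exists>a b. jet (\<lambda>x t. - u x t) x t a b \<and> a - D * sum b UNIV = - g (- (- u x t)))"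
    by (intro exI[of _ T] allI impI jet_pde_uminus T)
qed

lemma pde_uminus: "pde k D g u \<Longrightarrow> pde k D (\<lambda>s. - g (- s)) (\<lambda>x t. - u x t)"
  unfolding pde_def by (intro allI impI jet_pde_uminus) blast

section \<open>Spreading of positivity into the half-space\<close>

lemma convex_combination_gt:
  fixes a b r s :: real
  assumes "r < a" "r < b" "0 \<le> s" "s \<le> 1"
  shows "r < (1 - s) * a + s * b"
proof (cases "s = 0")
  case False
  have "(1 - s) * r + s * r < (1 - s) * a + s * b"
    using assms False by (intro add_le_less_mono mult_left_mono mult_strict_left_mono) auto
  then show ?thesis by (simp add: algebra_simps)
qed (use assms in simp)

lemma ball_inside:
  fixes x h c :: "real^'n"
  assumes "norm (x - h - s *\<^sub>R c) \<le> R" "R < h $ k + s * c $ k"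
  shows "0 < x $ k"
  using component_le_norm_cart[of "x - h - s *\<^sub>R c" k] assms by simp

text \<open>A small bump is carried from \<open>x0\<close> to \<open>h\<close> along a segment in
  unit time. It may lose an exponential factor, but one controlled by \<open>R\<close> alone; the
  distance \<open>r\<close> from the interface must not depend on \<open>R\<close>.\<close>

lemma positivity_spreads:
  fixes u :: "real^'n::finite \<Rightarrow> real \<Rightarrow> real"
  assumes "0 < D" and pde: "pde k D g u" and cont: "init_cont k u"
    and nonneg: "\<And>x t. 0 < x $ k \<Longrightarrow> 0 \<le> t \<Longrightarrow> 0 \<le> u x t"
    and g: "\<And>r. 0 \<le> r \<Longrightarrow> r \<le> C \<Longrightarrow> - L * r \<le> g r" and "0 < C" "0 \<le> L"
    and x0: "0 < x0 $ k" "0 < u x0 0"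
  shows "\<exists>r>0. \<forall>R. \<exists>c>0. \<forall>h. r < h $ k \<longrightarrow> norm h \<le> R \<longrightarrow> c \<le> u h 1"
proof -
  have "continuous_on {x. 0 < x $ k} (\<lambda>x. u x 0)"
    by (rule continuous_on_compose2[OF cont[unfolded init_cont_def], of _ "\<lambda>x. (x, 0)", simplified])
      (auto intro!: continuous_intros)
  then obtain e where e: "e > 0" "\<And>x. 0 < x $ k \<Longrightarrow> dist x x0 < e \<Longrightarrow> dist (u x 0) (u x0 0) < u x0 0 / 2"
    using x0 unfolding continuous_on_iff by (metis half_gt_zero mem_Collect_eq)
  define r where "r = min e (x0 $ k) / 2"
  have r: "0 < r" "r < e" "r < x0 $ k" using e x0 by (auto simp: r_def)
  define c1 where "c1 = u x0 0 / 2"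
  have "0 < c1" using x0 by (simp add: c1_def)
  have c1: "c1 \<le> u x 0" if "norm (x - x0) \<le> r" for x
  proof -
    have "0 < x $ k" using ball_inside[of x x0 0 0 r k] that r by simp
    then show ?thesis using e(2)[of x] that r by (auto simp: dist_norm c1_def abs_if split: if_splits)
  qed
  show ?thesis
  proof (rule exI[of _ r], rule conjI, rule r(1), rule allI)
    fix R :: real
    define B where "B = 8 * D + 4 * real CARD('n) * D + 4 * (norm x0 + \<bar>R\<bar>) * r"
    \<comment> \<open>So negative that the discriminant condition holds for every speed up to
      \<open>norm x0 + \<bar>R\<bar>\<close>.\<close>
    define l where "l = - L - B\<^sup>2 / (32 * D * r\<^sup>2) - 1"
    have "0 \<le> B\<^sup>2 / (32 * D * r\<^sup>2)" using \<open>0 < D\<close> by simp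
    then have lneg: "l \<le> 0" using \<open>0 \<le> L\<close> unfolding l_def by linarith
    define \<kappa> where "\<kappa> = min c1 C / (r\<^sup>2)\<^sup>2"
    have \<kappa>: "0 < \<kappa>" "\<kappa> * (r\<^sup>2)\<^sup>2 \<le> c1" "\<kappa> * (r\<^sup>2)\<^sup>2 \<le> C" using \<open>0 < c1\<close> \<open>0 < C\<close> r by (auto simp: \<kappa>_def)
    show "\<exists>c>0. \<forall>h. r < h $ k \<longrightarrow> norm h \<le> R \<longrightarrow> c \<le> u h 1"
    proof (intro exI[of _ "\<kappa> * exp l * (r\<^sup>2)\<^sup>2"] conjI allI impI)
      show "0 < \<kappa> * exp l * (r\<^sup>2)\<^sup>2" using \<kappa> r by simp
      fix h :: "real^'n" assume h: "r < h $ k" "norm h \<le> R"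
      have "\<kappa> * exp (l * (1 - 0)) * (r\<^sup>2 - (norm (h - x0 - (1 - 0) *\<^sub>R (h - x0)))\<^sup>2)\<^sup>2 \<le> u h 1"
      proof (rule moving_ball[OF \<open>0 < D\<close> pde cont order_refl r(1) \<kappa>(1), where m = "- L" and ?s0.0 = C and ?t1.0 = 1])
        have "norm (h - x0) \<le> norm x0 + \<bar>R\<bar>" using h norm_triangle_ineq4[of h x0] by linarith
        then have "8 * D + 4 * real CARD('n) * D + 4 * norm (h - x0) * r \<le> B"
          unfolding B_def using r \<open>0 < D\<close> by (intro add_mono mult_right_mono) auto
        then have "(8 * D + 4 * real CARD('n) * D + 4 * norm (h - x0) * r)\<^sup>2 \<le> B\<^sup>2"
          using r \<open>0 < D\<close> by (intro power_mono) auto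
        also have "\<dots> = 32 * (B\<^sup>2 / (32 * D * r\<^sup>2)) * D * r\<^sup>2" using r \<open>0 < D\<close> by simp
        also have "\<dots> \<le> 32 * (- L - l) * D * r\<^sup>2"
          using r \<open>0 < D\<close> by (intro mult_right_mono mult_left_mono) (auto simp: l_def)
        finally show "(8 * D + 4 * real CARD('n) * D + 4 * norm (h - x0) * r)\<^sup>2 \<le> 32 * (- L - l) * D * r\<^sup>2" .
        have "0 \<le> B\<^sup>2 / (32 * D * r\<^sup>2)" using \<open>0 < D\<close> by simp
        then show "l < - L" by (simp add: l_def)
        fix x :: "real^'n" and t :: real
        show "0 < x $ k" if "0 \<le> t" "t \<le> 1" "norm (x - x0 - (t - 0) *\<^sub>R (h - x0)) \<le> r"
        proof -
          have "r < (1 - t) * x0 $ k + t * h $ k" using r h that by (intro convex_combination_gt) auto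
          then show ?thesis using that by (intro ball_inside[of x x0 t "h - x0" r k]) (auto simp: algebra_simps)
        qed
        show "\<kappa> * exp (l * (t - 0)) * (r\<^sup>2)\<^sup>2 \<le> C" if "0 \<le> t" "t \<le> 1"
        proof -
          have "l * t \<le> 0" using that lneg by (simp add: mult_nonpos_nonneg)
          then have "(\<kappa> * (r\<^sup>2)\<^sup>2) * exp (l * t) \<le> (\<kappa> * (r\<^sup>2)\<^sup>2) * 1" using \<kappa> by (intro mult_left_mono) auto
          then show ?thesis using \<kappa>(3) by (simp add: algebra_simps)
        qed
        show "\<kappa> * (r\<^sup>2 - (norm (x - x0))\<^sup>2)\<^sup>2 \<le> u x 0" if "norm (x - x0) \<le> r"
        proof -
          have "(norm (x - x0))\<^sup>2 \<le> r\<^sup>2" using that by (intro power_mono) auto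
          then have "(r\<^sup>2 - (norm (x - x0))\<^sup>2)\<^sup>2 \<le> (r\<^sup>2)\<^sup>2" by (intro power_mono) auto
          then have "\<kappa> * (r\<^sup>2 - (norm (x - x0))\<^sup>2)\<^sup>2 \<le> \<kappa> * (r\<^sup>2)\<^sup>2" using \<kappa> by simp
          then show ?thesis using \<kappa>(2) c1[OF that] by linarith
        qed
      qed (use nonneg g r in auto)
      then show "\<kappa> * exp l * (r\<^sup>2)\<^sup>2 \<le> u h 1" by simp
    qed
  qed
qed

text \<open>For a large radius the linear growth \<open>m\<close> compensates the diffusive loss,
  and a bump can travel at speed at most \<open>D / R1\<close> without losing height. At late times
  every point with \<open>R1 + 1 \<le> x $ k\<close> is reached at such a speed, so the height
  \<kappa> does not depend on \<open>R\<close>.\<close>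

lemma hair_trigger:
  fixes u :: "real^'n::finite \<Rightarrow> real \<Rightarrow> real"
  assumes "0 < D" and pde: "pde k D g u" and cont: "init_cont k u"
    and nonneg: "\<And>x t. 0 < x $ k \<Longrightarrow> 0 \<le> t \<Longrightarrow> 0 \<le> u x t"
    and gL: "\<And>r. 0 \<le> r \<Longrightarrow> r \<le> C \<Longrightarrow> - L * r \<le> g r" and "0 < C" "0 \<le> L"
    and g: "\<And>r. 0 \<le> r \<Longrightarrow> r \<le> s0 \<Longrightarrow> m * r \<le> g r" and "0 < m" "0 < s0"
    and x0: "0 < x0 $ k" "0 < u x0 0"
  shows "\<exists>Y0>0. \<exists>\<kappa>>0. \<forall>R. \<exists>T. \<forall>x t. Y0 \<le> x $ k \<longrightarrow> norm x \<le> R \<longrightarrow> T \<le> t \<longrightarrow> \<kappa> \<le> u x t"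
proof -
  obtain r where r: "0 < r" "\<And>R. \<exists>c>0. \<forall>h. r < h $ k \<longrightarrow> norm h \<le> R \<longrightarrow> c \<le> u h 1"
    using positivity_spreads[OF \<open>0 < D\<close> pde cont nonneg gL \<open>0 < C\<close> \<open>0 \<le> L\<close> x0] by blast
  \<comment> \<open>The coefficient 12 is 8 plus 4, the latter for the motion term, because
    \<open>norm c * R1 \<le> D\<close>.\<close>
  define B where "B = 12 * D + 4 * real CARD('n) * D"
  \<comment> \<open>Since \<open>R1 \<ge> 1\<close>, a lower bound on \<open>R1\<close> is also one
    on its square, and no square root is needed.\<close>
  define R1 where "R1 = 1 + B\<^sup>2 / (32 * m * D)"
  have "1 \<le> R1" using \<open>0 < m\<close> \<open>0 < D\<close> by (simp add: R1_def)
  have R1: "B\<^sup>2 \<le> 32 * m * D * R1\<^sup>2"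
  proof -
    have "B\<^sup>2 = 32 * m * D * (B\<^sup>2 / (32 * m * D))" using \<open>0 < m\<close> \<open>0 < D\<close> by simp
    also have "\<dots> \<le> 32 * m * D * (R1 * R1)"
    proof (rule mult_left_mono)
      have "B\<^sup>2 / (32 * m * D) \<le> R1 * 1" by (simp add: R1_def)
      also have "\<dots> \<le> R1 * R1" using \<open>1 \<le> R1\<close> by (intro mult_left_mono) auto
      finally show "B\<^sup>2 / (32 * m * D) \<le> R1 * R1" .
    qed (use \<open>0 < m\<close> \<open>0 < D\<close> in simp)
    finally show ?thesis by (simp add: power2_eq_square)
  qed
  define H where "H = (R1 + r + 1) *\<^sub>R (axis k 1 :: real^'n)"
  have H: "H $ k = R1 + r + 1" by (simp add: H_def)
  obtain c1 where c1: "0 < c1" "\<And>h. r < h $ k \<Longrightarrow> norm h \<le> norm H + R1 \<Longrightarrow> c1 \<le> u h 1"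
    using r(2) by blast
  define \<kappa> where "\<kappa> = min c1 s0 / (R1\<^sup>2)\<^sup>2"
  have \<kappa>: "0 < \<kappa>" "\<kappa> * (R1\<^sup>2)\<^sup>2 \<le> c1" "\<kappa> * (R1\<^sup>2)\<^sup>2 \<le> s0"
    using c1(1) \<open>0 < s0\<close> \<open>1 \<le> R1\<close> by (auto simp: \<kappa>_def)
  show ?thesis
  proof (rule exI[of _ "R1 + 1"], rule conjI, use \<open>1 \<le> R1\<close> in simp, rule exI[of _ "\<kappa> * (R1\<^sup>2)\<^sup>2"], intro conjI allI)
    show "0 < \<kappa> * (R1\<^sup>2)\<^sup>2" using \<open>1 \<le> R1\<close> \<kappa> by auto
    fix R :: real
    \<comment> \<open>The waiting time after which the velocity needed to reach \<open>x\<close>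
      obeys \<open>norm c * R1 \<le> D\<close>; the summand 2 keeps \<open>t - 1\<close> away from
      0.\<close>
    define T where "T = 2 + (\<bar>R\<bar> + norm H) * R1 / D"
    show "\<exists>T. \<forall>x t. R1 + 1 \<le> x $ k \<longrightarrow> norm x \<le> R \<longrightarrow> T \<le> t \<longrightarrow> \<kappa> * (R1\<^sup>2)\<^sup>2 \<le> u x t"
    proof (intro exI[of _ T] allI impI)
      fix x :: "real^'n" and t
      assume h: "R1 + 1 \<le> x $ k" "norm x \<le> R" "T \<le> t"
      have "0 \<le> (\<bar>R\<bar> + norm H) * R1 / D" using \<open>1 \<le> R1\<close> \<open>0 < D\<close> by simp
      then have t: "2 \<le> t" using h by (simp add: T_def)
      define c where "c = (1 / (t - 1)) *\<^sub>R (x - H)"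
      have tc: "(t - 1) *\<^sub>R c = x - H" using t by (simp add: c_def)
      have "norm (x - H) \<le> \<bar>R\<bar> + norm H" using h norm_triangle_ineq4[of x H] by linarith
      then have "norm (x - H) * R1 \<le> (\<bar>R\<bar> + norm H) * R1" using \<open>1 \<le> R1\<close> by (intro mult_right_mono) auto
      also have "\<dots> = D * ((\<bar>R\<bar> + norm H) * R1 / D)" using \<open>0 < D\<close> by simp
      also have "\<dots> \<le> D * (t - 1)" using h \<open>0 < D\<close> by (intro mult_left_mono) (auto simp: T_def)
      finally have cR: "norm c * R1 \<le> D" proof -
        assume "norm (x - H) * R1 \<le> D * (t - 1)"
        moreover have "norm c = norm (x - H) / (t - 1)" unfolding c_def norm_scaleR using t by simp
        ultimately show ?thesis using t by (simp add: pos_divide_le_eq)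
      qed
      have "\<kappa> * exp (0 * (t - 1)) * (R1\<^sup>2 - (norm (x - H - (t - 1) *\<^sub>R c))\<^sup>2)\<^sup>2 \<le> u x t"
      proof (rule moving_ball[OF \<open>0 < D\<close> pde cont zero_le_one _ \<kappa>(1) \<open>0 < m\<close>, where ?s0.0 = s0 and ?t1.0 = t])
        show "0 < R1" using \<open>1 \<le> R1\<close> by simp
        have "8 * D + 4 * real CARD('n) * D + 4 * norm c * R1 \<le> B" using cR by (simp add: B_def)
        then have "(8 * D + 4 * real CARD('n) * D + 4 * norm c * R1)\<^sup>2 \<le> B\<^sup>2"
          using \<open>0 < D\<close> \<open>1 \<le> R1\<close> by (intro power_mono) auto
        then show "(8 * D + 4 * real CARD('n) * D + 4 * norm c * R1)\<^sup>2 \<le> 32 * (m - 0) * D * R1\<^sup>2"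
          using R1 by simp
        fix z :: "real^'n" and s :: real
        show "0 < z $ k" if "1 \<le> s" "s \<le> t" "norm (z - H - (s - 1) *\<^sub>R c) \<le> R1"
        proof -
          define \<sigma> where "\<sigma> = (s - 1) / (t - 1)"
          have "R1 < (1 - \<sigma>) * H $ k + \<sigma> * x $ k"
            using that t r h unfolding H \<sigma>_def by (intro convex_combination_gt) auto
          also have "\<dots> = H $ k + (s - 1) * c $ k"
            by (simp add: c_def \<sigma>_def algebra_simps)
          finally show ?thesis using that by (intro ball_inside[of z H "s - 1" c R1 k]) auto
        qed
        show "\<kappa> * exp (0 * (s - 1)) * (R1\<^sup>2)\<^sup>2 \<le> s0" using \<kappa> by simp
        show "\<kappa> * (R1\<^sup>2 - (norm (z - H))\<^sup>2)\<^sup>2 \<le> u z 1" if "norm (z - H) \<le> R1"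
        proof -
          have "(norm (z - H))\<^sup>2 \<le> R1\<^sup>2" using that by (intro power_mono) auto
          then have "(R1\<^sup>2 - (norm (z - H))\<^sup>2)\<^sup>2 \<le> (R1\<^sup>2)\<^sup>2" by (intro power_mono) auto
          then have "\<kappa> * (R1\<^sup>2 - (norm (z - H))\<^sup>2)\<^sup>2 \<le> \<kappa> * (R1\<^sup>2)\<^sup>2" using \<kappa> by simp
          moreover have "c1 \<le> u z 1"
          proof (rule c1(2))
            show "r < z $ k" using component_le_norm_cart[of "z - H" k] that H by simp
            show "norm z \<le> norm H + R1" using norm_triangle_ineq2[of z H] that by linarith
          qed
          ultimately show ?thesis using \<kappa>(2) by linarith
        qed
        show "norm (x - H - (t - 1) *\<^sub>R c) \<le> R1" unfolding tc using \<open>1 \<le> R1\<close> by simp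
      qed (use nonneg g t in auto)
      then show "\<kappa> * (R1\<^sup>2)\<^sup>2 \<le> u x t" unfolding tc by simp
    qed
  qed
qed

section \<open>Lower bounds up to the interface and across it\<close>

definition lower_unif :: "'n::finite \<Rightarrow> (real^'n \<Rightarrow> real \<Rightarrow> real) \<Rightarrow> real \<Rightarrow> bool" where
  "lower_unif k w \<kappa> \<longleftrightarrow> (\<forall>R. \<exists>T. \<forall>x t. 0 \<le> x $ k \<longrightarrow> norm x \<le> R \<longrightarrow> T \<le> t \<longrightarrow> \<kappa> \<le> w x t)"

text \<open>The affine function \<open>\<epsilon> * (1 + \<mu> / D * y)\<close> balances the flux
  against \<open>v = 0\<close>, the worst case. The reaction is nonnegative at the values it takes,
  so it is a subsolution on a slab of any width, and \<open>L = 0\<close> can be used.\<close>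

lemma lower_unif_near_interface:
  fixes u v :: "real^'n::finite \<Rightarrow> real \<Rightarrow> real"
  assumes pos: "0 < D" "0 < \<mu>" "0 < \<nu>" "0 < s1"
    and cont: "half_cont k u" and pde: "evpde k D g u" and flux: "flux k D \<mu> \<nu> u v"
    and nonneg: "\<And>x t. 0 \<le> x $ k \<Longrightarrow> 0 < t \<Longrightarrow> 0 \<le> u x t" "\<And>x t. 0 \<le> x $ k \<Longrightarrow> 0 < t \<Longrightarrow> 0 \<le> v x t"
    and g: "\<And>r. r \<le> s1 \<Longrightarrow> 0 \<le> g r"
    and "0 < Y0" "0 < \<kappa>"
    and far: "\<And>R. \<exists>T. \<forall>x t. Y0 \<le> x $ k \<longrightarrow> norm x \<le> R \<longrightarrow> T \<le> t \<longrightarrow> \<kappa> \<le> u x t"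
  shows "\<exists>\<kappa>'>0. lower_unif k u \<kappa>'"
proof -
  define q where "q = 1 + \<mu> / D * Y0"
  have "1 \<le> q" using pos \<open>0 < Y0\<close> by (simp add: q_def)
  define \<epsilon> where "\<epsilon> = min \<kappa> s1 / q"
  have "0 < \<epsilon>" using \<open>1 \<le> q\<close> \<open>0 < \<kappa>\<close> pos by (simp add: \<epsilon>_def)
  have \<epsilon>q: "\<epsilon> * q \<le> \<kappa>" "\<epsilon> * q \<le> s1" using \<open>1 \<le> q\<close> by (auto simp: \<epsilon>_def)
  define \<phi> where "\<phi> = (\<lambda>y. - \<epsilon> * (1 + \<mu> / D * y))"
  have near: "\<exists>T. \<forall>x t. 0 \<le> x $ k \<longrightarrow> x $ k \<le> Y0 \<longrightarrow> norm x \<le> R \<longrightarrow> T \<le> t \<longrightarrow> - u x t \<le> \<phi> (x $ k) + \<epsilon> / 2" for R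
  proof (rule slab_comparison[OF pos(1) half_cont_uminus[OF cont] evpde_uminus[OF pde], where L = 0 and C = 0
        and v = "\<lambda>x t. - v x t" and b = 0 and \<mu> = \<mu> and \<nu> = \<nu> and ?\<phi>1.0 = "\<lambda>_. - \<epsilon> * (\<mu> / D)" and ?\<phi>2.0 = "\<lambda>_. 0"])
    show "(\<phi> has_real_derivative - \<epsilon> * (\<mu> / D)) (at y)" for y
      unfolding \<phi>_def using pos by (auto intro!: derivative_eq_intros)
    show "- g (- s) \<le> - D * 0 + 0 * (s - \<phi> y)" if "0 < y" "y < Y0" "\<phi> y \<le> s" for y s
    proof -
      have "- s \<le> \<epsilon> * (1 + \<mu> / D * y)" using that by (simp add: \<phi>_def)
      also have "\<dots> \<le> \<epsilon> * q" unfolding q_def using that pos \<open>0 < \<epsilon>\<close>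
        by (intro mult_left_mono add_left_mono) auto
      finally show ?thesis using g[of "- s"] \<epsilon>q by simp
    qed
    show "ub k (\<lambda>x t. - u x t) (\<phi> Y0) Y0" unfolding ub_def
    proof (intro allI impI)
      fix R \<epsilon>' :: real assume "0 < \<epsilon>'"
      obtain T where "\<And>x t. Y0 \<le> x $ k \<Longrightarrow> norm x \<le> R \<Longrightarrow> T \<le> t \<Longrightarrow> \<kappa> \<le> u x t" using far by blast
      moreover have "- \<kappa> \<le> \<phi> Y0" using \<epsilon>q by (simp add: \<phi>_def q_def)
      ultimately show "\<exists>T. \<forall>x t. x $ k = Y0 \<longrightarrow> norm x \<le> R \<longrightarrow> T \<le> t \<longrightarrow> - u x t \<le> \<phi> Y0 + \<epsilon>'"
        using \<open>0 < \<epsilon>'\<close> by (intro exI[of _ T] allI impI) (smt (verit))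
    qed
    have "ub k (\<lambda>x t. - v x t) 0 0" unfolding ub_def
    proof (intro allI impI)
      fix R \<epsilon>' :: real assume "0 < \<epsilon>'"
      show "\<exists>T. \<forall>x t. x $ k = 0 \<longrightarrow> norm x \<le> R \<longrightarrow> T \<le> t \<longrightarrow> - v x t \<le> 0 + \<epsilon>'"
      proof (intro exI[of _ 1] allI impI)
        fix x :: "real^'n" and t :: real assume "x $ k = 0" "1 \<le> t"
        then show "- v x t \<le> 0 + \<epsilon>'" using nonneg(2)[of x t] \<open>0 < \<epsilon>'\<close> by simp
      qed
    qed
    then show "ub k (\<lambda>x t. - u x t) (\<phi> 0) 0 \<or> 0 = (0::real) \<and> 0 < \<mu> \<and> 0 < \<nu> \<and> flux k D \<mu> \<nu> (\<lambda>x t. - u x t) (\<lambda>x t. - v x t) \<and>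
        ub k (\<lambda>x t. - v x t) 0 0 \<and> \<nu> * 0 - \<mu> * \<phi> 0 \<le> - D * (- \<epsilon> * (\<mu> / D))"
      using pos flux_uminus[OF flux] by (simp add: \<phi>_def)
  qed (use nonneg \<open>0 < Y0\<close> \<open>0 < \<epsilon>\<close> pos in auto)
  show ?thesis
  proof (intro exI[of _ "min \<kappa> (\<epsilon> / 2)"] conjI)
    show "0 < min \<kappa> (\<epsilon> / 2)" using \<open>0 < \<kappa>\<close> \<open>0 < \<epsilon>\<close> by simp
    show "lower_unif k u (min \<kappa> (\<epsilon> / 2))" unfolding lower_unif_def
    proof
      fix R
      obtain T1 where T1: "\<And>x t. Y0 \<le> x $ k \<Longrightarrow> norm x \<le> R \<Longrightarrow> T1 \<le> t \<Longrightarrow> \<kappa> \<le> u x t" using far by blast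
      obtain T2 where T2: "\<And>x t. 0 \<le> x $ k \<Longrightarrow> x $ k \<le> Y0 \<Longrightarrow> norm x \<le> R \<Longrightarrow> T2 \<le> t \<Longrightarrow> - u x t \<le> \<phi> (x $ k) + \<epsilon> / 2"
        using near by blast
      show "\<exists>T. \<forall>x t. 0 \<le> x $ k \<longrightarrow> norm x \<le> R \<longrightarrow> T \<le> t \<longrightarrow> min \<kappa> (\<epsilon> / 2) \<le> u x t"
      proof (intro exI[of _ "max T1 T2"] allI impI)
        fix x :: "real^'n" and t assume h: "0 \<le> x $ k" "norm x \<le> R" "max T1 T2 \<le> t"
        show "min \<kappa> (\<epsilon> / 2) \<le> u x t"
        proof (cases "Y0 \<le> x $ k")
          case True
          then have "\<kappa> \<le> u x t" using T1 h by simp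
          then show ?thesis by simp
        next
          case False
          have "0 \<le> \<epsilon> * (\<mu> / D * x $ k)" using \<open>0 < \<epsilon>\<close> pos h by simp
          moreover have "- u x t \<le> \<phi> (x $ k) + \<epsilon> / 2" using T2 h False by simp
          ultimately have "\<epsilon> / 2 \<le> u x t" unfolding \<phi>_def by (simp add: algebra_simps)
          then show ?thesis by simp
        qed
      qed
    qed
  qed
qed

text \<open>The affine barrier descends to 0 at \<open>y = l\<close>, where only
  \<open>0 \<le> v\<close> is known. A longer slab makes it flatter and thus never spoils the flux
  condition, so one \<epsilon> serves all balls.\<close>

lemma lower_unif_across_interface:
  fixes u v :: "real^'n::finite \<Rightarrow> real \<Rightarrow> real"
  assumes pos: "0 < d" "0 < \<mu>" "0 < \<nu>" "0 < s2" "0 < \<kappa>"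
    and cont: "half_cont k v" and pde: "evpde k d f v" and flux: "flux k d \<nu> \<mu> v u"
    and nonneg: "\<And>x t. 0 \<le> x $ k \<Longrightarrow> 0 < t \<Longrightarrow> 0 \<le> v x t"
    and f: "\<And>r. r \<le> s2 \<Longrightarrow> 0 \<le> f r"
    and u: "lower_unif k u \<kappa>"
  shows "\<exists>\<kappa>'>0. lower_unif k v \<kappa>'"
proof -
  \<comment> \<open>The supply \<open>\<mu> * \<kappa>\<close> must cover
    \<open>\<nu> * \<epsilon>\<close> and the diffusive flux, which is at most
    \<open>d * \<epsilon>\<close> because the slope is \<open>\<epsilon> / l\<close> with
    \<open>1 \<le> l\<close>.\<close>
  define \<epsilon> where "\<epsilon> = min s2 (\<mu> * \<kappa> / (\<nu> + d))"
  have "0 < \<epsilon>" using pos by (simp add: \<epsilon>_def)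
  have "\<epsilon> \<le> \<mu> * \<kappa> / (\<nu> + d)" by (simp add: \<epsilon>_def)
  then have \<epsilon>1: "\<epsilon> * (\<nu> + d) \<le> \<mu> * \<kappa>" using pos by (simp add: pos_le_divide_eq)
  have \<epsilon>2: "\<epsilon> \<le> s2" by (simp add: \<epsilon>_def)
  show ?thesis
  proof (intro exI[of _ "\<epsilon> / 4"] conjI)
    show "0 < \<epsilon> / 4" using \<open>0 < \<epsilon>\<close> by simp
    show "lower_unif k v (\<epsilon> / 4)" unfolding lower_unif_def
    proof
      fix R :: real
      \<comment> \<open>More than twice the radius: on the ball the barrier keeps at least half of
        its interface value.\<close>
      define l where "l = 2 * \<bar>R\<bar> + 1"
      have l: "1 \<le> l" by (simp add: l_def)
      define \<phi> where "\<phi> = (\<lambda>y. - \<epsilon> * (1 - y / l))"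
      have "\<exists>T. \<forall>x t. 0 \<le> x $ k \<longrightarrow> x $ k \<le> l \<longrightarrow> norm x \<le> R \<longrightarrow> T \<le> t \<longrightarrow> - v x t \<le> \<phi> (x $ k) + \<epsilon> / 4"
      proof (rule slab_comparison[OF pos(1) half_cont_uminus[OF cont] evpde_uminus[OF pde], where L = 0 and C = 0
            and v = "\<lambda>x t. - u x t" and b = "- \<kappa>" and \<mu> = \<nu> and \<nu> = \<mu> and ?\<phi>1.0 = "\<lambda>_. \<epsilon> / l" and ?\<phi>2.0 = "\<lambda>_. 0"])
        show "(\<phi> has_real_derivative \<epsilon> / l) (at y)" for y
          unfolding \<phi>_def using l by (auto intro!: derivative_eq_intros)
        show "- f (- s) \<le> - d * 0 + 0 * (s - \<phi> y)" if "0 < y" "y < l" "\<phi> y \<le> s" for y s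
        proof -
          have "- s \<le> \<epsilon> * (1 - y / l)" using that by (simp add: \<phi>_def)
          also have "\<dots> \<le> \<epsilon> * 1" using that l \<open>0 < \<epsilon>\<close> by (intro mult_left_mono) auto
          finally show ?thesis using f[of "- s"] \<epsilon>2 by simp
        qed
        show "ub k (\<lambda>x t. - v x t) (\<phi> l) l" unfolding ub_def
        proof (intro allI impI)
          fix R \<epsilon>' :: real assume "0 < \<epsilon>'"
          show "\<exists>T. \<forall>x t. x $ k = l \<longrightarrow> norm x \<le> R \<longrightarrow> T \<le> t \<longrightarrow> - v x t \<le> \<phi> l + \<epsilon>'"
          proof (intro exI[of _ 1] allI impI)
            fix x :: "real^'n" and t :: real assume "x $ k = l" "1 \<le> t"
            then show "- v x t \<le> \<phi> l + \<epsilon>'" using nonneg[of x t] \<open>0 < \<epsilon>'\<close> l by (simp add: \<phi>_def)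
          qed
        qed
        have "ub k (\<lambda>x t. - u x t) (- \<kappa>) 0" unfolding ub_def
        proof (intro allI impI)
          fix R \<epsilon>' :: real assume "0 < \<epsilon>'"
          obtain T where "\<And>x t. 0 \<le> x $ k \<Longrightarrow> norm x \<le> R \<Longrightarrow> T \<le> t \<Longrightarrow> \<kappa> \<le> u x t"
            using u unfolding lower_unif_def by blast
          then show "\<exists>T. \<forall>x t. x $ k = 0 \<longrightarrow> norm x \<le> R \<longrightarrow> T \<le> t \<longrightarrow> - u x t \<le> - \<kappa> + \<epsilon>'"
            using \<open>0 < \<epsilon>'\<close> by (intro exI[of _ T] allI impI) (smt (verit))
        qed
        moreover have "d * (\<epsilon> / l) \<le> d * \<epsilon>"
          using l pos \<open>0 < \<epsilon>\<close> by (intro mult_left_mono) (auto simp: pos_divide_le_eq)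
        ultimately show "ub k (\<lambda>x t. - v x t) (\<phi> 0) 0 \<or> 0 = (0::real) \<and> 0 < \<nu> \<and> 0 < \<mu> \<and> flux k d \<nu> \<mu> (\<lambda>x t. - v x t)
            (\<lambda>x t. - u x t) \<and>
            ub k (\<lambda>x t. - u x t) (- \<kappa>) 0 \<and> \<mu> * - \<kappa> - \<nu> * \<phi> 0 \<le> - d * (\<epsilon> / l)"
          using pos flux_uminus[OF flux] \<epsilon>1 by (simp add: \<phi>_def algebra_simps)
      qed (use nonneg l \<open>0 < \<epsilon>\<close> pos in auto)
      then obtain T where T: "\<And>x t. 0 \<le> x $ k \<Longrightarrow> x $ k \<le> l \<Longrightarrow> norm x \<le> R \<Longrightarrow> T \<le> t \<Longrightarrow> - v x t \<le> \<phi> (x $ k) + \<epsilon> / 4"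
        by blast
      show "\<exists>T. \<forall>x t. 0 \<le> x $ k \<longrightarrow> norm x \<le> R \<longrightarrow> T \<le> t \<longrightarrow> \<epsilon> / 4 \<le> v x t"
      proof (intro exI[of _ T] allI impI)
        fix x :: "real^'n" and t assume h: "0 \<le> x $ k" "norm x \<le> R" "T \<le> t"
        have "x $ k \<le> R" using component_le_norm_cart[of x k] h by linarith
        then have "2 * x $ k \<le> l" by (simp add: l_def)
        then have "x $ k / l \<le> 1 / 2" using l by (simp add: field_simps)
        then have "\<epsilon> * (1 / 2) \<le> \<epsilon> * (1 - x $ k / l)" using \<open>0 < \<epsilon>\<close> by (intro mult_left_mono) auto
        moreover have "- v x t \<le> \<phi> (x $ k) + \<epsilon> / 4" using T h \<open>2 * x $ k \<le> l\<close> by simp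
        ultimately show "\<epsilon> / 4 \<le> v x t" unfolding \<phi>_def by simp
      qed
    qed
  qed
qed

section \<open>Exact profiles of the one-dimensional problem\<close>

text \<open>The first integral of \<open>w'' = h(w)\<close> for the solution that decays to \<open>0\<close>: \<open>w' = - pspeed h w\<close>.\<close>

definition pspeed :: "(real \<Rightarrow> real) \<Rightarrow> real \<Rightarrow> real" where
  "pspeed h s = sqrt (2 * integral {0..s} h)"

lemma integral_0_deriv:
  fixes h :: "real \<Rightarrow> real"
  assumes "continuous_on {0..} h" "0 < s"
  shows "((\<lambda>s. integral {0..s} h) has_real_derivative h s) (at s)"
proof -
  have "((\<lambda>s. integral {0..s} h) has_real_derivative h s) (at s within {0..s + 1})"
    by (rule integral_has_real_derivative[OF continuous_on_subset[OF assms(1)]]) (use assms in auto)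
  then have "((\<lambda>s. integral {0..s} h) has_real_derivative h s) (at s within {0<..<s + 1})"
    by (rule DERIV_subset) auto
  then show ?thesis using assms(2) by (simp add: at_within_open[of s "{0<..<s + 1}"])
qed

lemma integral_0_cont:
  fixes h :: "real \<Rightarrow> real"
  assumes "continuous_on {0..} h"
  shows "continuous_on {0..X} (\<lambda>s. integral {0..s} h)"
  by (intro indefinite_integral_continuous_1 integrable_continuous_real continuous_on_subset[OF assms]) auto

lemma integral_0_le:
  fixes h :: "real \<Rightarrow> real"
  assumes "continuous_on {0..} h" "\<And>s. 0 < s \<Longrightarrow> h s \<le> L * s" "0 \<le> s"
  shows "integral {0..s} h \<le> L * s\<^sup>2 / 2"
proof -
  let ?F = "\<lambda>s. L * s\<^sup>2 / 2 - integral {0..s} h"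
  have "?F 0 \<le> ?F s"
  proof (rule DERIV_nonneg_imp_increasing_open[OF assms(3)])
    fix x assume "0 < x" "x < s"
    then show "\<exists>y. (?F has_real_derivative y) (at x) \<and> 0 \<le> y"
      using assms(2)[of x] by (intro exI[of _ "L * x - h x"])
          (auto intro!: derivative_eq_intros integral_0_deriv[OF assms(1)])
  next
    show "continuous_on {0..s} ?F" by (intro continuous_intros integral_0_cont assms) simp
  qed
  then show ?thesis by simp
qed

lemma integral_0_strict_mono:
  fixes h :: "real \<Rightarrow> real"
  assumes "continuous_on {0..} h" "\<And>s. 0 < s \<Longrightarrow> 0 < h s" "0 \<le> a" "a < b"
  shows "integral {0..a} h < integral {0..b} h"
proof (rule DERIV_pos_imp_increasing_open[OF assms(4)])
  fix x assume "a < x" "x < b"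
  then show "\<exists>y. ((\<lambda>s. integral {0..s} h) has_real_derivative y) (at x) \<and> 0 < y"
    using assms(2)[of x] assms(3) by (intro exI[of _ "h x"] conjI integral_0_deriv[OF assms(1)]) auto
next
  show "continuous_on {a..b} (\<lambda>s. integral {0..s} h)"
    by (rule continuous_on_subset[OF integral_0_cont[OF assms(1), of b]]) (use assms(3) in auto)
qed

lemma pspeed_0 [simp]: "pspeed h 0 = 0"
  by (simp add: pspeed_def)

lemma pspeed_strict_mono:
  assumes "continuous_on {0..} h" "\<And>s. 0 < s \<Longrightarrow> 0 < h s" "0 \<le> a" "a < b"
  shows "pspeed h a < pspeed h b"
  using integral_0_strict_mono[OF assms] by (simp add: pspeed_def)

lemma pspeed_pos:
  assumes "continuous_on {0..} h" "\<And>s. 0 < s \<Longrightarrow> 0 < h s" "0 < s"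
  shows "0 < pspeed h s"
  using pspeed_strict_mono[OF assms(1,2) order_refl assms(3)] by simp

lemma pspeed_le:
  assumes "continuous_on {0..} h" "\<And>s. 0 < s \<Longrightarrow> h s \<le> L * s" "0 \<le> L" "0 \<le> s"
  shows "pspeed h s \<le> sqrt L * s"
proof -
  have "pspeed h s \<le> sqrt (L * s\<^sup>2)"
    unfolding pspeed_def using integral_0_le[OF assms(1,2,4)] by simp
  then show ?thesis using assms by (simp add: real_sqrt_mult)
qed

lemma pspeed_cont:
  assumes "continuous_on {0..} h"
  shows "continuous_on {0..X} (pspeed h)"
  unfolding pspeed_def by (intro continuous_intros integral_0_cont assms)

lemma pspeed_deriv:
  assumes "continuous_on {0..} h" "\<And>s. 0 < s \<Longrightarrow> 0 < h s" "0 < s"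
  shows "(pspeed h has_real_derivative h s / pspeed h s) (at s)"
proof -
  have "0 < integral {0..s} h"
    using integral_0_strict_mono[OF assms(1,2) order_refl assms(3)] by simp
  then show ?thesis unfolding pspeed_def
    by (auto intro!: derivative_eq_intros integral_0_deriv assms simp: field_simps real_sqrt_mult)
qed

text \<open>Up to a constant, the time at which the flow \<open>w' = - pspeed h w\<close> reaches
  \<open>s\<close>. Profiles are obtained by inverting it, which needs no Lipschitz property of
  \<open>pspeed\<close> near 0.\<close>

lemma travel_time_exists:
  assumes "continuous_on {0..} h" "\<And>s. 0 < s \<Longrightarrow> 0 < h s"
  shows "\<exists>T. \<forall>s>0. (T has_real_derivative - 1 / pspeed h s) (at s)"
proof -
  have "isCont (\<lambda>s. - 1 / pspeed h s) s" if "0 < s" for s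
    using pspeed_pos[OF assms that] DERIV_isCont[OF pspeed_deriv[OF assms that]]
    by (intro continuous_intros) auto
  then obtain T where "\<forall>s. ereal 0 < ereal s \<longrightarrow> ereal s < \<infinity> \<longrightarrow> (T has_vector_derivative - 1 / pspeed h s) (at s)"
    using einterval_antiderivative[of "ereal 0" \<infinity> "\<lambda>s. - 1 / pspeed h s"] by auto
  then show ?thesis
    by (auto simp: has_real_derivative_iff_has_vector_derivative)
qed

lemma travel_time_strict_antimono:
  assumes "continuous_on {0..} h" "\<And>s. 0 < s \<Longrightarrow> 0 < h s"
    and T: "\<And>s. 0 < s \<Longrightarrow> (T has_real_derivative - 1 / pspeed h s) (at s)" and "0 < a" "a < b"
  shows "T b < T a"
proof (rule DERIV_neg_imp_decreasing[OF \<open>a < b\<close>])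
  fix x assume "a \<le> x" "x \<le> b"
  then show "\<exists>y. (T has_real_derivative y) (at x) \<and> y < 0"
    using T[of x] pspeed_pos[OF assms(1,2), of x] \<open>0 < a\<close>
    by (intro exI[of _ "- 1 / pspeed h x"]) auto
qed

text \<open>The bound \<open>h s \<le> L * s\<close> makes \<open>T s + ln s / sqrt L\<close>
  nonincreasing, so travel times are unbounded at both ends. Hence the inverse of \<open>T\<close>
  is defined on the whole line and takes every positive value; the sweeps use its
  translates.\<close>

lemma profile_exists:
  assumes cont: "continuous_on {0..} h" and h: "\<And>s. 0 < s \<Longrightarrow> 0 < h s" "\<And>s. 0 < s \<Longrightarrow> h s \<le> L * s"
    and "0 < b"
  obtains w where "\<And>y. 0 < w y" "w 0 = b"
    "\<And>y. (w has_real_derivative - pspeed h (w y)) (at y)"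
    "\<And>y. ((\<lambda>y. - pspeed h (w y)) has_real_derivative h (w y)) (at y)"
    "\<And>s. 0 < s \<Longrightarrow> \<exists>y. w y = s" "\<And>x y. x < y \<Longrightarrow> w y < w x"
proof -
  obtain T0 where T0: "\<And>s. 0 < s \<Longrightarrow> (T0 has_real_derivative - 1 / pspeed h s) (at s)"
    using travel_time_exists[OF cont h(1)] by blast
  define T where "T = (\<lambda>s. T0 s - T0 b)"
  have T: "(T has_real_derivative - 1 / pspeed h s) (at s)" if "0 < s" for s
    unfolding T_def using T0[OF that] by (auto intro!: derivative_eq_intros)
  have dec: "T t < T s" if "0 < s" "s < t" for s t
    by (rule travel_time_strict_antimono[OF cont h(1) T that])
  have "0 < L" using h(1)[of 1] h(2)[of 1] by simp
  have P: "0 < pspeed h s" "pspeed h s \<le> sqrt L * s" if "0 < s" for s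
    using pspeed_pos[OF cont h(1) that] pspeed_le[OF cont h(2), of s] that \<open>0 < L\<close> by auto
  have logb: "T t + ln t / sqrt L \<le> T s + ln s / sqrt L" if "0 < s" "s \<le> t" for s t
  proof (rule DERIV_nonpos_imp_nonincreasing[OF that(2)])
    fix x assume "s \<le> x" "x \<le> t"
    then have "0 < x" using that by simp
    have "1 / (sqrt L * x) \<le> 1 / pspeed h x"
      using P[OF \<open>0 < x\<close>] \<open>0 < x\<close> \<open>0 < L\<close> by (intro divide_left_mono mult_pos_pos) auto
    then show "\<exists>y. ((\<lambda>s. T s + ln s / sqrt L) has_real_derivative y) (at x) \<and> y \<le> 0"
      using DERIV_add[OF T[OF \<open>0 < x\<close>] DERIV_cdivide[OF DERIV_ln_divide[OF \<open>0 < x\<close>], of "sqrt L"]]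
      by (intro exI[of _ "- 1 / pspeed h x + 1 / x / sqrt L"]) (simp add: mult.commute)
  qed
  have surj: "\<exists>s>0. T s = y" for y
  proof -
    \<comment> \<open>The exponential solves \<open>T 1 - ln s / sqrt L = y\<close> for
      \<open>s\<close>. The minimum and maximum with 1 select the side on which \<open>logb\<close>
      gives the required inequality.\<close>
    define s1 where "s1 = min 1 (exp (sqrt L * (T 1 - y)))"
    define s2 where "s2 = max 1 (exp (sqrt L * (T 1 - y)))"
    have s: "0 < s1" "s1 \<le> 1" "1 \<le> s2" "ln s1 \<le> sqrt L * (T 1 - y)" "sqrt L * (T 1 - y) \<le> ln s2"
      by (auto simp: s1_def s2_def min_def max_def ln_ge_iff) (use ln_le_cancel_iff exp_gt_zero in \<open>force+\<close>)?
    have "ln s1 / sqrt L \<le> T 1 - y" "T 1 - y \<le> ln s2 / sqrt L"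
      using s \<open>0 < L\<close> by (simp_all add: field_simps)
    then have "y \<le> T s1" "T s2 \<le> y" using logb[of s1 1] logb[of 1 s2] s by auto
    moreover have "isCont T x" if "s1 \<le> x" for x
      using DERIV_isCont[OF T[of x]] that s by simp
    ultimately obtain x where "s1 \<le> x" "T x = y"
      using IVT2[of T s2 y s1] s by auto
    then show ?thesis using s by (intro exI[of _ x]) auto
  qed
  define w where "w = (\<lambda>y. SOME s. 0 < s \<and> T s = y)"
  have w: "0 < w y" "T (w y) = y" for y
    using someI_ex[OF surj[of y]] unfolding w_def by auto
  have wT: "w (T s) = s" if "0 < s" for s
    using dec[of s "w (T s)"] dec[of "w (T s)" s] w[of "T s"] that by (metis less_irrefl linorder_neqE_linordered_idom)
  have cw: "isCont w y" for y
  proof -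
    have "isCont w (T (w y))"
      by (rule isCont_inverse_function2[of "w y / 2" "w y" "2 * w y"])
        (use w(1)[of y] in \<open>auto intro!: wT DERIV_isCont[OF T]\<close>)
    then show ?thesis by (simp add: w)
  qed
  have dw: "(w has_real_derivative - pspeed h (w y)) (at y)" for y
  proof -
    have "(w has_real_derivative inverse (- 1 / pspeed h (w y))) (at y)"
      by (rule DERIV_inverse_function[where f = T and a = "y - 1" and b = "y + 1"])
        (use w P[OF w(1)[of y]] cw T in auto)
    then show ?thesis by simp
  qed
  show ?thesis
  proof (rule that[of w])
    show "w 0 = b" using wT[OF \<open>0 < b\<close>] by (simp add: T_def)
    show "((\<lambda>y. - pspeed h (w y)) has_real_derivative h (w y)) (at y)" for y
      using DERIV_minus[OF DERIV_chain2[OF pspeed_deriv[OF cont h(1) w(1)] dw[of y]]] P[OF w(1)[of y]] by simp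
    show "\<exists>y. w y = s" if "0 < s" for s using wT[OF that] by blast
    show "w y < w x" if "x < y" for x y
      using dec[OF w(1)[of x], of "w y"] w that by (metis less_asym linorder_neqE_linordered_idom)
  qed (use w dw in auto)
qed

text \<open>Two solutions of first order equations \<open>w' = - P(w)\<close> are compared through the travel time of one of them.\<close>

lemma travel_time_exact:
  assumes "continuous_on {0..} h" "\<And>s. 0 < s \<Longrightarrow> 0 < h s"
    and T: "\<And>s. 0 < s \<Longrightarrow> (T has_real_derivative - 1 / pspeed h s) (at s)"
    and w: "\<And>y. 0 \<le> y \<Longrightarrow> 0 < w y" "\<And>y. 0 \<le> y \<Longrightarrow> (w has_real_derivative - pspeed h (w y)) (at y)"
    and "0 \<le> y"
  shows "T (w y) = T (w 0) + y"
proof (cases "y = 0")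
  case False
  have "T (w y) - y = T (w 0) - 0"
  proof (rule DERIV_isconst2[where f = "\<lambda>y. T (w y) - y" and a = 0 and b = y])
    show "0 < y" using False assms by simp
    have d: "((\<lambda>y. T (w y) - y) has_real_derivative 0) (at x)" if "0 \<le> x" for x
      using DERIV_chain2[OF T[OF w(1)] w(2), OF that that] pspeed_pos[OF assms(1,2) w(1)[OF that]]
      by (auto intro!: derivative_eq_intros)
    show "continuous_on {0..y} (\<lambda>y. T (w y) - y)"
      by (intro continuous_at_imp_continuous_on ballI DERIV_isCont[OF d]) auto
    show "((\<lambda>y. T (w y) - y) has_real_derivative 0) (at x)" if "0 < x" "x < y" for x using d that by simp
  qed (use assms in auto)
  then show ?thesis by simp
qed simp

text \<open>While \<open>x\<close> stays above \<open>s\<close>, its travel time grows at rate at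
  least \<open>e\<close>. The maximum with \<open>s\<close> appears because a perturbed speed is
  comparable with the exact one only away from 0.\<close>

lemma slow_profile_le:
  assumes cont: "continuous_on {0..} h" and h: "\<And>s. 0 < s \<Longrightarrow> 0 < h s"
    and w: "\<And>y. 0 \<le> y \<Longrightarrow> 0 < w y" "\<And>y. 0 \<le> y \<Longrightarrow> (w has_real_derivative - pspeed h (w y)) (at y)"
    and x: "\<And>y. 0 \<le> y \<Longrightarrow> (x has_real_derivative - q y) (at y)" "\<And>y z. 0 \<le> y \<Longrightarrow> y \<le> z \<Longrightarrow> x z \<le> x y" "x 0 = w 0"
    and q: "\<And>y. 0 \<le> y \<Longrightarrow> s \<le> x y \<Longrightarrow> e * pspeed h (x y) \<le> q y"
    and "0 < s" "0 \<le> e" "0 \<le> y"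
  shows "x y \<le> max s (w (e * y))"
proof (rule ccontr)
  assume "\<not> ?thesis"
  then have viol: "s < x y" "w (e * y) < x y" by auto
  obtain T where T: "\<And>s. 0 < s \<Longrightarrow> (T has_real_derivative - 1 / pspeed h s) (at s)"
    using travel_time_exists[OF cont h] by blast
  have xs: "s < x z" if "0 \<le> z" "z \<le> y" for z using x(2)[of z y] that viol by simp
  have "T (x 0) - e * 0 \<le> T (x y) - e * y"
  proof (rule DERIV_nonneg_imp_nondecreasing[OF \<open>0 \<le> y\<close>])
    fix z assume z: "0 \<le> z" "z \<le> y"
    have p: "0 < x z" "0 < pspeed h (x z)" using xs[OF z] \<open>0 < s\<close> pspeed_pos[OF cont h] by auto
    have "e \<le> q z / pspeed h (x z)" using q[OF z(1)] xs[OF z] p by (simp add: pos_le_divide_eq)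
    then show "\<exists>r. ((\<lambda>z. T (x z) - e * z) has_real_derivative r) (at z) \<and> 0 \<le> r"
      using DERIV_chain2[OF T[OF p(1)] x(1)[OF z(1)]]
      by (intro exI[of _ "- 1 / pspeed h (x z) * (- q z) - e"]) (auto intro!: derivative_eq_intros)
  qed
  moreover have "T (w (e * y)) = T (w 0) + e * y"
    using assms by (intro travel_time_exact[OF cont h T w]) auto
  ultimately have "T (w (e * y)) \<le> T (x y)" using x(3) by simp
  moreover have "T (x y) < T (w (e * y))"
    by (rule travel_time_strict_antimono[OF cont h T w(1) viol(2)]) (use assms in auto)
  ultimately show False by simp
qed

text \<open>The counterpart of \<open>slow_profile_le\<close>. The threshold lies strictly below the
  asserted bound: if \<open>x\<close> dropped to \<open>s\<close> before \<open>y\<close>, then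
  \<open>w\<close> would be at most \<open>s\<close> too early.\<close>

lemma fast_profile_ge:
  assumes cont: "continuous_on {0..} h" and h: "\<And>s. 0 < s \<Longrightarrow> 0 < h s"
    and w: "\<And>y. 0 \<le> y \<Longrightarrow> 0 < w y" "\<And>y. 0 \<le> y \<Longrightarrow> (w has_real_derivative - pspeed h (w y)) (at y)"
    and x: "\<And>y. 0 \<le> y \<Longrightarrow> (x has_real_derivative - q y) (at y)" "\<And>y z. 0 \<le> y \<Longrightarrow> y \<le> z \<Longrightarrow> x z \<le> x y" "x 0 = w 0"
    and q: "\<And>y. 0 \<le> y \<Longrightarrow> s \<le> x y \<Longrightarrow> q y \<le> e * pspeed h (x y)"
    and s: "0 < s" "s < w (e * y)" and "0 \<le> e" "0 \<le> y"
  shows "w (e * y) \<le> x y"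
proof -
  obtain T where T: "\<And>s. 0 < s \<Longrightarrow> (T has_real_derivative - 1 / pspeed h s) (at s)"
    using travel_time_exists[OF cont h] by blast
  have anti: "w z \<le> w z'" if "0 \<le> z'" "z' \<le> z" for z z'
  proof (rule DERIV_nonpos_imp_nonincreasing[OF that(2)])
    fix r assume "z' \<le> r" "r \<le> z"
    then show "\<exists>d. (w has_real_derivative d) (at r) \<and> d \<le> 0"
      using w[of r] pspeed_pos[OF cont h w(1)[of r]] that by (intro exI[of _ "- pspeed h (w r)"]) auto
  qed
  have main: "w (e * z) \<le> x z" if z: "0 \<le> z" "s \<le> x z" for z
  proof (rule ccontr)
    assume "\<not> w (e * z) \<le> x z"
    have xs: "s \<le> x r" if "0 \<le> r" "r \<le> z" for r using x(2)[of r z] that z by simp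
    have "T (x z) - e * z \<le> T (x 0) - e * 0"
    proof (rule DERIV_nonpos_imp_nonincreasing[OF z(1)])
      fix r assume r: "0 \<le> r" "r \<le> z"
      have p: "0 < x r" "0 < pspeed h (x r)" using xs[OF r] s pspeed_pos[OF cont h] by auto
      have "q r / pspeed h (x r) \<le> e" using q[OF r(1)] xs[OF r] p by (simp add: pos_divide_le_eq)
      then show "\<exists>d. ((\<lambda>z. T (x z) - e * z) has_real_derivative d) (at r) \<and> d \<le> 0"
        using DERIV_chain2[OF T[OF p(1)] x(1)[OF r(1)]]
        by (intro exI[of _ "- 1 / pspeed h (x r) * (- q r) - e"]) (auto intro!: derivative_eq_intros)
    qed
    moreover have "T (w (e * z)) = T (w 0) + e * z"
      using assms z by (intro travel_time_exact[OF cont h T w]) auto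
    ultimately have "T (x z) \<le> T (w (e * z))" using x(3) by simp
    moreover have "T (w (e * z)) < T (x z)"
      by (rule travel_time_strict_antimono[OF cont h T]) (use z s \<open>\<not> w (e * z) \<le> x z\<close> in auto)
    ultimately show False by simp
  qed
  show ?thesis
  proof (cases "s \<le> x y")
    case True
    then show ?thesis using main \<open>0 \<le> y\<close> by simp
  next
    case False
    have "w (e * y) \<le> w 0" using assms by (intro anti) auto
    then have "s < x 0" using s x(3) by simp
    moreover have "isCont x r" if "0 \<le> r" for r using DERIV_isCont[OF x(1)[OF that]] .
    ultimately obtain z where z: "0 \<le> z" "z \<le> y" "x z = s"
      using IVT2[of x y s 0] False \<open>0 \<le> y\<close> by auto
    then have "w (e * z) \<le> s" using main[of z] by simp
    moreover have "w (e * y) \<le> w (e * z)" using z assms by (intro anti mult_left_mono) auto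
    ultimately show ?thesis using s by simp
  qed
qed

section \<open>One-dimensional subsolutions\<close>

text \<open>A comparison property in the spirit of viscosity subsolutions, with the restriction on
  the width inherited from the slabs. It is what remains of the equation for an envelope not known
  to be continuous.\<close>

definition subsol :: "real \<Rightarrow> real \<Rightarrow> (real \<Rightarrow> real) \<Rightarrow> (real \<Rightarrow> real) \<Rightarrow> bool" where
  "subsol D L g n \<longleftrightarrow> (\<forall>y1 y2 \<phi> \<phi>1 \<phi>2. 0 \<le> y1 \<longrightarrow> y1 < y2 \<longrightarrow> L * (y2 - y1)\<^sup>2 \<le> D / 2 \<longrightarrow>
     (\<forall>y. y1 \<le> y \<longrightarrow> y \<le> y2 \<longrightarrow> (\<phi> has_real_derivative \<phi>1 y) (at y)) \<longrightarrow>
     (\<forall>y. y1 \<le> y \<longrightarrow> y \<le> y2 \<longrightarrow> (\<phi>1 has_real_derivative \<phi>2 y) (at y)) \<longrightarrow>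
     (\<forall>y. y1 < y \<longrightarrow> y < y2 \<longrightarrow> g (\<phi> y) \<le> - D * \<phi>2 y) \<longrightarrow>
     n y1 \<le> \<phi> y1 \<longrightarrow> n y2 \<le> \<phi> y2 \<longrightarrow> (\<forall>y. y1 \<le> y \<longrightarrow> y \<le> y2 \<longrightarrow> n y \<le> \<phi> y))"

lemma subsolD:
  assumes "subsol D L g n" "0 \<le> y1" "y1 < y2" "L * (y2 - y1)\<^sup>2 \<le> D / 2"
    "\<And>y. y1 \<le> y \<Longrightarrow> y \<le> y2 \<Longrightarrow> (\<phi> has_real_derivative \<phi>1 y) (at y)"
    "\<And>y. y1 \<le> y \<Longrightarrow> y \<le> y2 \<Longrightarrow> (\<phi>1 has_real_derivative \<phi>2 y) (at y)"
    "\<And>y. y1 < y \<Longrightarrow> y < y2 \<Longrightarrow> g (\<phi> y) \<le> - D * \<phi>2 y"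
    "n y1 \<le> \<phi> y1" "n y2 \<le> \<phi> y2" "y1 \<le> y" "y \<le> y2"
  shows "n y \<le> \<phi> y"
  using assms(1)[unfolded subsol_def, rule_format, of y1 y2 \<phi> \<phi>1 \<phi>2 y] assms by blast

definition lip :: "real \<Rightarrow> (real \<Rightarrow> real) \<Rightarrow> bool" where
  "lip L g \<longleftrightarrow> 0 < L \<and> (\<forall>a b. \<bar>g a - g b\<bar> \<le> L * \<bar>a - b\<bar>)"

lemma lipD: "lip L g \<Longrightarrow> \<bar>g a - g b\<bar> \<le> L * \<bar>a - b\<bar>" and lip_pos: "lip L g \<Longrightarrow> 0 < L"
  by (auto simp: lip_def)

lemma lip_continuous: "lip L g \<Longrightarrow> continuous_on A g"
proof -
  assume l: "lip L g"
  have "L-lipschitz_on A g"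
    using lipD[OF l] lip_pos[OF l] by (intro lipschitz_onI) (auto simp: dist_real_def)
  then show ?thesis by (rule lipschitz_on_continuous_on)
qed

text \<open>Takes the place of the strong maximum principle, whose strictness would not be uniform
  on the half-line: the margin \<gamma> lets a parabolic dent of fixed depth be pressed into
  \<open>W\<close> around every point.\<close>

lemma subsol_gain:
  assumes "0 < D" and sub: "subsol D L g n" and g: "lip L g"
    and W: "\<And>y. 0 \<le> y \<Longrightarrow> (W has_real_derivative W1 y) (at y)" "\<And>y. 0 \<le> y \<Longrightarrow> (W1 has_real_derivative W2 y) (at y)"
    and super: "\<And>y. 0 \<le> y \<Longrightarrow> g (W y) + \<gamma> \<le> - D * W2 y" and "0 < \<gamma>"
    and le: "\<And>y. 0 \<le> y \<Longrightarrow> n y \<le> W y" and "n 0 < W 0"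
  shows "\<exists>\<delta>>0. \<forall>y\<ge>0. n y \<le> W y - \<delta>"
proof -
  have "0 < L" using lip_pos[OF g] .
  \<comment> \<open>Intervals of length \<open>2 * \<rho>\<close> are used, and
    \<open>4 * L * \<rho>\<^sup>2 = D / 2\<close> is the largest width allowed by
    \<open>subsol\<close>.\<close>
  define \<rho> where "\<rho> = sqrt (D / (8 * L))"
  have "0 < \<rho>" using \<open>0 < D\<close> \<open>0 < L\<close> by (simp add: \<rho>_def)
  have \<rho>2: "L * \<rho>\<^sup>2 = D / 8" using \<open>0 < D\<close> \<open>0 < L\<close> by (simp add: \<rho>_def)
  \<comment> \<open>The depth at which the Lipschitz change \<open>L * \<delta>0\<close> together
    with the curvature of the dent uses up the margin exactly.\<close>
  define \<delta>0 where "\<delta>0 = \<gamma> / (L + 2 * D / \<rho>\<^sup>2)"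
  have den: "0 < L + 2 * D / \<rho>\<^sup>2" using \<open>0 < D\<close> \<open>0 < L\<close> by (simp add: add_pos_nonneg)
  then have "0 < \<delta>0" using \<open>0 < \<gamma>\<close> by (simp add: \<delta>0_def)
  have \<delta>0: "L * \<delta>0 + D * (2 * \<delta>0 / \<rho>\<^sup>2) = \<gamma>"
  proof -
    have "L * \<delta>0 + D * (2 * \<delta>0 / \<rho>\<^sup>2) = (L + 2 * D / \<rho>\<^sup>2) * \<delta>0" by (simp add: algebra_simps)
    then show ?thesis using den by (simp add: \<delta>0_def)
  qed
  define \<delta> where "\<delta> = min \<delta>0 (W 0 - n 0)"
  have "0 < \<delta>" using \<open>0 < \<delta>0\<close> assms(9) by (simp add: \<delta>_def)
  have far: "n y \<le> W y - \<delta>0" if "\<rho> \<le> y" for y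
  proof -
    define \<phi> where "\<phi> = (\<lambda>x. W x - \<delta>0 + \<delta>0 * ((x - y) / \<rho>)\<^sup>2)"
    have "n y \<le> \<phi> y"
    proof (rule subsolD[OF sub, where ?y1.0 = "y - \<rho>" and ?y2.0 = "y + \<rho>" and \<phi> = \<phi>
          and ?\<phi>1.0 = "\<lambda>x. W1 x + 2 * \<delta>0 / \<rho>\<^sup>2 * (x - y)" and ?\<phi>2.0 = "\<lambda>x. W2 x + 2 * \<delta>0 / \<rho>\<^sup>2"])
      show "0 \<le> y - \<rho>" "y - \<rho> < y + \<rho>" "y - \<rho> \<le> y" "y \<le> y + \<rho>" using that \<open>0 < \<rho>\<close> by auto
      have "L * (y + \<rho> - (y - \<rho>))\<^sup>2 = 4 * (L * \<rho>\<^sup>2)" by (simp add: power2_eq_square)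
      then show "L * (y + \<rho> - (y - \<rho>))\<^sup>2 \<le> D / 2" using \<rho>2 by simp
      fix x
      show "(\<phi> has_real_derivative W1 x + 2 * \<delta>0 / \<rho>\<^sup>2 * (x - y)) (at x)" if "y - \<rho> \<le> x"
        unfolding \<phi>_def using W(1)[of x] that \<open>\<rho> \<le> y\<close> \<open>0 < \<rho>\<close>
        by (auto intro!: derivative_eq_intros simp: field_simps power2_eq_square)
      show "((\<lambda>x. W1 x + 2 * \<delta>0 / \<rho>\<^sup>2 * (x - y)) has_real_derivative W2 x + 2 * \<delta>0 / \<rho>\<^sup>2) (at x)" if "y - \<rho> \<le> x"
      proof -
        have lin: "((\<lambda>x. c * (x - y)) has_real_derivative c) (at x)" for c :: real
          by (auto intro!: derivative_eq_intros)
        show ?thesis by (rule DERIV_add[OF W(2) lin]) (use that \<open>\<rho> \<le> y\<close> in simp)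
      qed
      show "g (\<phi> x) \<le> - D * (W2 x + 2 * \<delta>0 / \<rho>\<^sup>2)" if "y - \<rho> < x" "x < y + \<rho>"
      proof -
        have "\<bar>(x - y) / \<rho>\<bar> \<le> 1" using that \<open>0 < \<rho>\<close> by (simp add: abs_le_iff)
        then have sq: "((x - y) / \<rho>)\<^sup>2 \<le> 1" by (simp add: abs_square_le_1)
        have "\<bar>\<phi> x - W x\<bar> = \<delta>0 * (1 - ((x - y) / \<rho>)\<^sup>2)"
        proof -
          have "\<phi> x - W x = - (\<delta>0 * (1 - ((x - y) / \<rho>)\<^sup>2))" by (simp add: \<phi>_def algebra_simps)
          then show ?thesis using sq \<open>0 < \<delta>0\<close> by simp
        qed
        also have "\<dots> \<le> \<delta>0 * 1" using \<open>0 < \<delta>0\<close> by (intro mult_left_mono) auto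
        finally have "L * \<bar>\<phi> x - W x\<bar> \<le> L * \<delta>0" using \<open>0 < L\<close> by simp
        then have "g (\<phi> x) \<le> g (W x) + L * \<delta>0" using lipD[OF g, of "\<phi> x" "W x"] by linarith
        moreover have "g (W x) + \<gamma> \<le> - D * W2 x" using super[of x] that \<open>\<rho> \<le> y\<close> by simp
        ultimately show ?thesis using \<delta>0 by (simp add: distrib_left)
      qed
      show "n (y - \<rho>) \<le> \<phi> (y - \<rho>)" "n (y + \<rho>) \<le> \<phi> (y + \<rho>)"
        using le[of "y - \<rho>"] le[of "y + \<rho>"] that \<open>0 < \<rho>\<close> by (auto simp: \<phi>_def)
    qed
    then show ?thesis by (simp add: \<phi>_def)
  qed
  \<comment> \<open>No room for a dent near 0, so \<open>W\<close> is lowered by a constant;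
    \<open>n 0 < W 0\<close> covers the left end and \<open>far\<close> the right one.\<close>
  have near: "n y \<le> W y - \<delta>" if "0 \<le> y" "y \<le> \<rho>" for y
  proof (rule subsolD[OF sub, where ?y1.0 = 0 and ?y2.0 = \<rho> and \<phi> = "\<lambda>y. W y - \<delta>" and ?\<phi>1.0 = W1 and ?\<phi>2.0 = W2])
    show "L * (\<rho> - 0)\<^sup>2 \<le> D / 2" using \<rho>2 \<open>0 < D\<close> by simp
    fix x
    show "((\<lambda>y. W y - \<delta>) has_real_derivative W1 x) (at x)" if "0 \<le> x"
      using W(1)[OF that] by (auto intro!: derivative_eq_intros)
    show "g (W x - \<delta>) \<le> - D * W2 x" if "0 < x"
    proof -
      have "g (W x - \<delta>) \<le> g (W x) + L * \<delta>" using lipD[OF g, of "W x - \<delta>" "W x"] \<open>0 < \<delta>\<close> by simp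
      moreover have "L * \<delta> \<le> L * \<delta>0" using \<open>0 < L\<close> by (simp add: \<delta>_def)
      moreover have "0 \<le> D * (2 * \<delta>0 / \<rho>\<^sup>2)" using \<open>0 < D\<close> \<open>0 < \<delta>0\<close> by simp
      ultimately show ?thesis using super[of x] that \<delta>0 by linarith
    qed
    show "n \<rho> \<le> W \<rho> - \<delta>" using far[of \<rho>] by (simp add: \<delta>_def)
  qed (use that W \<open>0 < \<rho>\<close> in \<open>auto simp: \<delta>_def\<close>)
  show ?thesis
  proof (intro exI[of _ \<delta>] conjI allI impI)
    fix y :: real assume "0 \<le> y"
    then show "n y \<le> W y - \<delta>"
      using near[of y] far[of y] by (cases "y \<le> \<rho>") (auto simp: \<delta>_def)
  qed fact
qed

text \<open>Sliding method: at the least admissible parameter the gap from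
  \<open>subsol_gain\<close> is uniform in \<open>y\<close>, so by Lipschitz dependence on \<tau>
  the parameter could still be lowered unless it is 0.\<close>

lemma subsol_sweep:
  assumes "0 < D" and sub: "subsol D L g n" and g: "lip L g"
    and W: "\<And>\<tau> y. 0 \<le> \<tau> \<Longrightarrow> \<tau> \<le> \<tau>0 \<Longrightarrow> 0 \<le> y \<Longrightarrow> (W \<tau> has_real_derivative W1 \<tau> y) (at y)"
       "\<And>\<tau> y. 0 \<le> \<tau> \<Longrightarrow> \<tau> \<le> \<tau>0 \<Longrightarrow> 0 \<le> y \<Longrightarrow> (W1 \<tau> has_real_derivative W2 \<tau> y) (at y)"
    and super: "\<And>\<tau> y. 0 \<le> \<tau> \<Longrightarrow> \<tau> \<le> \<tau>0 \<Longrightarrow> 0 \<le> y \<Longrightarrow> g (W \<tau> y) + \<gamma> \<le> - D * W2 \<tau> y" and "0 < \<gamma>"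
    and K: "\<And>\<sigma> \<tau> y. 0 \<le> \<sigma> \<Longrightarrow> \<sigma> \<le> \<tau> \<Longrightarrow> \<tau> \<le> \<tau>0 \<Longrightarrow> 0 \<le> y \<Longrightarrow> \<bar>W \<tau> y - W \<sigma> y\<bar> \<le> K * (\<tau> - \<sigma>)"
    and start: "0 \<le> \<tau>0" "\<And>y. 0 \<le> y \<Longrightarrow> n y \<le> W \<tau>0 y"
    and bdry: "\<And>\<tau>. 0 < \<tau> \<Longrightarrow> \<tau> \<le> \<tau>0 \<Longrightarrow> n 0 < W \<tau> 0"
    and "0 \<le> y"
  shows "n y \<le> W 0 y"
proof -
  define S where "S = {\<tau>. 0 \<le> \<tau> \<and> \<tau> \<le> \<tau>0 \<and> (\<forall>y\<ge>0. n y \<le> W \<tau> y)}"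
  define K' where "K' = max 1 K"
  have "0 < K'" by (simp add: K'_def)
  have K': "\<bar>W \<tau> y - W \<sigma> y\<bar> \<le> K' * (\<tau> - \<sigma>)" if "0 \<le> \<sigma>" "\<sigma> \<le> \<tau>" "\<tau> \<le> \<tau>0" "0 \<le> y" for \<sigma> \<tau> y
  proof -
    have "K * (\<tau> - \<sigma>) \<le> K' * (\<tau> - \<sigma>)" using that by (intro mult_right_mono) (auto simp: K'_def)
    then show ?thesis using K[OF that] by linarith
  qed
  have "\<tau>0 \<in> S" using start by (simp add: S_def)
  have bdd: "bdd_below S" by (auto simp: S_def bdd_below_def)
  define t where "t = Inf S"
  have t: "0 \<le> t" "t \<le> \<tau>0"
    unfolding t_def using \<open>\<tau>0 \<in> S\<close> bdd by (auto intro: cInf_greatest cInf_lower simp: S_def)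
  have "t \<in> S"
  proof -
    have "n y \<le> W t y" if "0 \<le> y" for y
    proof (rule field_le_epsilon)
      fix e :: real assume "0 < e"
      then have "t < t + e / K'" using \<open>0 < K'\<close> by simp
      then obtain \<tau> where \<tau>: "\<tau> \<in> S" "\<tau> < t + e / K'"
        unfolding t_def using cInf_lessD \<open>\<tau>0 \<in> S\<close> by blast
      have "t \<le> \<tau>" unfolding t_def using \<tau> bdd by (intro cInf_lower)
      then have "\<bar>W \<tau> y - W t y\<bar> \<le> K' * (\<tau> - t)" using \<tau> t that by (intro K') (auto simp: S_def)
      also have "\<dots> \<le> K' * (e / K')" using \<tau> \<open>0 < K'\<close> by (intro mult_left_mono) auto
      also have "\<dots> = e" using \<open>0 < K'\<close> by simp
      finally show "n y \<le> W t y + e" using \<tau> that unfolding S_def by auto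
    qed
    then show ?thesis using t by (simp add: S_def)
  qed
  have "t = 0"
  proof (rule ccontr)
    assume "t \<noteq> 0"
    then have "0 < t" using t by simp
    have "\<exists>\<delta>>0. \<forall>y\<ge>0. n y \<le> W t y - \<delta>"
      by (rule subsol_gain[OF \<open>0 < D\<close> sub g W super \<open>0 < \<gamma>\<close>]) (use t \<open>t \<in> S\<close> bdry[OF \<open>0 < t\<close>] in \<open>auto simp: S_def\<close>)
    then obtain \<delta> where \<delta>: "0 < \<delta>" "\<And>y. 0 \<le> y \<Longrightarrow> n y \<le> W t y - \<delta>" by blast
    define s where "s = max 0 (t - \<delta> / K')"
    have s: "0 \<le> s" "s < t" using \<delta> \<open>0 < K'\<close> \<open>0 < t\<close> by (auto simp: s_def)
    have "K' * (t - s) \<le> K' * (\<delta> / K')" using \<open>0 < K'\<close> by (intro mult_left_mono) (auto simp: s_def)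
    also have "\<dots> = \<delta>" using \<open>0 < K'\<close> by simp
    finally have "K' * (t - s) \<le> \<delta>" .
    then have "n y \<le> W s y" if "0 \<le> y" for y
      using K'[of s t y] s t \<delta>(2)[OF that] that by (auto simp: abs_le_iff)
    then have "s \<in> S" using s t by (simp add: S_def)
    then show False using cInf_lower[OF _ bdd, of s] s by (simp add: t_def)
  qed
  then show ?thesis using \<open>t \<in> S\<close> \<open>0 \<le> y\<close> by (simp add: S_def)
qed

section \<open>Subsolutions for a reaction with one sign change\<close>

definition kpp_sign :: "real \<Rightarrow> (real \<Rightarrow> real) \<Rightarrow> bool" where
  "kpp_sign z g \<longleftrightarrow> (\<forall>s<z. 0 < g s) \<and> (\<forall>s>z. g s < 0)"

lemma kpp_sign_zero:
  assumes "kpp_sign z g" "lip L g"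
  shows "g z = 0"
proof (rule ccontr)
  assume nz: "g z \<noteq> 0"
  define e where "e = \<bar>g z\<bar> / (2 * L)"
  have "0 < L" using lip_pos[OF assms(2)] .
  then have "0 < e" using nz by (simp add: e_def)
  have "L * e = \<bar>g z\<bar> / 2" using \<open>0 < L\<close> by (simp add: e_def)
  then have "\<bar>g (z + e) - g z\<bar> \<le> \<bar>g z\<bar> / 2" "\<bar>g (z - e) - g z\<bar> \<le> \<bar>g z\<bar> / 2"
    using lipD[OF assms(2), of "z + e" z] lipD[OF assms(2), of "z - e" z] \<open>0 < e\<close> by auto
  moreover have "g (z + e) < 0" "0 < g (z - e)" using assms(1) \<open>0 < e\<close> by (auto simp: kpp_sign_def)
  ultimately show False using nz by (auto simp: abs_if split: if_splits)
qed

lemma kpp_gap: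
  assumes "kpp_sign z g" "lip L g" "z < a"
  shows "\<exists>\<gamma>>0. \<forall>s. a \<le> s \<longrightarrow> s \<le> b \<longrightarrow> g s + \<gamma> \<le> 0"
proof (cases "a \<le> b")
  case True
  obtain x where x: "x \<in> {a..b}" "\<And>s. s \<in> {a..b} \<Longrightarrow> g s \<le> g x"
    using continuous_attains_sup[OF compact_Icc _ lip_continuous[OF assms(2)], of a b] True by auto
  then have "g x < 0" using assms by (auto simp: kpp_sign_def)
  then show ?thesis using x by (intro exI[of _ "- g x"]) auto
qed (use assms in \<open>auto intro: exI[of _ 1]\<close>)

lemma subsol_le_max:
  assumes "0 < D" and sub: "subsol D L g n" and g: "lip L g" "kpp_sign z g"
    and B: "\<And>y. 0 \<le> y \<Longrightarrow> n y \<le> B" and "n 0 \<le> b" "z \<le> b" and "0 \<le> y"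
  shows "n y \<le> b"
proof (rule field_le_epsilon)
  fix e :: real assume "0 < e"
  define \<tau>0 where "\<tau>0 = max 0 (B - (b + e))"
  obtain \<gamma> where \<gamma>: "0 < \<gamma>" "\<And>s. b + e \<le> s \<Longrightarrow> s \<le> b + e + \<tau>0 \<Longrightarrow> g s + \<gamma> \<le> 0"
    using kpp_gap[OF g(2,1), of "b + e" "b + e + \<tau>0"] assms \<open>0 < e\<close> by auto
  have "B \<le> b + e + \<tau>0" by (simp add: \<tau>0_def)
  then have st: "n y \<le> b + e + \<tau>0" if "0 \<le> y" for y using B[OF that] by linarith
  have "n y \<le> b + e + 0"
    by (rule subsol_sweep[OF \<open>0 < D\<close> sub g(1), where W = "\<lambda>\<tau> y. b + e + \<tau>" and ?W1.0 = "\<lambda>\<tau> y. 0" and ?W2.0 = "\<lambda>\<tau> y. 0"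
        and ?\<tau>0.0 = \<tau>0 and \<gamma> = \<gamma> and K = 1])
      (use \<gamma> st \<open>n 0 \<le> b\<close> \<open>0 \<le> y\<close> \<open>0 < e\<close> in \<open>auto simp: \<tau>0_def\<close>)
  then show "n y \<le> b + e" by simp
qed

text \<open>Brings \<open>n\<close> below any level above \<open>z\<close> at a finite distance,
  which is what the sweep with falling profiles needs as a start.\<close>

lemma subsol_exp_decay:
  assumes "0 < D" and sub: "subsol D L g n" and g: "lip L g" "kpp_sign z g"
    and nb: "\<And>y. 0 \<le> y \<Longrightarrow> n y \<le> b" and "z < M" "M < b"
  shows "\<exists>l>0. \<forall>y\<ge>0. n y \<le> M + (b - M) * exp (- l * y)"
proof -
  obtain \<gamma> where \<gamma>: "0 < \<gamma>" "\<And>s. M \<le> s \<Longrightarrow> s \<le> M + (b - M) + (b - M) \<Longrightarrow> g s + \<gamma> \<le> 0"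
    using kpp_gap[OF g(2,1) \<open>z < M\<close>] by blast
  \<comment> \<open>The decay is slow enough for its curvature to spend only half of the margin
    \<gamma>.\<close>
  define l where "l = sqrt (\<gamma> / (2 * D * (b - M)))"
  have "0 < l" using \<gamma> assms by (simp add: l_def)
  have l: "D * ((b - M) * l\<^sup>2) = \<gamma> / 2" using \<gamma> assms by (simp add: l_def field_simps)
  have e1: "exp (- l * y) \<le> 1" if "0 \<le> y" for y using that \<open>0 < l\<close> by simp
  have be: "0 \<le> (b - M) * exp (- l * y)" "(b - M) * exp (- l * y) \<le> b - M" if "0 \<le> y" for y
    using mult_left_mono[OF e1[OF that], of "b - M"] assms by auto
  have "n y \<le> M + 0 + (b - M) * exp (- l * y)" if "0 \<le> y" for y
  proof (rule subsol_sweep[OF \<open>0 < D\<close> sub g(1), where W = "\<lambda>\<tau> y. M + \<tau> + (b - M) * exp (- l * y)"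
        and ?W1.0 = "\<lambda>\<tau> y. (b - M) * (- l * exp (- l * y))" and ?W2.0 = "\<lambda>\<tau> y. (b - M) * (l\<^sup>2 * exp (- l * y))"
        and ?\<tau>0.0 = "b - M" and \<gamma> = "\<gamma> / 2" and K = 1])
    fix \<tau> y :: real assume h: "0 \<le> \<tau>" "\<tau> \<le> b - M" "0 \<le> y"
    show "((\<lambda>y. M + \<tau> + (b - M) * exp (- l * y)) has_real_derivative (b - M) * (- l * exp (- l * y))) (at y)"
      by (auto intro!: derivative_eq_intros)
    show "((\<lambda>y. (b - M) * (- l * exp (- l * y))) has_real_derivative (b - M) * (l\<^sup>2 * exp (- l * y))) (at y)"
      by (auto intro!: derivative_eq_intros simp: power2_eq_square)
    have "(b - M) * (l\<^sup>2 * exp (- l * y)) \<le> (b - M) * (l\<^sup>2 * 1)"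
      using e1[OF h(3)] assms by (intro mult_left_mono) auto
    then have "D * ((b - M) * (l\<^sup>2 * exp (- l * y))) \<le> \<gamma> / 2"
      using l \<open>0 < D\<close> by (metis less_imp_le mult.right_neutral mult_left_mono)
    moreover have "g (M + \<tau> + (b - M) * exp (- l * y)) + \<gamma> \<le> 0"
      using h be[OF h(3)] by (intro \<gamma>) auto
    ultimately show "g (M + \<tau> + (b - M) * exp (- l * y)) + \<gamma> / 2 \<le> - D * ((b - M) * (l\<^sup>2 * exp (- l * y)))"
      by simp
  next
    fix y :: real assume "0 \<le> y"
    then show "n y \<le> M + (b - M) + (b - M) * exp (- l * y)" using nb be(1) by (simp add: add_increasing2)
  next
    fix \<tau> :: real assume "0 < \<tau>"
    then show "n 0 < M + \<tau> + (b - M) * exp (- l * 0)" using nb[of 0] by simp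
  qed (use \<gamma> assms that in auto)
  then show ?thesis using \<open>0 < l\<close> by (intro exI[of _ l]) auto
qed

text \<open>The Dirichlet-to-Neumann map of the half-line problem: the initial slope of the profile
  that starts at \<open>a\<close> and tends to \<open>z\<close>, given by the two branches of the
  stable manifold of \<open>z\<close>.\<close>

definition pslope :: "real \<Rightarrow> (real \<Rightarrow> real) \<Rightarrow> real \<Rightarrow> real \<Rightarrow> real" where
  "pslope D g z a = (if a < z then pspeed (\<lambda>r. g (z - r) / D) (z - a) else - pspeed (\<lambda>r. - g (z + r) / D) (a - z))"

definition profile :: "real \<Rightarrow> (real \<Rightarrow> real) \<Rightarrow> real \<Rightarrow> real \<Rightarrow> (real \<Rightarrow> real) \<Rightarrow> (real \<Rightarrow> real) \<Rightarrow> bool" where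
  "profile D g z b \<Phi> \<Phi>1 \<longleftrightarrow> \<Phi> 0 = b \<and>
     (\<forall>y\<ge>0. (b < z \<longrightarrow> b \<le> \<Phi> y \<and> \<Phi> y < z) \<and> (z < b \<longrightarrow> z < \<Phi> y \<and> \<Phi> y \<le> b) \<and> (b = z \<longrightarrow> \<Phi> y = z) \<and>
        (\<Phi> has_real_derivative \<Phi>1 y) (at y) \<and> \<Phi>1 y = pslope D g z (\<Phi> y) \<and>
        (\<Phi>1 has_real_derivative - g (\<Phi> y) / D) (at y))"

lemma profile_lipschitz:
  assumes "continuous_on {0..} h" "\<And>s. 0 < s \<Longrightarrow> 0 < h s" "\<And>s. 0 < s \<Longrightarrow> h s \<le> L * s" "0 \<le> L"
    and w: "\<And>y. 0 < w y" "\<And>y. (w has_real_derivative - pspeed h (w y)) (at y)"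
    and X: "\<And>y. a \<le> y \<Longrightarrow> w y \<le> X" and "a \<le> p" "p \<le> q"
  shows "\<bar>w p - w q\<bar> \<le> sqrt L * X * (q - p)"
proof (cases "p = q")
  case False
  then have "p < q" using assms by simp
  obtain r where r: "p < r" "r < q" "w q - w p = (q - p) * (- pspeed h (w r))"
    using MVT2[OF \<open>p < q\<close>, of w "\<lambda>y. - pspeed h (w y)"] w(2) by auto
  have "0 < pspeed h (w r)" by (rule pspeed_pos[OF assms(1,2) w(1)])
  have "pspeed h (w r) \<le> sqrt L * w r" using w(1)[of r] by (intro pspeed_le assms) auto
  also have "\<dots> \<le> sqrt L * X" using X[of r] r assms by (intro mult_left_mono) auto
  finally have "(q - p) * pspeed h (w r) \<le> (q - p) * (sqrt L * X)" using \<open>p < q\<close> by simp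
  moreover have "0 < (q - p) * pspeed h (w r)" using \<open>p < q\<close> \<open>0 < pspeed h (w r)\<close> by simp
  moreover have "w p - w q = (q - p) * pspeed h (w r)" using r(3) by simp
  ultimately show ?thesis by (simp add: mult.commute)
qed simp

lemma le_limit_at_0:
  fixes f :: "real \<Rightarrow> real"
  assumes "isCont f 0" "\<And>e. 0 < e \<Longrightarrow> e < 1 \<Longrightarrow> c \<le> f e"
  shows "c \<le> f 0"
proof (rule tendsto_lowerbound)
  show "(f \<longlongrightarrow> f 0) (at_right 0)" using assms(1) unfolding isCont_def by (rule filterlim_mono) (auto simp: at_le)
  show "\<forall>\<^sub>F e in at_right 0. c \<le> f e"
    unfolding eventually_at_right_field using assms(2) by (intro exI[of _ 1]) auto
qed simp

text \<open>The exact profile is replaced by one that descends only to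
  \<open>M = z + \<zeta>\<close> and has reduced curvature, which gives a uniform margin. Sweeping
  its translates back yields \<open>n \<le> M + w\<close>; in terms of travel time \<open>w\<close>
  is slower than the exact profile by at most the factor \<open>1 - e\<close>, and then
  \<open>e\<close> tends to 0.\<close>

lemma subsol_le_falling_profile:
  assumes "0 < D" and sub: "subsol D L g n" and g: "lip L g" "kpp_sign z g"
    and B: "\<And>y. 0 \<le> y \<Longrightarrow> n y \<le> B" and nb: "n 0 \<le> b" and "z < b"
    and P: "profile D g z b \<Phi> \<Phi>1" and "0 \<le> y"
  shows "n y \<le> \<Phi> y"
proof -
  have "0 < L" using lip_pos[OF g(1)] .
  have gz: "g z = 0" by (rule kpp_sign_zero[OF g(2,1)])
  have gneg: "g s < 0" if "z < s" for s using g(2) that by (simp add: kpp_sign_def)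
  have glin: "- g s \<le> L * (s - z)" if "z < s" for s using lipD[OF g(1), of s z] gz that by simp
  define h0 where "h0 = (\<lambda>r. - g (z + r) / D)"
  have ch0: "continuous_on {0..} h0" unfolding h0_def
    using \<open>0 < D\<close> by (intro continuous_intros continuous_on_compose2[OF lip_continuous[OF g(1), of UNIV]]) auto
  have h0: "0 < h0 s" "h0 s \<le> L / D * s" if "0 < s" for s
    using gneg[of "z + s"] glin[of "z + s"] that \<open>0 < D\<close> by (auto simp: h0_def field_simps)
  define \<phi>0 where "\<phi>0 = (\<lambda>y. \<Phi> y - z)"
  have \<phi>0: "0 < \<phi>0 y" "(\<phi>0 has_real_derivative - pspeed h0 (\<phi>0 y)) (at y)" if "0 \<le> y" for y
    using P that \<open>z < b\<close> unfolding profile_def \<phi>0_def pslope_def h0_def by (auto intro!: derivative_eq_intros)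
  have \<phi>00: "\<phi>0 0 = b - z" using P by (simp add: profile_def \<phi>0_def)
  define X where "X = b - z"
  have "0 < X" using \<open>z < b\<close> by (simp add: X_def)
  have nb': "n y \<le> b" if "0 \<le> y" for y
    by (rule subsol_le_max[OF \<open>0 < D\<close> sub g B nb _ that]) (use \<open>z < b\<close> in auto)
  have main: "n y - z \<le> max (\<phi>0 y) (\<phi>0 ((1 - e) * y))" if e: "0 < e" "e < 1" for e
  proof -
    define s where "s = \<phi>0 y"
    have "0 < s" using \<phi>0(1)[OF \<open>0 \<le> y\<close>] by (simp add: s_def)
    define c where "c = integral {0..s} h0"
    have "0 < c" using integral_0_strict_mono[OF ch0 h0(1) order_refl \<open>0 < s\<close>] by (simp add: c_def)
    \<comment> \<open>A factor \<open>1 - e\<close> in speed is its square in the integrals under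
      \<open>pspeed\<close>; \<open>q\<close> is the relative loss that can be afforded.\<close>
    define q where "q = 1 - (1 - e)\<^sup>2"
    have "(1 - e)\<^sup>2 < 1" using e by (simp add: power_less_one_iff abs_square_less_1)
    then have "0 < q" by (simp add: q_def)
    define lx where "lx = L / D * X"
    \<comment> \<open>Passing to \<open>h\<close> costs at most \<open>lx * \<zeta>\<close> in the
      integral, while \<open>c\<close> is the smallest exact integral that occurs above the
      threshold \<open>s\<close>.\<close>
    define \<zeta> where "\<zeta> = min (min s X / 2) (q * c / lx)"
    have LX: "0 < lx" using \<open>0 < L\<close> \<open>0 < D\<close> \<open>0 < X\<close> by (simp add: lx_def)
    have \<zeta>: "0 < \<zeta>" "\<zeta> < s" "\<zeta> < X" using \<open>0 < s\<close> \<open>0 < X\<close> \<open>0 < q\<close> \<open>0 < c\<close> LX by (auto simp: \<zeta>_def)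
    have "\<zeta> * lx \<le> q * c / lx * lx"
      using LX by (intro mult_right_mono) (auto simp: \<zeta>_def)
    then have "\<zeta> * lx \<le> q * c" using LX by simp
    then have \<zeta>c: "L / D * \<zeta> * X \<le> q * c" by (simp add: lx_def mult.commute mult.left_commute)
    define M where "M = z + \<zeta>"
    \<comment> \<open>The factor vanishes linearly at 0, so \<open>h\<close> keeps a linear bound
      although \<open>g M\<close> is not zero, and it leaves the margin
      \<open>- g (M + w) * \<zeta> / (w + \<zeta>)\<close>.\<close>
    define h where "h = (\<lambda>w. - g (M + w) / D * (w / (w + \<zeta>)))"
    have ch: "continuous_on {0..} h" unfolding h_def
      using \<open>0 < D\<close> \<zeta> by (intro continuous_intros continuous_on_compose2[OF lip_continuous[OF g(1), of UNIV]]) auto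
    have h: "0 < h w" "h w \<le> L / D * w" if "0 < w" for w
    proof -
      have a: "0 < - g (M + w)" "- g (M + w) \<le> L * (w + \<zeta>)"
        using gneg[of "M + w"] glin[of "M + w"] that \<zeta> by (auto simp: M_def add.commute)
      show "0 < h w" unfolding h_def using a that \<zeta> \<open>0 < D\<close> by (intro mult_pos_pos divide_pos_pos) auto
      have "h w \<le> L * (w + \<zeta>) / D * (w / (w + \<zeta>))" unfolding h_def
        using a that \<zeta> \<open>0 < D\<close> by (intro mult_right_mono divide_right_mono) auto
      also have "\<dots> = L / D * w" using that \<zeta> \<open>0 < D\<close> by simp
      finally show "h w \<le> L / D * w" .
    qed
    have "0 < b - M" using \<zeta> by (simp add: M_def X_def)
    obtain w where w: "\<And>y. 0 < w y" "w 0 = b - M" "\<And>y. (w has_real_derivative - pspeed h (w y)) (at y)"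
      "\<And>y. ((\<lambda>y. - pspeed h (w y)) has_real_derivative h (w y)) (at y)"
      "\<And>x y. x < y \<Longrightarrow> w y < w x"
      using profile_exists[OF ch h \<open>0 < b - M\<close>] by metis
    have wle: "w y \<le> w x" if "x \<le> y" for x y using w(5)[of x y] that by (cases "x = y") auto
    have "n y \<le> M + w y" if "0 \<le> y" for y
    proof -
      \<comment> \<open>Exponential decay towards a level strictly below \<open>M\<close> brings
        \<open>n\<close> under \<open>M\<close> after the finite distance \<tau>0.\<close>
      define M' where "M' = z + \<zeta> / 2"
      have "z < M'" "M' < b" "M' < M" using \<zeta> by (auto simp: M'_def X_def M_def)
      then obtain l where l: "0 < l" "\<And>y. 0 \<le> y \<Longrightarrow> n y \<le> M' + (b - M') * exp (- l * y)"
        using subsol_exp_decay[OF \<open>0 < D\<close> sub g nb' \<open>z < M'\<close> \<open>M' < b\<close>] by blast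
      define \<tau>0 where "\<tau>0 = max 0 (ln ((b - M') / (M - M')) / l)"
      have decay: "M' + (b - M') * exp (- l * y) \<le> M" if "\<tau>0 \<le> y" for y
      proof -
        have "ln ((b - M') / (M - M')) \<le> l * y" using that l by (simp add: \<tau>0_def field_simps)
        then have "(b - M') / (M - M') \<le> exp (l * y)" using \<open>M' < b\<close> \<open>M' < M\<close> by
            (simp add: ln_le_cancel_iff[symmetric] del: ln_le_cancel_iff)
        then have "(b - M') \<le> (M - M') * exp (l * y)" using \<open>M' < M\<close> by (simp add: field_simps)
        then show ?thesis by (simp add: exp_minus field_simps)
      qed
      obtain \<gamma>1 where \<gamma>1: "0 < \<gamma>1" "\<And>s. M \<le> s \<Longrightarrow> s \<le> M + w (- \<tau>0) \<Longrightarrow> g s + \<gamma>1 \<le> 0"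
        using kpp_gap[OF g(2,1), of M "M + w (- \<tau>0)"] \<zeta> by (auto simp: M_def)
      define \<gamma> where "\<gamma> = \<gamma>1 * \<zeta> / (w (- \<tau>0) + \<zeta>)"
      have "n y \<le> M + w (y - 0)"
      proof (rule subsol_sweep[OF \<open>0 < D\<close> sub g(1), where W = "\<lambda>\<tau> y. M + w (y - \<tau>)" and ?\<tau>0.0 = \<tau>0
            and ?W1.0 = "\<lambda>\<tau> y. - pspeed h (w (y - \<tau>))" and ?W2.0 = "\<lambda>\<tau> y. h (w (y - \<tau>))" and \<gamma> = \<gamma>
            and K = "sqrt (L / D) * w (- \<tau>0)"])
        show "0 < \<gamma>" using \<gamma>1 \<zeta> w(1)[of "- \<tau>0"] by (simp add: \<gamma>_def)
        show "0 \<le> \<tau>0" by (simp add: \<tau>0_def)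
        fix \<tau> y :: real
        show "((\<lambda>y. M + w (y - \<tau>)) has_real_derivative - pspeed h (w (y - \<tau>))) (at y)"
          using DERIV_add[OF DERIV_const DERIV_chain2[OF w(3) DERIV_diff[OF DERIV_ident DERIV_const]], of M \<tau> y] by simp
        show "((\<lambda>y. - pspeed h (w (y - \<tau>))) has_real_derivative h (w (y - \<tau>))) (at y)"
          using DERIV_chain2[OF w(4) DERIV_diff[OF DERIV_ident DERIV_const], of \<tau> y] by simp
        show "g (M + w (y - \<tau>)) + \<gamma> \<le> - D * h (w (y - \<tau>))" if "0 \<le> \<tau>" "\<tau> \<le> \<tau>0" "0 \<le> y"
        proof -
          define r where "r = w (y - \<tau>)"
          have r: "0 < r" "r \<le> w (- \<tau>0)" using w(1) wle[of "- \<tau>0" "y - \<tau>"] that by (auto simp: r_def)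
          have k: "\<gamma>1 \<le> - g (M + r)" using \<gamma>1(2)[of "M + r"] r by simp
          have "\<gamma> \<le> \<gamma>1 * \<zeta> / (r + \<zeta>)" unfolding \<gamma>_def using r \<gamma>1 \<zeta> by (intro divide_left_mono) auto
          also have "\<dots> \<le> - g (M + r) * \<zeta> / (r + \<zeta>)" using k r \<zeta> by (intro divide_right_mono mult_right_mono) auto
          also have "\<dots> = - g (M + r) - (- g (M + r)) * (r / (r + \<zeta>))" using r \<zeta> by (simp add: field_simps)
          also have "(- g (M + r)) * (r / (r + \<zeta>)) = D * h r" using \<open>0 < D\<close> by (simp add: h_def)
          finally show ?thesis by (simp add: r_def)
        qed
        show "n y \<le> M + w (y - \<tau>0)" if "0 \<le> y"
        proof (cases "\<tau>0 \<le> y")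
          case True
          then show ?thesis using l(2)[OF that] decay[of y] w(1)[of "y - \<tau>0"] by linarith
        next
          case False
          then show ?thesis using nb'[OF that] wle[of "y - \<tau>0" 0] w(2) by simp
        qed
        show "n 0 < M + w (0 - \<tau>)" if "0 < \<tau>" using nb w(5)[of "- \<tau>" 0] w(2) that by simp
      next
        fix \<sigma> \<tau> y :: real assume "0 \<le> \<sigma>" "\<sigma> \<le> \<tau>" "\<tau> \<le> \<tau>0" "0 \<le> y"
        then have "\<bar>w (y - \<tau>) - w (y - \<sigma>)\<bar> \<le> sqrt (L / D) * w (- \<tau>0) * ((y - \<sigma>) - (y - \<tau>))"
          using \<open>0 < L\<close> \<open>0 < D\<close> by (intro profile_lipschitz[OF ch h _ w(1,3), of "- \<tau>0"] wle) auto
        then show "\<bar>M + w (y - \<tau>) - (M + w (y - \<sigma>))\<bar> \<le> sqrt (L / D) * w (- \<tau>0) * (\<tau> - \<sigma>)" by simp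
      qed fact
      then show ?thesis by simp
    qed
    then have "n y - z \<le> \<zeta> + w y" using \<open>0 \<le> y\<close> by (simp add: M_def algebra_simps)
    also have "\<zeta> + w y \<le> max s (\<phi>0 ((1 - e) * y))"
    proof (rule slow_profile_le[OF ch0 h0(1) \<phi>0, where q = "\<lambda>y. pspeed h (w y)"])
      show "((\<lambda>y. \<zeta> + w y) has_real_derivative - pspeed h (w y)) (at y)" for y
        using w(3)[of y] by (auto intro!: derivative_eq_intros)
      show "\<zeta> + w y \<le> \<zeta> + w x" if "x \<le> y" for x y using wle[OF that] by simp
      show "\<zeta> + w 0 = \<phi>0 0" using w(2) \<phi>00 by (simp add: M_def)
      fix y :: real assume y: "0 \<le> y" "s \<le> \<zeta> + w y"
      define x where "x = \<zeta> + w y"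
      have x: "s \<le> x" "x \<le> X" "\<zeta> \<le> x" using y wle[OF y(1)] w(2) w(1)[of y] by (auto simp: x_def X_def M_def)
      \<comment> \<open>After the shift by \<zeta> the integrands differ by
        \<open>h0 r * (\<zeta> / r)\<close>, at most \<open>L / D * \<zeta>\<close>; integration
        gives a shortfall of at most \<open>L / D * \<zeta> * x\<close>.\<close>
      have "integral {0..\<zeta> - \<zeta>} h - integral {0..\<zeta>} h0 + L / D * \<zeta> * \<zeta> \<le> integral {0..x - \<zeta>} h - integral {0..x} h0 +
          L / D * \<zeta> * x"
      proof (rule DERIV_nonneg_imp_increasing_open[OF x(3)])
        fix r assume r: "\<zeta> < r" "r < x"
        have "((\<lambda>r. integral {0..r - \<zeta>} h) has_real_derivative h (r - \<zeta>)) (at r)"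
          using DERIV_chain2[OF integral_0_deriv[OF ch] DERIV_diff[OF DERIV_ident DERIV_const], of r \<zeta>] r by simp
        moreover have "((\<lambda>r. integral {0..r} h0) has_real_derivative h0 r) (at r)"
          using r \<zeta> by (intro integral_0_deriv[OF ch0]) auto
        ultimately have "((\<lambda>r. integral {0..r - \<zeta>} h - integral {0..r} h0 + L / D * \<zeta> * r) has_real_derivative h
            (r - \<zeta>) - h0 r + L / D * \<zeta>) (at r)"
          using \<open>0 < D\<close> by (auto intro!: derivative_eq_intros)
        moreover have "0 \<le> h (r - \<zeta>) - h0 r + L / D * \<zeta>"
        proof -
          have "h (r - \<zeta>) = h0 r * ((r - \<zeta>) / r)" by (simp add: h_def h0_def M_def)
          also have "\<dots> = h0 r - h0 r * (\<zeta> / r)" using r \<zeta> by (simp add: field_simps)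
          finally have "h (r - \<zeta>) - h0 r = - (h0 r * (\<zeta> / r))" by simp
          moreover have "h0 r * (\<zeta> / r) \<le> L / D * r * (\<zeta> / r)" using h0(2)[of r] r \<zeta> by (intro mult_right_mono) auto
          moreover have "L / D * r * (\<zeta> / r) = L / D * \<zeta>" using r \<zeta> by simp
          ultimately show ?thesis by linarith
        qed
        ultimately show "\<exists>d. ((\<lambda>r. integral {0..r - \<zeta>} h - integral {0..r} h0 + L / D * \<zeta> * r) has_real_derivative d)
            (at r) \<and> 0 \<le> d" by blast
      next
        have "continuous_on {\<zeta>..x} (\<lambda>r. integral {0..r - \<zeta>} h)"
          by (rule continuous_on_compose2[OF integral_0_cont[OF ch, of "x - \<zeta>"]]) (auto intro!: continuous_intros)
        moreover have "continuous_on {\<zeta>..x} (\<lambda>r. integral {0..r} h0)"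
          by (rule continuous_on_subset[OF integral_0_cont[OF ch0, of x]]) (use \<zeta> in auto)
        ultimately show "continuous_on {\<zeta>..x} (\<lambda>r. integral {0..r - \<zeta>} h - integral {0..r} h0 + L / D * \<zeta> * r)"
          by (intro continuous_intros)
      qed
      moreover have "integral {0..\<zeta>} h0 \<le> L / D * \<zeta>\<^sup>2 / 2" using \<zeta> by (intro integral_0_le ch0 h0(2)) auto
      moreover have "0 \<le> L / D * \<zeta>\<^sup>2 / 2" using \<open>0 < L\<close> \<open>0 < D\<close> by simp
      moreover have "L / D * \<zeta> * x \<le> L / D * \<zeta> * X" using x \<zeta> \<open>0 < L\<close> \<open>0 < D\<close> by (intro mult_left_mono) auto
      moreover have "q * c \<le> q * integral {0..x} h0"
      proof (rule mult_left_mono)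
        show "c \<le> integral {0..x} h0"
          using integral_0_strict_mono[OF ch0 h0(1), of s x] x \<open>0 < s\<close> unfolding c_def by (cases "s = x") auto
      qed (use \<open>0 < q\<close> in simp)
      ultimately have "integral {0..x} h0 - q * integral {0..x} h0 \<le> integral {0..x - \<zeta>} h"
        using \<zeta>c by (simp add: power2_eq_square)
      then have "(1 - e)\<^sup>2 * (2 * integral {0..x} h0) \<le> 2 * integral {0..x - \<zeta>} h" by (simp add: q_def algebra_simps)
      then have "sqrt ((1 - e)\<^sup>2 * (2 * integral {0..x} h0)) \<le> pspeed h (x - \<zeta>)" unfolding pspeed_def by simp
      then show "(1 - e) * pspeed h0 (\<zeta> + w y) \<le> pspeed h (w y)"
        using e by (simp add: real_sqrt_mult pspeed_def x_def)
    qed (use \<open>0 < s\<close> e \<open>0 \<le> y\<close> in auto)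
    finally show ?thesis by (simp add: s_def)
  qed
  have "isCont \<phi>0 ((1 - 0) * y)" using DERIV_isCont[OF \<phi>0(2)[OF \<open>0 \<le> y\<close>]] by simp
  then have "isCont (\<lambda>e. \<phi>0 ((1 - e) * y)) 0"
    by (intro isCont_o2[where g = \<phi>0 and f = "\<lambda>e. (1 - e) * y"] continuous_intros)
  then have "isCont (\<lambda>e. max (\<phi>0 y) (\<phi>0 ((1 - e) * y))) 0"
    by (intro continuous_intros)
  from le_limit_at_0[OF this main] show ?thesis by (simp add: \<phi>0_def)
qed

text \<open>The perturbed profile rises past \<open>z\<close> to \<open>M = z + \<zeta>\<close>. The
  sweep starts from a translate above \<open>z\<close>, and \<open>n \<le> z\<close> is known. This
  profile is faster than the exact one by at most the factor \<open>1 + e\<close>, which is removed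
  at the end.\<close>

lemma subsol_le_rising_profile:
  assumes "0 < D" and sub: "subsol D L g n" and g: "lip L g" "kpp_sign z g"
    and B: "\<And>y. 0 \<le> y \<Longrightarrow> n y \<le> B" and nb: "n 0 \<le> b" and "b < z"
    and P: "profile D g z b \<Phi> \<Phi>1" and "0 \<le> y"
  shows "n y \<le> \<Phi> y"
proof -
  have "0 < L" using lip_pos[OF g(1)] .
  have gz: "g z = 0" by (rule kpp_sign_zero[OF g(2,1)])
  have gpos: "0 < g s" if "s < z" for s using g(2) that by (simp add: kpp_sign_def)
  have gneg: "g s < 0" if "z < s" for s using g(2) that by (simp add: kpp_sign_def)
  have glin: "g s \<le> L * (z - s)" if "s < z" for s using lipD[OF g(1), of s z] gz that by simp
  define h0 where "h0 = (\<lambda>r. g (z - r) / D)"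
  have ch0: "continuous_on {0..} h0" unfolding h0_def
    using \<open>0 < D\<close> by (intro continuous_intros continuous_on_compose2[OF lip_continuous[OF g(1), of UNIV]]) auto
  have h0: "0 < h0 s" if "0 < s" for s
    using gpos[of "z - s"] that \<open>0 < D\<close> by (auto simp: h0_def)
  define \<phi>0 where "\<phi>0 = (\<lambda>y. z - \<Phi> y)"
  have \<phi>0: "0 < \<phi>0 y" "(\<phi>0 has_real_derivative - pspeed h0 (\<phi>0 y)) (at y)" if "0 \<le> y" for y
    using P that \<open>b < z\<close> unfolding profile_def \<phi>0_def pslope_def h0_def by (auto intro!: derivative_eq_intros)
  have \<phi>00: "\<phi>0 0 = z - b" using P by (simp add: profile_def \<phi>0_def)
  define X where "X = z - b"
  have "0 < X" using \<open>b < z\<close> by (simp add: X_def)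
  have nz: "n y \<le> z" if "0 \<le> y" for y
    by (rule subsol_le_max[OF \<open>0 < D\<close> sub g B _ _ that]) (use \<open>b < z\<close> nb in auto)
  have main: "n y \<le> z - \<phi>0 ((1 + e) * y)" if e: "0 < e" "e < 1" for e
  proof -
    have ey: "0 \<le> (1 + e) * y" using e \<open>0 \<le> y\<close> by simp
    \<comment> \<open>Half of the target value, as \<open>fast_profile_ge\<close> asks for a
      threshold strictly below it.\<close>
    define s where "s = \<phi>0 ((1 + e) * y) / 2"
    have s: "0 < s" "s < \<phi>0 ((1 + e) * y)" using \<phi>0(1)[OF ey] by (auto simp: s_def)
    define c where "c = integral {0..s} h0"
    have "0 < c" using integral_0_strict_mono[OF ch0 h0 order_refl \<open>0 < s\<close>] by (simp add: c_def)
    \<comment> \<open>\<open>\<zeta> * Q\<close> bounds the excess of the perturbed integral: the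
      square comes from the added term \<open>\<zeta> * w\<close>, and \<open>L\<close> from the
      extra interval of length \<zeta>.\<close>
    define Q where "Q = ((X + 1)\<^sup>2 + L) / (2 * D)"
    have "0 < Q" using \<open>0 < L\<close> \<open>0 < D\<close> by (simp add: Q_def add_nonneg_pos)
    define \<zeta> where "\<zeta> = min 1 (2 * e * c / Q)"
    have \<zeta>: "0 < \<zeta>" "\<zeta> \<le> 1" using \<open>0 < c\<close> \<open>0 < Q\<close> e by (auto simp: \<zeta>_def)
    have "\<zeta> * Q \<le> 2 * e * c / Q * Q" using \<open>0 < Q\<close> by (intro mult_right_mono) (auto simp: \<zeta>_def)
    then have \<zeta>c: "\<zeta> * Q \<le> 2 * e * c" using \<open>0 < Q\<close> by simp
    define M where "M = z + \<zeta>"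
    \<comment> \<open>The maximum with 0 keeps \<open>h\<close> positive where \<open>M - w\<close>
      exceeds \<open>z\<close> and \<open>g\<close> is negative.\<close>
    define h where "h = (\<lambda>w. (max 0 (g (M - w)) + \<zeta> * w) / D)"
    have ch: "continuous_on {0..} h" unfolding h_def
      using \<open>0 < D\<close> by (intro continuous_intros continuous_on_compose2[OF lip_continuous[OF g(1), of UNIV]]) auto
    have h: "0 < h w" "h w \<le> (L + \<zeta>) / D * w" if "0 < w" for w
    proof -
      show "0 < h w" unfolding h_def using that \<zeta> \<open>0 < D\<close> by (intro divide_pos_pos add_nonneg_pos) auto
      have "max 0 (g (M - w)) \<le> L * w"
      proof (cases "M - w < z")
        case True
        have "g (M - w) \<le> L * (z - (M - w))" by (rule glin[OF True])
        also have "\<dots> \<le> L * w" using \<zeta> \<open>0 < L\<close> by (intro mult_left_mono) (auto simp: M_def)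
        finally show ?thesis using that \<open>0 < L\<close> by simp
      next
        case False
        then have "g (M - w) \<le> 0" using gneg[of "M - w"] gz by (cases "M - w = z") auto
        then show ?thesis using that \<open>0 < L\<close> by simp
      qed
      then show "h w \<le> (L + \<zeta>) / D * w" unfolding h_def using \<open>0 < D\<close>
        by (simp add: divide_right_mono algebra_simps)
    qed
    have "0 < M - b" using \<zeta> \<open>b < z\<close> by (simp add: M_def)
    obtain w where w: "\<And>y. 0 < w y" "w 0 = M - b" "\<And>y. (w has_real_derivative - pspeed h (w y)) (at y)"
      "\<And>y. ((\<lambda>y. - pspeed h (w y)) has_real_derivative h (w y)) (at y)"
      "\<And>s. 0 < s \<Longrightarrow> \<exists>y. w y = s" "\<And>x y. x < y \<Longrightarrow> w y < w x"
      by (rule profile_exists[OF ch h \<open>0 < M - b\<close>]) (assumption | rule that)+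
    have wle: "w y \<le> w x" if "x \<le> y" for x y using w(6)[of x y] that by (cases "x = y") auto
    have nw: "n y \<le> M - w y" if "0 \<le> y" for y
    proof -
      obtain \<tau>0 where \<tau>0: "w \<tau>0 = \<zeta> / 2" using w(5)[of "\<zeta> / 2"] \<zeta> by auto
      have "0 \<le> \<tau>0"
      proof (rule ccontr)
        assume "\<not> 0 \<le> \<tau>0"
        then have "w 0 < w \<tau>0" by (intro w(6)) simp
        then show False using w(2) \<tau>0 \<zeta> \<open>b < z\<close> by (simp add: M_def)
      qed
      obtain \<gamma>1 where \<gamma>1: "0 < \<gamma>1" "\<And>s. z + \<zeta> / 2 \<le> s \<Longrightarrow> s \<le> M \<Longrightarrow> g s + \<gamma>1 \<le> 0"
        using kpp_gap[OF g(2,1), of "z + \<zeta> / 2" M] \<zeta> by auto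
      \<comment> \<open>Two sources of margin: for \<open>w \<le> \<zeta> / 2\<close> the profile
        lies above \<open>z\<close> and \<open>g\<close> is negative; otherwise the term
        \<open>\<zeta> * w\<close> provides it.\<close>
      define \<gamma> where "\<gamma> = min \<gamma>1 (\<zeta> * (\<zeta> / 2))"
      have "n y \<le> M - w (y + 0)"
      proof (rule subsol_sweep[OF \<open>0 < D\<close> sub g(1), where W = "\<lambda>\<tau> y. M - w (y + \<tau>)" and ?\<tau>0.0 = \<tau>0
            and ?W1.0 = "\<lambda>\<tau> y. - (- pspeed h (w (y + \<tau>)))" and ?W2.0 = "\<lambda>\<tau> y. - h (w (y + \<tau>))" and \<gamma> = \<gamma>
            and K = "sqrt ((L + \<zeta>) / D) * (M - b)"])
        show "0 < \<gamma>" using \<gamma>1 \<zeta> by (simp add: \<gamma>_def)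
        fix \<tau> y :: real
        show "((\<lambda>y. M - w (y + \<tau>)) has_real_derivative - (- pspeed h (w (y + \<tau>)))) (at y)"
          using DERIV_diff[OF DERIV_const DERIV_chain2[OF w(3) DERIV_add[OF DERIV_ident DERIV_const]], of M \<tau> y] by simp
        show "((\<lambda>y. - (- pspeed h (w (y + \<tau>)))) has_real_derivative - h (w (y + \<tau>))) (at y)"
          using DERIV_minus[OF DERIV_chain2[OF w(4) DERIV_add[OF DERIV_ident DERIV_const]], of \<tau> y] by simp
        show "g (M - w (y + \<tau>)) + \<gamma> \<le> - D * - h (w (y + \<tau>))"
        proof -
          define r where "r = w (y + \<tau>)"
          have r: "0 < r" using w(1) by (auto simp: r_def)
          have "g (M - r) + \<gamma> \<le> max 0 (g (M - r)) + \<zeta> * r"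
          proof (cases "r \<le> \<zeta> / 2")
            case True
            then have "g (M - r) + \<gamma>1 \<le> 0" using r by (intro \<gamma>1) (auto simp: M_def)
            moreover have "0 \<le> \<zeta> * r" using r \<zeta> by simp
            moreover have "\<gamma> \<le> \<gamma>1" by (simp add: \<gamma>_def)
            ultimately show ?thesis by linarith
          next
            case False
            then have "\<zeta> * (\<zeta> / 2) \<le> \<zeta> * r" using \<zeta> by (intro mult_left_mono) auto
            then show ?thesis by (simp add: \<gamma>_def)
          qed
          then show ?thesis using \<open>0 < D\<close> by (simp add: h_def r_def)
        qed
        show "n y \<le> M - w (y + \<tau>0)" if "0 \<le> y"
          using nz[OF that] wle[of \<tau>0 "y + \<tau>0"] \<tau>0 \<zeta> that by (simp add: M_def)
        show "n 0 < M - w (0 + \<tau>)" if "0 < \<tau>" using nb w(6)[of 0 \<tau>] w(2) that by simp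
      next
        fix \<sigma> \<tau> y :: real assume h': "0 \<le> \<sigma>" "\<sigma> \<le> \<tau>" "\<tau> \<le> \<tau>0" "0 \<le> y"
        have "\<bar>w (y + \<sigma>) - w (y + \<tau>)\<bar> \<le> sqrt ((L + \<zeta>) / D) * (M - b) * ((y + \<tau>) - (y + \<sigma>))"
        proof (rule profile_lipschitz[OF ch h _ w(1,3)])
          show "w x \<le> M - b" if "0 \<le> x" for x using wle[OF that] w(2) by simp
        qed (use h' \<open>0 < L\<close> \<open>0 < D\<close> \<zeta> in auto)
        then show "\<bar>M - w (y + \<tau>) - (M - w (y + \<sigma>))\<bar> \<le> sqrt ((L + \<zeta>) / D) * (M - b) * (\<tau> - \<sigma>)" by simp
      qed fact+
      then show ?thesis by simp
    qed
    have "n y \<le> z - (w y - \<zeta>)" using nw[OF \<open>0 \<le> y\<close>] by (simp add: M_def)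
    moreover have "\<phi>0 ((1 + e) * y) \<le> w y - \<zeta>"
    proof (rule fast_profile_ge[OF ch0 h0 \<phi>0, where q = "\<lambda>y. pspeed h (w y)" and s = s])
      show "((\<lambda>y. w y - \<zeta>) has_real_derivative - pspeed h (w y)) (at y)" for y
        using w(3)[of y] by (auto intro!: derivative_eq_intros)
      show "w y - \<zeta> \<le> w x - \<zeta>" if "x \<le> y" for x y using wle[OF that] by simp
      show "w 0 - \<zeta> = \<phi>0 0" using w(2) \<phi>00 by (simp add: M_def)
      fix y :: real assume y: "0 \<le> y" "s \<le> w y - \<zeta>"
      define x where "x = w y - \<zeta>"
      have x: "s \<le> x" "x \<le> X" "0 \<le> x" using y wle[OF y(1)] w(2) s by (auto simp: x_def X_def M_def)
      let ?F = "\<lambda>r. integral {0..r} h0 + \<zeta> / D * (r + \<zeta>)\<^sup>2 / 2 - integral {0..r + \<zeta>} h"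
      have "?F 0 \<le> ?F x"
      proof (rule DERIV_nonneg_imp_increasing_open[OF x(3)])
        fix r assume r: "0 < r" "r < x"
        have "((\<lambda>r. integral {0..r + \<zeta>} h) has_real_derivative h (r + \<zeta>)) (at r)"
          using DERIV_chain2[OF integral_0_deriv[OF ch] DERIV_add[OF DERIV_ident DERIV_const], of r \<zeta>] r \<zeta> by simp
        moreover have "((\<lambda>r. integral {0..r} h0) has_real_derivative h0 r) (at r)"
          using r by (intro integral_0_deriv[OF ch0]) auto
        ultimately have "(?F has_real_derivative h0 r + \<zeta> / D * (r + \<zeta>) - h (r + \<zeta>)) (at r)"
          using \<open>0 < D\<close> by (auto intro!: derivative_eq_intros simp: field_simps)
        moreover have "h (r + \<zeta>) = h0 r + \<zeta> / D * (r + \<zeta>)"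
          using gpos[of "z - r"] r by (simp add: h_def h0_def M_def add_divide_distrib)
        ultimately show "\<exists>d. (?F has_real_derivative d) (at r) \<and> 0 \<le> d" by auto
      next
        have "continuous_on {0..x} (\<lambda>r. integral {0..r + \<zeta>} h)"
          by (rule continuous_on_compose2[OF integral_0_cont[OF ch, of "x + \<zeta>"]]) (use \<zeta> in \<open>auto intro!: continuous_intros\<close>)
        then show "continuous_on {0..x} ?F"
          using integral_0_cont[OF ch0, of x] by (intro continuous_intros) auto
      qed
      moreover have "integral {0..0 + \<zeta>} h \<le> (L + \<zeta>) / D * (0 + \<zeta>)\<^sup>2 / 2" using \<zeta> by (intro integral_0_le ch h(2)) auto
      ultimately have 1: "integral {0..x + \<zeta>} h \<le> integral {0..x} h0 + \<zeta> / D * (x + \<zeta>)\<^sup>2 / 2 + L / D * \<zeta>\<^sup>2 / 2"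
        by (simp add: algebra_simps add_divide_distrib)
      have "(x + \<zeta>)\<^sup>2 \<le> (X + 1)\<^sup>2" using x \<zeta> by (intro power_mono) auto
      then have "\<zeta> / D * (x + \<zeta>)\<^sup>2 / 2 \<le> \<zeta> / D * (X + 1)\<^sup>2 / 2"
        using \<zeta> \<open>0 < D\<close> by (intro divide_right_mono mult_left_mono) auto
      moreover have "L / D * \<zeta>\<^sup>2 / 2 \<le> L / D * \<zeta> / 2"
        using \<zeta> \<open>0 < D\<close> \<open>0 < L\<close> by (intro divide_right_mono mult_left_mono) (auto simp: power2_eq_square mult_left_le_one_le)
      moreover have "\<zeta> / D * (X + 1)\<^sup>2 / 2 + L / D * \<zeta> / 2 = \<zeta> * Q"
        unfolding Q_def using \<open>0 < D\<close> by (simp add: field_simps)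
      moreover have "2 * e * c \<le> 2 * e * integral {0..x} h0"
      proof (rule mult_left_mono)
        show "c \<le> integral {0..x} h0"
          using integral_0_strict_mono[OF ch0 h0, of s x] x s unfolding c_def by (cases "s = x") auto
      qed (use e in simp)
      moreover have "0 \<le> e\<^sup>2 * integral {0..x} h0"
        using integral_0_strict_mono[OF ch0 h0, of 0 x] x s by simp
      ultimately have "integral {0..x + \<zeta>} h \<le> integral {0..x} h0 + 2 * e * integral {0..x} h0 + e\<^sup>2 * integral {0..x} h0"
        using 1 \<zeta>c by linarith
      then have "2 * integral {0..x + \<zeta>} h \<le> (1 + e)\<^sup>2 * (2 * integral {0..x} h0)"
        by (simp add: power2_eq_square algebra_simps)
      then have "pspeed h (x + \<zeta>) \<le> sqrt ((1 + e)\<^sup>2 * (2 * integral {0..x} h0))" unfolding pspeed_def by simp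
      then show "pspeed h (w y) \<le> (1 + e) * pspeed h0 (w y - \<zeta>)"
        using e by (simp add: real_sqrt_mult pspeed_def x_def)
    qed (use s e \<open>0 \<le> y\<close> in auto)
    ultimately show ?thesis by simp
  qed
  have "isCont \<phi>0 ((1 + 0) * y)" using DERIV_isCont[OF \<phi>0(2)[OF \<open>0 \<le> y\<close>]] by simp
  then have "isCont (\<lambda>e. \<phi>0 ((1 + e) * y)) 0"
    by (intro isCont_o2[where g = \<phi>0 and f = "\<lambda>e. (1 + e) * y"] continuous_intros)
  then have "isCont (\<lambda>e. z - \<phi>0 ((1 + e) * y)) 0"
    by (intro continuous_intros)
  from le_limit_at_0[OF this main] show ?thesis by (simp add: \<phi>0_def)
qed

lemma subsol_le_profile:
  assumes "0 < D" "subsol D L g n" "lip L g" "kpp_sign z g" "\<And>y. 0 \<le> y \<Longrightarrow> n y \<le> B" "n 0 \<le> b"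
    "profile D g z b \<Phi> \<Phi>1" "0 \<le> y"
  shows "n y \<le> \<Phi> y"
proof (cases b z rule: linorder_cases)
  case less
  then show ?thesis using subsol_le_rising_profile[OF assms(1-6) _ assms(7,8)] by simp
next
  case greater
  then show ?thesis using subsol_le_falling_profile[OF assms(1-6) _ assms(7,8)] by simp
next
  case equal
  then have "\<Phi> y = z" using assms(7,8) by (auto simp: profile_def)
  moreover have "n y \<le> z" using subsol_le_max[OF assms(1-5) _ order_refl assms(8)] assms(6) equal by simp
  ultimately show ?thesis by simp
qed

section \<open>Existence of exact profiles and monotonicity of their slope\<close>

lemma rate_facts:
  assumes "0 < D" "lip L g" "kpp_sign z g"
  shows "continuous_on {0..} (\<lambda>r. g (z - r) / D)" "continuous_on {0..} (\<lambda>r. - g (z + r) / D)"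
    "0 < s \<Longrightarrow> 0 < g (z - s) / D" "0 < s \<Longrightarrow> 0 < - g (z + s) / D"
    "0 < s \<Longrightarrow> g (z - s) / D \<le> L / D * s" "0 < s \<Longrightarrow> - g (z + s) / D \<le> L / D * s"
proof -
  have gz: "g z = 0" by (rule kpp_sign_zero[OF assms(3,2)])
  show "continuous_on {0..} (\<lambda>r. g (z - r) / D)" "continuous_on {0..} (\<lambda>r. - g (z + r) / D)"
    using assms(1) by (intro continuous_intros continuous_on_compose2[OF lip_continuous[OF assms(2), of UNIV]]; auto)+
  show "0 < s \<Longrightarrow> 0 < g (z - s) / D" "0 < s \<Longrightarrow> 0 < - g (z + s) / D"
    using assms(1,3) by (auto simp: kpp_sign_def divide_neg_pos)
  show "g (z - s) / D \<le> L / D * s" if "0 < s"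
    using lipD[OF assms(2), of "z - s" z] gz that assms(1) by (simp add: divide_right_mono)
  show "- g (z + s) / D \<le> L / D * s" if "0 < s"
    using lipD[OF assms(2), of "z + s" z] gz that divide_right_mono[of "- g (z + s)" "L * s" D] assms(1) by simp
qed

lemma profile_of_kpp:
  assumes "0 < D" "lip L g" "kpp_sign z g"
  shows "\<exists>\<Phi> \<Phi>1. profile D g z b \<Phi> \<Phi>1"
proof (cases b z rule: linorder_cases)
  case less
  note r = rate_facts[OF assms]
  obtain w where w: "\<And>y. 0 < w y" "w 0 = z - b" "\<And>y. (w has_real_derivative - pspeed (\<lambda>r. g (z - r) / D) (w y)) (at y)"
      "\<And>y. ((\<lambda>y. - pspeed (\<lambda>r. g (z - r) / D) (w y)) has_real_derivative g (z - w y) / D) (at y)"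
      "\<And>s. 0 < s \<Longrightarrow> \<exists>y. w y = s"
      "\<And>x y. x < y \<Longrightarrow> w y < w x"
    by (rule profile_exists[OF r(1) r(3) r(5), of "z - b"]) (assumption | rule that | simp add: less)+
  have "b \<le> z - w y" if "0 \<le> y" for y using w(2) w(6)[of 0 y] that by (cases "y = 0") auto
  then have "profile D g z b (\<lambda>y. z - w y) (\<lambda>y. - (- pspeed (\<lambda>r. g (z - r) / D) (w y)))"
    unfolding profile_def using w(1,2) less DERIV_diff[OF DERIV_const w(3), of z] DERIV_minus[OF w(4)]
    by (auto simp: pslope_def)
  then show ?thesis by blast
next
  case greater
  note r = rate_facts[OF assms]
  obtain w where w: "\<And>y. 0 < w y" "w 0 = b - z" "\<And>y. (w has_real_derivative - pspeed (\<lambda>r. - g (z + r) / D) (w y)) (at y)"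
      "\<And>y. ((\<lambda>y. - pspeed (\<lambda>r. - g (z + r) / D) (w y)) has_real_derivative - g (z + w y) / D) (at y)"
      "\<And>s. 0 < s \<Longrightarrow> \<exists>y. w y = s"
      "\<And>x y. x < y \<Longrightarrow> w y < w x"
    by (rule profile_exists[OF r(2) r(4) r(6), of "b - z"]) (assumption | rule that | simp add: greater)+
  have "z + w y \<le> b" if "0 \<le> y" for y using w(2) w(6)[of 0 y] that by (cases "y = 0") auto
  then have "profile D g z b (\<lambda>y. z + w y) (\<lambda>y. - pspeed (\<lambda>r. - g (z + r) / D) (w y))"
    unfolding profile_def using w(1,2) greater DERIV_add[OF DERIV_const w(3), of z] w(4)
    by (auto simp: pslope_def less_le_not_le)
  then show ?thesis by blast
next
  case equal
  have "profile D g z b (\<lambda>y. z) (\<lambda>y. 0)"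
    unfolding profile_def using equal kpp_sign_zero[OF assms(3,2)] by (auto simp: pslope_def)
  then show ?thesis by blast
qed

text \<open>The absolute slope grows with the distance from \<open>z\<close> because the integrand
  of \<open>pspeed\<close> is positive. Uniqueness of the interface values rests on this.\<close>

lemma pslope_strict_antimono:
  assumes "0 < D" "lip L g" "kpp_sign z g" "a < b"
  shows "pslope D g z b < pslope D g z a"
proof -
  note r = rate_facts[OF assms(1-3)]
  show ?thesis
  proof (cases "b < z")
    case True
    then show ?thesis using pspeed_strict_mono[OF r(1) r(3), of "z - b" "z - a"] assms(4) by (simp add: pslope_def)
  next
    case b: False
    then have nb: "0 \<le> pspeed (\<lambda>r. - g (z + r) / D) (b - z)"
      using pspeed_pos[OF r(2) r(4), of "b - z"] by (cases "b = z") auto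
    show ?thesis
    proof (cases "a < z")
      case True
      then have "0 < pspeed (\<lambda>r. g (z - r) / D) (z - a)" by (intro pspeed_pos[OF r(1) r(3)]) auto
      then show ?thesis using True b nb by (simp add: pslope_def)
    next
      case False
      then show ?thesis using pspeed_strict_mono[OF r(2) r(4), of "a - z" "b - z"] assms(4) b by (simp add: pslope_def)
    qed
  qed
qed

lemma pslope_continuous:
  assumes "0 < D" "lip L g" "kpp_sign z g"
  shows "continuous_on {a..b} (pslope D g z)"
proof -
  note r = rate_facts[OF assms]
  have "pslope D g z = (\<lambda>a. if a \<le> z then pspeed (\<lambda>r. g (z - r) / D) (z - a) else - pspeed (\<lambda>r. - g (z + r) / D) (a - z))"
    by (auto simp: pslope_def fun_eq_iff)
  moreover have "continuous_on ({min a z..z} \<union> {z..max b z})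
      (\<lambda>a. if a \<le> z then pspeed (\<lambda>r. g (z - r) / D) (z - a) else - pspeed (\<lambda>r. - g (z + r) / D) (a - z))"
  proof (rule continuous_on_If)
    show "continuous_on {min a z..z} (\<lambda>a. pspeed (\<lambda>r. g (z - r) / D) (z - a))"
      by (rule continuous_on_compose2[OF pspeed_cont[OF r(1), of "z - min a z"]]) (auto intro!: continuous_intros)
    show "continuous_on {z..max b z} (\<lambda>a. - pspeed (\<lambda>r. - g (z + r) / D) (a - z))"
      by (intro continuous_on_minus, rule continuous_on_compose2[OF pspeed_cont[OF r(2), of "max b z - z"]])
          (auto intro!: continuous_intros)
  qed auto
  ultimately show ?thesis by (auto elim: continuous_on_subset)
qed

section \<open>The upper envelope of a solution\<close>

text \<open>The interface version of \<open>subsol\<close>: instead of dominating \<open>n\<close>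
  at 0, the test function has to satisfy the flux inequality with the other component replaced by
  its bound \<open>c\<close>.\<close>

definition robin_sub :: "real \<Rightarrow> real \<Rightarrow> (real \<Rightarrow> real) \<Rightarrow> real \<Rightarrow> real \<Rightarrow> real \<Rightarrow> (real \<Rightarrow> real) \<Rightarrow> bool" where
  "robin_sub D L g \<mu> \<nu> c n \<longleftrightarrow> (\<forall>\<rho> \<phi> \<phi>1 \<phi>2. 0 < \<rho> \<longrightarrow> L * \<rho>\<^sup>2 \<le> D / 2 \<longrightarrow>
     (\<forall>y. 0 \<le> y \<longrightarrow> y \<le> \<rho> \<longrightarrow> (\<phi> has_real_derivative \<phi>1 y) (at y)) \<longrightarrow>
     (\<forall>y. 0 \<le> y \<longrightarrow> y \<le> \<rho> \<longrightarrow> (\<phi>1 has_real_derivative \<phi>2 y) (at y)) \<longrightarrow>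
     (\<forall>y. 0 < y \<longrightarrow> y < \<rho> \<longrightarrow> g (\<phi> y) \<le> - D * \<phi>2 y) \<longrightarrow>
     n \<rho> \<le> \<phi> \<rho> \<longrightarrow> \<nu> * c - \<mu> * \<phi> 0 \<le> - D * \<phi>1 0 \<longrightarrow> n 0 \<le> \<phi> 0)"

text \<open>If the inequality failed by \<eta>, the exact profile could be lowered near 0 by the
  parabola \<open>\<epsilon> * (1 - y / \<rho>)\<^sup>2\<close>: its slope fits into \<eta>, its
  curvature outweighs the Lipschitz change of \<open>g\<close>, and
  \<open>n 0 \<le> n 0 - \<epsilon>\<close> would follow.\<close>

lemma robin_slope:
  assumes "0 < D" "0 < \<mu>" and sub: "subsol D L g n" and g: "lip L g" "kpp_sign z g"
    and B: "\<And>y. 0 \<le> y \<Longrightarrow> n y \<le> B" and rob: "robin_sub D L g \<mu> \<nu> c n"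
  shows "- D * pslope D g z (n 0) \<le> \<nu> * c - \<mu> * n 0"
proof (rule ccontr)
  assume viol: "\<not> - D * pslope D g z (n 0) \<le> \<nu> * c - \<mu> * n 0"
  define \<eta> where "\<eta> = - D * pslope D g z (n 0) - (\<nu> * c - \<mu> * n 0)"
  have "0 < \<eta>" using viol by (simp add: \<eta>_def)
  obtain \<Phi> \<Phi>1 where P: "profile D g z (n 0) \<Phi> \<Phi>1" using profile_of_kpp[OF \<open>0 < D\<close> g] by blast
  have le: "n y \<le> \<Phi> y" if "0 \<le> y" for y
    by (rule subsol_le_profile[OF \<open>0 < D\<close> sub g B order_refl P that])
  have \<Phi>: "\<Phi> 0 = n 0" "\<Phi>1 0 = pslope D g z (n 0)"
    "\<And>y. 0 \<le> y \<Longrightarrow> (\<Phi> has_real_derivative \<Phi>1 y) (at y)"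
    "\<And>y. 0 \<le> y \<Longrightarrow> (\<Phi>1 has_real_derivative - g (\<Phi> y) / D) (at y)"
    using P by (auto simp: profile_def)
  have "0 < L" using lip_pos[OF g(1)] .
  define \<rho> where "\<rho> = sqrt (D / (2 * L))"
  have \<rho>: "0 < \<rho>" "L * \<rho>\<^sup>2 = D / 2" using \<open>0 < D\<close> \<open>0 < L\<close> by (simp_all add: \<rho>_def)
  \<comment> \<open>Uses up \<eta> exactly: \<open>\<mu> * \<epsilon>\<close> for the lowered value
    and \<open>2 * D * \<epsilon> / \<rho>\<close> for the added slope.\<close>
  define \<epsilon> where "\<epsilon> = \<eta> / (\<mu> + 2 * D / \<rho>)"
  have den: "0 < \<mu> + 2 * D / \<rho>" using \<open>0 < \<mu>\<close> \<open>0 < D\<close> \<rho> by (simp add: add_pos_pos)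
  then have "0 < \<epsilon>" using \<open>0 < \<eta>\<close> by (simp add: \<epsilon>_def)
  have \<epsilon>: "\<mu> * \<epsilon> + D * (2 * \<epsilon> / \<rho>) = \<eta>"
  proof -
    have "\<mu> * \<epsilon> + D * (2 * \<epsilon> / \<rho>) = (\<mu> + 2 * D / \<rho>) * \<epsilon>" by (simp add: algebra_simps)
    then show ?thesis using den by (simp add: \<epsilon>_def)
  qed
  define \<phi> where "\<phi> = (\<lambda>y. \<Phi> y - \<epsilon> * (1 - y / \<rho>)\<^sup>2)"
  have "n 0 \<le> \<phi> 0"
  proof (rule rob[unfolded robin_sub_def, rule_format, where \<rho> = \<rho> and \<phi> = \<phi>
        and ?\<phi>1.0 = "\<lambda>y. \<Phi>1 y + 2 * \<epsilon> / \<rho> * (1 - y / \<rho>)" and ?\<phi>2.0 = "\<lambda>y. - g (\<Phi> y) / D + - (2 * \<epsilon> / \<rho>\<^sup>2)"])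
    show "0 < \<rho>" "L * \<rho>\<^sup>2 \<le> D / 2" using \<rho> by auto
    fix y :: real assume y: "0 \<le> y"
    show "(\<phi> has_real_derivative \<Phi>1 y + 2 * \<epsilon> / \<rho> * (1 - y / \<rho>)) (at y)"
      unfolding \<phi>_def using \<Phi>(3)[OF y] \<rho> by (auto intro!: derivative_eq_intros)
    have "((\<lambda>y. 2 * \<epsilon> / \<rho> * (1 - y / \<rho>)) has_real_derivative - (2 * \<epsilon> / \<rho>\<^sup>2)) (at y)"
      using \<rho> by (auto intro!: derivative_eq_intros simp: power2_eq_square)
    then show "((\<lambda>y. \<Phi>1 y + 2 * \<epsilon> / \<rho> * (1 - y / \<rho>)) has_real_derivative - g (\<Phi> y) / D + - (2 * \<epsilon> / \<rho>\<^sup>2)) (at y)"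
      by (rule DERIV_add[OF \<Phi>(4)[OF y]])
  next
    fix y assume y: "0 < y" "y < \<rho>"
    have "(1 - y / \<rho>)\<^sup>2 \<le> 1" using y by (intro power_le_one) auto
    then have "\<epsilon> * (1 - y / \<rho>)\<^sup>2 \<le> \<epsilon>" using \<open>0 < \<epsilon>\<close> by simp
    then have "\<bar>\<phi> y - \<Phi> y\<bar> \<le> \<epsilon>" using \<open>0 < \<epsilon>\<close> by (simp add: \<phi>_def)
    then have "L * \<bar>\<phi> y - \<Phi> y\<bar> \<le> L * \<epsilon>" using \<open>0 < L\<close> by simp
    then have "g (\<phi> y) \<le> g (\<Phi> y) + L * \<epsilon>" using lipD[OF g(1), of "\<phi> y" "\<Phi> y"] by linarith
    also have "L * \<epsilon> = L * \<rho>\<^sup>2 * \<epsilon> / \<rho>\<^sup>2" using \<rho>(1) by simp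
    also have "\<dots> = D * \<epsilon> / \<rho>\<^sup>2 / 2" unfolding \<rho>(2) by simp
    also have "\<dots> \<le> 2 * (D * \<epsilon> / \<rho>\<^sup>2)"
    proof -
      have "x / 2 \<le> 2 * x" if "0 \<le> x" for x :: real using that by simp
      then show ?thesis by this (use \<open>0 < D\<close> \<open>0 < \<epsilon>\<close> in simp)
    qed
    finally show "g (\<phi> y) \<le> - D * (- g (\<Phi> y) / D + - (2 * \<epsilon> / \<rho>\<^sup>2))" using \<open>0 < D\<close> by (simp add: algebra_simps)
  next
    show "n \<rho> \<le> \<phi> \<rho>" using le[of \<rho>] \<rho> by (simp add: \<phi>_def)
    show "\<nu> * c - \<mu> * \<phi> 0 \<le> - D * (\<Phi>1 0 + 2 * \<epsilon> / \<rho> * (1 - 0 / \<rho>))"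
      using \<epsilon> \<Phi>(1,2) unfolding \<phi>_def \<eta>_def by (simp add: algebra_simps)
  qed
  then show False using \<Phi>(1) \<open>0 < \<epsilon>\<close> by (simp add: \<phi>_def)
qed

text \<open>An interface value above the steady one has a smaller slope, hence more outward flux,
  which the other component can supply only if it is too large as well. Adding the two flux
  inequalities cancels the exchange terms and contradicts strict monotonicity of the slopes.\<close>

lemma pair_le_steady:
  assumes pos: "0 < D" "0 < d" "0 < \<mu>" "0 < \<nu>"
    and sub: "subsol D L g n1" "subsol d L f n2"
    and g: "lip L g" "kpp_sign z1 g" and f: "lip L f" "kpp_sign z2 f"
    and B: "\<And>y. 0 \<le> y \<Longrightarrow> n1 y \<le> B" "\<And>y. 0 \<le> y \<Longrightarrow> n2 y \<le> B"
    and rob: "robin_sub D L g \<mu> \<nu> (n2 0) n1" "robin_sub d L f \<nu> \<mu> (n1 0) n2"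
    and steady: "- D * pslope D g z1 a = \<nu> * b - \<mu> * a" "- d * pslope d f z2 b = \<mu> * a - \<nu> * b"
    and P: "profile D g z1 a \<Phi> \<Phi>1" "profile d f z2 b \<Psi> \<Psi>1" and "0 \<le> y"
  shows "n1 y \<le> \<Phi> y" "n2 y \<le> \<Psi> y"
proof -
  note r1 = robin_slope[OF pos(1,3) sub(1) g B(1) rob(1)]
  note r2 = robin_slope[OF pos(2,4) sub(2) f B(2) rob(2)]
  have m1: "D * pslope D g z1 x < D * pslope D g z1 a" if "a < x" for x
    using pslope_strict_antimono[OF pos(1) g that] pos(1) by simp
  have m2: "d * pslope d f z2 x < d * pslope d f z2 b" if "b < x" for x
    using pslope_strict_antimono[OF pos(2) f that] pos(2) by simp
  have both: False if "a < n1 0" "b < n2 0"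
    using m1[OF that(1)] m2[OF that(2)] r1 r2 steady by simp
  have ab: "b < n2 0" if "a < n1 0"
  proof -
    have "\<mu> * a < \<mu> * n1 0" using that pos by simp
    then have "\<nu> * b < \<nu> * n2 0" using m1[OF that] r1 steady(1) by simp
    then show ?thesis using pos by simp
  qed
  have ba: "a < n1 0" if "b < n2 0"
  proof -
    have "\<nu> * b < \<nu> * n2 0" using that pos by simp
    then have "\<mu> * a < \<mu> * n1 0" using m2[OF that] r2 steady(2) by simp
    then show ?thesis using pos by simp
  qed
  have "n1 0 \<le> a" "n2 0 \<le> b" using both ab ba by force+
  then show "n1 y \<le> \<Phi> y" "n2 y \<le> \<Psi> y"
    using subsol_le_profile[OF pos(1) sub(1) g B(1) _ P(1) \<open>0 \<le> y\<close>]
      subsol_le_profile[OF pos(2) sub(2) f B(2) _ P(2) \<open>0 \<le> y\<close>] by auto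
qed

section \<open>From the parabolic problem to its envelope\<close>

definition half_bounded :: "'n::finite \<Rightarrow> (real^'n \<Rightarrow> real \<Rightarrow> real) \<Rightarrow> real \<Rightarrow> bool" where
  "half_bounded k w C \<longleftrightarrow> (\<forall>x t. 0 \<le> x $ k \<longrightarrow> 0 < t \<longrightarrow> \<bar>w x t\<bar> \<le> C)"

lemma half_boundedD: "half_bounded k w C \<Longrightarrow> 0 \<le> x $ k \<Longrightarrow> 0 < t \<Longrightarrow> \<bar>w x t\<bar> \<le> C"
  by (simp add: half_bounded_def)

definition upper_envelope :: "'n::finite \<Rightarrow> (real^'n \<Rightarrow> real \<Rightarrow> real) \<Rightarrow> real \<Rightarrow> real" where
  "upper_envelope k w y = Inf {c. ub k w c y}"

lemma ub_mono: "ub k w c y \<Longrightarrow> c \<le> c' \<Longrightarrow> ub k w c' y"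
  unfolding ub_def by (meson add_right_mono order_trans)

lemma upper_envelope:
  fixes w :: "real^'n::finite \<Rightarrow> real \<Rightarrow> real"
  assumes bd: "half_bounded k w C" and "0 \<le> y"
  shows "upper_envelope k w y \<le> c \<longleftrightarrow> ub k w c y" "upper_envelope k w y \<le> C"
proof -
  have ubC: "ub k w C y" unfolding ub_def
  proof (intro allI impI exI[of _ 1])
    fix R \<epsilon> :: real and x :: "real^'n" and t :: real
    assume "0 < \<epsilon>" "x $ k = y" "1 \<le> t"
    then show "w x t \<le> C + \<epsilon>" using half_boundedD[OF bd, of x t] \<open>0 \<le> y\<close> by simp
  qed
  have lb: "- C \<le> c" if ubc: "ub k w c y" for c
  proof (rule field_le_epsilon)
    fix e :: real assume "0 < e"
    obtain T where T: "\<And>x t. x $ k = y \<Longrightarrow> norm x \<le> \<bar>y\<bar> \<Longrightarrow> T \<le> t \<Longrightarrow> w x t \<le> c + e"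
      using ubc \<open>0 < e\<close> unfolding ub_def by meson
    \<comment> \<open>The hyperplane meets the ball of radius \<open>\<bar>y\<bar>\<close> in this
      point, so admissible constants are bounded below and \<open>Inf\<close> is a genuine
      infimum.\<close>
    have "w (y *\<^sub>R axis k 1) (max T 1) \<le> c + e" by (rule T) (auto simp: norm_axis_1)
    moreover have "\<bar>w (y *\<^sub>R axis k 1) (max T 1)\<bar> \<le> C" by (rule half_boundedD[OF bd]) (use \<open>0 \<le> y\<close> in auto)
    ultimately show "- C \<le> c + e" by simp
  qed
  have bdd: "bdd_below {c. ub k w c y}" using lb by (auto simp: bdd_below_def)
  show "upper_envelope k w y \<le> C" unfolding upper_envelope_def using ubC bdd by (auto intro: cInf_lower)
  show "upper_envelope k w y \<le> c \<longleftrightarrow> ub k w c y"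
  proof
    assume "ub k w c y"
    then show "upper_envelope k w y \<le> c" unfolding upper_envelope_def using bdd by (auto intro: cInf_lower)
  next
    assume le: "upper_envelope k w y \<le> c"
    show "ub k w c y" unfolding ub_def
    proof (intro allI impI)
      fix R \<epsilon> :: real assume "0 < \<epsilon>"
      then have "Inf {c. ub k w c y} < c + \<epsilon> / 2" using le by (simp add: upper_envelope_def)
      then obtain c' where "ub k w c' y" "c' < c + \<epsilon> / 2"
        using cInf_lessD[of "{c. ub k w c y}"] ubC by auto
      then have "ub k w (c + \<epsilon> / 2) y" using ub_mono by (metis less_imp_le)
      then obtain T where T: "\<And>x t. x $ k = y \<Longrightarrow> norm x \<le> R \<Longrightarrow> T \<le> t \<Longrightarrow> w x t \<le> c + \<epsilon> / 2 + \<epsilon> / 2"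
        using \<open>0 < \<epsilon>\<close> unfolding ub_def by (meson half_gt_zero)
      show "\<exists>T. \<forall>x t. x $ k = y \<longrightarrow> norm x \<le> R \<longrightarrow> T \<le> t \<longrightarrow> w x t \<le> c + \<epsilon>"
      proof (intro exI[of _ T] allI impI)
        fix x t assume "x $ k = y" "norm x \<le> R" "T \<le> t"
        from T[OF this] show "w x t \<le> c + \<epsilon>" by simp
      qed
    qed
  qed
qed

lemma slab_comparison_lip:
  fixes w v :: "real^'n::finite \<Rightarrow> real \<Rightarrow> real"
  assumes "0 < D" and w: "half_cont k w" "evpde k D g w" and g: "lip L g"
    and bd: "\<And>x t. 0 \<le> x $ k \<Longrightarrow> 0 < t \<Longrightarrow> w x t \<le> C"
    and y: "0 \<le> y1" "y1 < y2" "L * (y2 - y1)\<^sup>2 \<le> D / 2"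
    and d: "\<And>y. y1 \<le> y \<Longrightarrow> y \<le> y2 \<Longrightarrow> (\<phi> has_real_derivative \<phi>1 y) (at y)"
      "\<And>y. y1 \<le> y \<Longrightarrow> y \<le> y2 \<Longrightarrow> (\<phi>1 has_real_derivative \<phi>2 y) (at y)"
    and super: "\<And>y. y1 < y \<Longrightarrow> y < y2 \<Longrightarrow> g (\<phi> y) \<le> - D * \<phi>2 y"
    and right: "ub k w (\<phi> y2) y2"
    and left: "ub k w (\<phi> y1) y1 \<or>
      (y1 = 0 \<and> 0 < \<mu> \<and> 0 < \<nu> \<and> flux k D \<mu> \<nu> w v \<and> ub k v b 0 \<and> \<nu> * b - \<mu> * \<phi> 0 \<le> - D * \<phi>1 0)"
    and "0 < \<epsilon>"
  shows "\<exists>T. \<forall>x t. y1 \<le> x $ k \<longrightarrow> x $ k \<le> y2 \<longrightarrow> norm x \<le> R \<longrightarrow> T \<le> t \<longrightarrow> w x t \<le> \<phi> (x $ k) + \<epsilon>"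
proof (rule slab_comparison[OF \<open>0 < D\<close> w bd y(1,2) d _ y(3) _ right left \<open>0 < \<epsilon>\<close>])
  show "0 \<le> L" using lip_pos[OF g] by simp
  fix y s assume h: "y1 < y" "y < y2" "\<phi> y \<le> s"
  then show "g s \<le> - D * \<phi>2 y + L * (s - \<phi> y)"
    using super[OF h(1,2)] lipD[OF g, of s "\<phi> y"] by simp
qed

lemma ub_of_slab:
  assumes "\<And>R \<epsilon>. 0 < \<epsilon> \<Longrightarrow> \<exists>T. \<forall>x t. y1 \<le> x $ k \<longrightarrow> x $ k \<le> y2 \<longrightarrow> norm x \<le> R \<longrightarrow> T \<le> t \<longrightarrow> w x t \<le> \<phi> (x $ k) + \<epsilon>"
    and "y1 \<le> y" "y \<le> y2"
  shows "ub k w (\<phi> y) y"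
  unfolding ub_def
proof (intro allI impI)
  fix R \<epsilon> :: real assume "0 < \<epsilon>"
  then obtain T where "\<And>x t. y1 \<le> x $ k \<Longrightarrow> x $ k \<le> y2 \<Longrightarrow> norm x \<le> R \<Longrightarrow> T \<le> t \<Longrightarrow> w x t \<le> \<phi> (x $ k) + \<epsilon>"
    using assms(1) by metis
  then show "\<exists>T. \<forall>x t. x $ k = y \<longrightarrow> norm x \<le> R \<longrightarrow> T \<le> t \<longrightarrow> w x t \<le> \<phi> y + \<epsilon>"
    using assms(2,3) by (intro exI[of _ T]) auto
qed

lemma upper_envelope_subsol:
  fixes w :: "real^'n::finite \<Rightarrow> real \<Rightarrow> real"
  assumes "0 < D" and w: "half_cont k w" "evpde k D g w" and g: "lip L g"
    and bd: "half_bounded k w C"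
  shows "subsol D L g (upper_envelope k w)"
  unfolding subsol_def
proof (intro allI impI)
  fix y1 y2 \<phi> \<phi>1 \<phi>2 y
  assume h: "0 \<le> y1" "y1 < y2" "L * (y2 - y1)\<^sup>2 \<le> D / 2"
    "\<forall>y. y1 \<le> y \<longrightarrow> y \<le> y2 \<longrightarrow> (\<phi> has_real_derivative \<phi>1 y) (at y)"
    "\<forall>y. y1 \<le> y \<longrightarrow> y \<le> y2 \<longrightarrow> (\<phi>1 has_real_derivative \<phi>2 y) (at y)"
    "\<forall>y. y1 < y \<longrightarrow> y < y2 \<longrightarrow> g (\<phi> y) \<le> - D * \<phi>2 y"
    "upper_envelope k w y1 \<le> \<phi> y1" "upper_envelope k w y2 \<le> \<phi> y2" "y1 \<le> y" "y \<le> y2"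
  have C: "w x t \<le> C" if "0 \<le> x $ k" "0 < t" for x t using half_boundedD[OF bd that] by simp
  have u: "ub k w (\<phi> y1) y1" "ub k w (\<phi> y2) y2"
    using h upper_envelope(1)[OF bd] by auto
  have "ub k w (\<phi> y) y"
  proof (rule ub_of_slab[OF _ h(9,10)])
    fix R \<epsilon> :: real assume "0 < \<epsilon>"
    then show "\<exists>T. \<forall>x t. y1 \<le> x $ k \<longrightarrow> x $ k \<le> y2 \<longrightarrow> norm x \<le> R \<longrightarrow> T \<le> t \<longrightarrow> w x t \<le> \<phi> (x $ k) + \<epsilon>"
      using h(4,5,6) by (intro slab_comparison_lip[OF \<open>0 < D\<close> w g C h(1-3) _ _ _ u(2) disjI1[OF u(1)]]) auto
  qed
  then show "upper_envelope k w y \<le> \<phi> y"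
    using upper_envelope(1)[OF bd] h by auto
qed

lemma upper_envelope_robin:
  fixes w v :: "real^'n::finite \<Rightarrow> real \<Rightarrow> real"
  assumes "0 < D" "0 < \<mu>" "0 < \<nu>" and w: "half_cont k w" "evpde k D g w" and g: "lip L g" and "flux k D \<mu> \<nu> w v"
    and bd: "half_bounded k w C" "half_bounded k v C"
  shows "robin_sub D L g \<mu> \<nu> (upper_envelope k v 0) (upper_envelope k w)"
  unfolding robin_sub_def
proof (intro allI impI)
  fix \<rho> \<phi> \<phi>1 \<phi>2
  assume h: "0 < \<rho>" "L * \<rho>\<^sup>2 \<le> D / 2"
    "\<forall>y. 0 \<le> y \<longrightarrow> y \<le> \<rho> \<longrightarrow> (\<phi> has_real_derivative \<phi>1 y) (at y)"
    "\<forall>y. 0 \<le> y \<longrightarrow> y \<le> \<rho> \<longrightarrow> (\<phi>1 has_real_derivative \<phi>2 y) (at y)"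
    "\<forall>y. 0 < y \<longrightarrow> y < \<rho> \<longrightarrow> g (\<phi> y) \<le> - D * \<phi>2 y"
    "upper_envelope k w \<rho> \<le> \<phi> \<rho>" "\<nu> * upper_envelope k v 0 - \<mu> * \<phi> 0 \<le> - D * \<phi>1 0"
  have C: "w x t \<le> C" if "0 \<le> x $ k" "0 < t" for x t using half_boundedD[OF bd(1) that] by simp
  have u: "ub k w (\<phi> \<rho>) \<rho>"
    using h upper_envelope(1)[OF bd(1)] by auto
  have v: "ub k v (upper_envelope k v 0) 0"
    using upper_envelope(1)[OF bd(2)] by auto
  have "ub k w (\<phi> 0) 0"
  proof (rule ub_of_slab)
    fix R \<epsilon> :: real assume "0 < \<epsilon>"
    show "\<exists>T. \<forall>x t. 0 \<le> x $ k \<longrightarrow> x $ k \<le> \<rho> \<longrightarrow> norm x \<le> R \<longrightarrow> T \<le> t \<longrightarrow> w x t \<le> \<phi> (x $ k) + \<epsilon>"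
    proof (rule slab_comparison_lip[OF \<open>0 < D\<close> w g C, where \<phi> = \<phi> and ?\<phi>1.0 = \<phi>1 and ?\<phi>2.0 = \<phi>2
          and \<mu> = \<mu> and \<nu> = \<nu> and v = v and b = "upper_envelope k v 0"])
      show "ub k w (\<phi> 0) 0 \<or> 0 = (0::real) \<and> 0 < \<mu> \<and> 0 < \<nu> \<and> flux k D \<mu> \<nu> w v \<and>
          ub k v (upper_envelope k v 0) 0 \<and> \<nu> * upper_envelope k v 0 - \<mu> * \<phi> 0 \<le> - D * \<phi>1 0"
        using h(7) v assms(2,3,7) by simp
    qed (use h u \<open>0 < \<epsilon>\<close> in auto)
  qed (use h in auto)
  then show "upper_envelope k w 0 \<le> \<phi> 0"
    using upper_envelope(1)[OF bd(1)] by auto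
qed

text \<open>Bounds on single hyperplanes become uniform by a second use of the slab comparison, with
  the exact profile itself as upper function; finitely many slabs of width \<rho> cover a
  ball.\<close>

lemma locally_uniform_upper:
  fixes w :: "real^'n::finite \<Rightarrow> real \<Rightarrow> real"
  assumes "0 < D" and w: "half_cont k w" "evpde k D g w" and g: "lip L g"
    and bd: "\<And>x t. 0 \<le> x $ k \<Longrightarrow> 0 < t \<Longrightarrow> w x t \<le> C"
    and P: "profile D g z b \<Phi> \<Phi>1" and u: "\<And>y. 0 \<le> y \<Longrightarrow> ub k w (\<Phi> y) y" and "0 < \<epsilon>"
  shows "\<exists>T. \<forall>x t. 0 \<le> x $ k \<longrightarrow> norm x \<le> R \<longrightarrow> T \<le> t \<longrightarrow> w x t \<le> \<Phi> (x $ k) + \<epsilon>"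
proof -
  have "0 < L" using lip_pos[OF g] .
  define \<rho> where "\<rho> = sqrt (D / (2 * L))"
  have \<rho>: "0 < \<rho>" "L * \<rho>\<^sup>2 = D / 2" using \<open>0 < D\<close> \<open>0 < L\<close> by (simp_all add: \<rho>_def)
  have slab: "\<exists>T. \<forall>x t. real j * \<rho> \<le> x $ k \<longrightarrow> x $ k \<le> real (Suc j) * \<rho> \<longrightarrow> norm x \<le> R \<longrightarrow> T \<le> t \<longrightarrow> w x t \<le> \<Phi> (x $ k) + \<epsilon>" for j
  proof (rule slab_comparison_lip[OF \<open>0 < D\<close> w g bd, where ?\<phi>1.0 = \<Phi>1 and ?\<phi>2.0 = "\<lambda>y. - g (\<Phi> y) / D"])
    have j: "0 \<le> real j * \<rho>" using \<rho> by simp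
    show "0 \<le> real j * \<rho>" by fact
    show "real j * \<rho> < real (Suc j) * \<rho>" using \<rho> by simp
    have "real (Suc j) * \<rho> - real j * \<rho> = \<rho>" by (simp add: algebra_simps)
    then show "L * (real (Suc j) * \<rho> - real j * \<rho>)\<^sup>2 \<le> D / 2" using \<rho> by simp
    show "(\<Phi> has_real_derivative \<Phi>1 y) (at y)" "(\<Phi>1 has_real_derivative - g (\<Phi> y) / D) (at y)" if "real j * \<rho> \<le> y" for y
      using P j that unfolding profile_def by (meson order_trans)+
    show "ub k w (\<Phi> (real (Suc j) * \<rho>)) (real (Suc j) * \<rho>)" using \<rho> by (intro u) simp
    \<comment> \<open>The first half of the disjunction holds on every slab; the parameters of the
      second half are filled with 0 and \<open>w\<close>.\<close>
    show "ub k w (\<Phi> (real j * \<rho>)) (real j * \<rho>) \<or> real j * \<rho> = 0 \<and> 0 < (0::real) \<and> 0 < (0::real) \<and> flux k D 0 0 w w \<and>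
        ub k w 0 0 \<and> 0 * 0 - 0 * \<Phi> 0 \<le> - D * \<Phi>1 0"
      using u[OF j] by simp
  qed (use \<open>0 < D\<close> \<open>0 < \<epsilon>\<close> in auto)
  have "\<exists>T. \<forall>x t. 0 \<le> x $ k \<longrightarrow> x $ k \<le> real J * \<rho> \<longrightarrow> norm x \<le> R \<longrightarrow> T \<le> t \<longrightarrow> w x t \<le> \<Phi> (x $ k) + \<epsilon>" for J
  proof (induction J)
    case 0
    from slab[of 0] obtain T where T: "\<And>x t. 0 \<le> x $ k \<Longrightarrow> x $ k \<le> \<rho> \<Longrightarrow> norm x \<le> R \<Longrightarrow> T \<le> t \<Longrightarrow> w x t \<le> \<Phi> (x $ k) + \<epsilon>" by auto
    show ?case
    proof (intro exI[of _ T] allI impI)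
      fix x :: "real^'n" and t assume "0 \<le> x $ k" "x $ k \<le> real 0 * \<rho>" "norm x \<le> R" "T \<le> t"
      then show "w x t \<le> \<Phi> (x $ k) + \<epsilon>" using \<rho> by (intro T) auto
    qed
  next
    case (Suc J)
    then obtain T1 where T1: "\<And>x t. 0 \<le> x $ k \<Longrightarrow> x $ k \<le> real J * \<rho> \<Longrightarrow> norm x \<le> R \<Longrightarrow> T1 \<le> t \<Longrightarrow> w x t \<le> \<Phi> (x $ k) + \<epsilon>" by blast
    from slab[of J] obtain T2 where T2: "\<And>x t. real J * \<rho> \<le> x $ k \<Longrightarrow> x $ k \<le> real (Suc J) * \<rho> \<Longrightarrow> norm x \<le> R \<Longrightarrow> T2 \<le> t \<Longrightarrow> w
        x t \<le> \<Phi> (x $ k) + \<epsilon>" by blast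
    show ?case
    proof (intro exI[of _ "max T1 T2"] allI impI)
      fix x :: "real^'n" and t assume h: "0 \<le> x $ k" "x $ k \<le> real (Suc J) * \<rho>" "norm x \<le> R" "max T1 T2 \<le> t"
      show "w x t \<le> \<Phi> (x $ k) + \<epsilon>"
      proof (cases "x $ k \<le> real J * \<rho>")
        case True
        then show ?thesis using h by (intro T1) auto
      next
        case False
        then show ?thesis using h by (intro T2) auto
      qed
    qed
  qed
  from this[of "nat \<lceil>\<bar>R\<bar> / \<rho>\<rceil>"] obtain T where
    T: "\<And>x t. 0 \<le> x $ k \<Longrightarrow> x $ k \<le> real (nat \<lceil>\<bar>R\<bar> / \<rho>\<rceil>) * \<rho> \<Longrightarrow> norm x \<le> R \<Longrightarrow> T \<le> t \<Longrightarrow> w x t \<le> \<Phi> (x $ k) + \<epsilon>" by blast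
  have "\<bar>R\<bar> / \<rho> \<le> real (nat \<lceil>\<bar>R\<bar> / \<rho>\<rceil>)" by (rule real_nat_ceiling_ge)
  then have "\<bar>R\<bar> \<le> real (nat \<lceil>\<bar>R\<bar> / \<rho>\<rceil>) * \<rho>" using pos_divide_le_eq[OF \<rho>(1)] by blast
  moreover have "x $ k \<le> \<bar>R\<bar>" if "norm x \<le> R" for x :: "real^'n"
    using component_le_norm_cart[of x k] that by linarith
  ultimately have "x $ k \<le> real (nat \<lceil>\<bar>R\<bar> / \<rho>\<rceil>) * \<rho>" if "norm x \<le> R" for x :: "real^'n"
    using that by (meson order_trans)
  then show ?thesis using T by blast
qed

lemma coupled_upper:
  fixes u v :: "real^'n::finite \<Rightarrow> real \<Rightarrow> real"
  assumes pos: "0 < D" "0 < d" "0 < \<mu>" "0 < \<nu>" "0 < \<epsilon>"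
    and u: "half_cont k u" "evpde k D g u" "flux k D \<mu> \<nu> u v"
    and v: "half_cont k v" "evpde k d f v" "flux k d \<nu> \<mu> v u"
    and bd: "half_bounded k u C" "half_bounded k v C"
    and g: "lip L g" "kpp_sign z1 g" and f: "lip L f" "kpp_sign z2 f"
    and steady: "- D * pslope D g z1 a = \<nu> * b - \<mu> * a" "- d * pslope d f z2 b = \<mu> * a - \<nu> * b"
    and P: "profile D g z1 a \<Phi> \<Phi>1" "profile d f z2 b \<Psi> \<Psi>1"
  shows "\<exists>T. \<forall>x t. 0 \<le> x $ k \<longrightarrow> norm x \<le> R \<longrightarrow> T \<le> t \<longrightarrow> u x t \<le> \<Phi> (x $ k) + \<epsilon>"
    "\<exists>T. \<forall>x t. 0 \<le> x $ k \<longrightarrow> norm x \<le> R \<longrightarrow> T \<le> t \<longrightarrow> v x t \<le> \<Psi> (x $ k) + \<epsilon>"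
proof -
  note eu = upper_envelope[OF bd(1)] and ev = upper_envelope[OF bd(2)]
  have le: "upper_envelope k u y \<le> \<Phi> y" "upper_envelope k v y \<le> \<Psi> y" if "0 \<le> y" for y
    by (rule pair_le_steady[OF pos(1-4) upper_envelope_subsol[OF pos(1) u(1,2) g(1) bd(1)]
      upper_envelope_subsol[OF pos(2) v(1,2) f(1) bd(2)] g f _ _
      upper_envelope_robin[OF pos(1,3,4) u(1,2) g(1) u(3) bd]
      upper_envelope_robin[OF pos(2,4,3) v(1,2) f(1) v(3) bd(2,1)] steady P that];
      rule eu(2) ev(2); assumption)+
  have C: "u x t \<le> C" "v x t \<le> C" if "0 \<le> x $ k" "0 < t" for x t
    using half_boundedD[OF bd(1) that] half_boundedD[OF bd(2) that] by auto
  have ub: "ub k u (\<Phi> y) y" "ub k v (\<Psi> y) y" if "0 \<le> y" for y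
    using le[OF that] eu(1)[OF that] ev(1)[OF that] by auto
  show "\<exists>T. \<forall>x t. 0 \<le> x $ k \<longrightarrow> norm x \<le> R \<longrightarrow> T \<le> t \<longrightarrow> u x t \<le> \<Phi> (x $ k) + \<epsilon>"
    by (rule locally_uniform_upper[OF pos(1) u(1,2) g(1) C(1) P(1) ub(1) pos(5)])
  show "\<exists>T. \<forall>x t. 0 \<le> x $ k \<longrightarrow> norm x \<le> R \<longrightarrow> T \<le> t \<longrightarrow> v x t \<le> \<Psi> (x $ k) + \<epsilon>"
    by (rule locally_uniform_upper[OF pos(2) v(1,2) f(1) C(2) P(2) ub(2) pos(5)])
qed

section \<open>Reflection of the lower half-space\<close>

definition mirror :: "'n \<Rightarrow> real^'n \<Rightarrow> real^'n" where
  "mirror k x = x - (2 * x $ k) *\<^sub>R axis k 1"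

lemma mirror_nth [simp]: "mirror k x $ k = - x $ k"
  by (simp add: mirror_def)

lemma mirror_mirror [simp]: "mirror k (mirror k x) = x"
  by (simp add: mirror_def[of k "mirror k x"]) (simp add: mirror_def)

lemma norm_mirror [simp]: "norm (mirror k x) = norm (x :: real^'n::finite)"
proof -
  have "(norm (mirror k x))\<^sup>2 = (norm x)\<^sup>2"
    using norm_sq_add_axis[of x "- 2 * x $ k" k] by (simp add: mirror_def power2_eq_square)
  then show ?thesis by simp
qed

lemma mirror_add_axis:
  "mirror k (x + r *\<^sub>R axis i 1) = mirror k x + (if i = k then - r else r) *\<^sub>R axis i (1::real)"
  by (auto simp: mirror_def axis_def vec_eq_iff algebra_simps)

lemma mirror_eq_self: "x $ k = 0 \<Longrightarrow> mirror k x = x"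
  by (simp add: mirror_def)

lemma continuous_on_mirror [continuous_intros]:
  "continuous_on A f \<Longrightarrow> continuous_on A (\<lambda>z. mirror k (f z))"
  unfolding mirror_def by (intro continuous_intros)

lemma jet_mirror:
  assumes "jet w (mirror k x) t a b"
  shows "jet (\<lambda>x t. w (mirror k x) t) x t a b"
  unfolding jet_def
proof (intro conjI allI)
  show "((\<lambda>s. w (mirror k x) s) has_real_derivative a) (at t)" using assms by (simp add: jet_def)
  fix i
  obtain q where q: "\<forall>\<^sub>F r in nhds 0. ((\<lambda>r. w (mirror k x + r *\<^sub>R axis i 1) t) has_real_derivative q r) (at r)"
    "(q has_real_derivative b i) (at 0)"
    using assms unfolding jet_def by blast
  show "\<exists>q. (\<forall>\<^sub>F r in nhds 0. ((\<lambda>r. w (mirror k (x + r *\<^sub>R axis i 1)) t) has_real_derivative q r) (at r)) \<and>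
      (q has_real_derivative b i) (at 0)"
  proof (cases "i = k")
    case False
    then show ?thesis using q by (intro exI[of _ q]) (simp add: mirror_add_axis)
  next
    case True
    obtain e where e: "e > 0" "\<And>r. \<bar>r\<bar> < e \<Longrightarrow> ((\<lambda>r. w (mirror k x + r *\<^sub>R axis i 1) t) has_real_derivative q r) (at r)"
      using q(1) unfolding eventually_nhds_metric dist_real_def by auto
    have "\<forall>\<^sub>F r in nhds 0. ((\<lambda>r. w (mirror k x + (- r) *\<^sub>R axis i 1) t) has_real_derivative - q (- r)) (at r)"
      unfolding eventually_nhds_metric dist_real_def
    proof (intro exI[of _ e] conjI allI impI)
      fix r :: real assume "\<bar>r - 0\<bar> < e"
      then show "((\<lambda>r. w (mirror k x + (- r) *\<^sub>R axis i 1) t) has_real_derivative - q (- r)) (at r)"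
        using DERIV_chain2[OF e(2)[of "- r"] DERIV_minus[OF DERIV_ident]] by simp
    qed fact
    moreover have "((\<lambda>r. - q (- r)) has_real_derivative b i) (at 0)"
      using DERIV_minus[OF DERIV_chain2[of q "b i" "\<lambda>r. - r" 0, OF _ DERIV_minus[OF DERIV_ident]]] q(2) by simp
    ultimately show ?thesis using True by (intro exI[of _ "\<lambda>r. - q (- r)"]) (simp add: mirror_add_axis)
  qed
qed

section \<open>Classical derivatives and jets\<close>

lemma jet_of_C21:
  assumes "C21_on w \<Omega>" "x \<in> \<Omega>" "0 < t"
  shows "jet w x t (dpt w x t) (\<lambda>i. dxx w i x t)"
  unfolding jet_def dpt_def dxx_def
proof (intro conjI allI)
  show "((\<lambda>s. w x s) has_real_derivative deriv (\<lambda>s. w x s) t) (at t)"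
    using assms unfolding C21_on_def by (auto simp: DERIV_deriv_iff_real_differentiable)
  fix i
  have "\<forall>\<^sub>F r in nhds 0. (\<lambda>r. w (x + r *\<^sub>R axis i 1) t) differentiable (at r)"
    "deriv (\<lambda>r. w (x + r *\<^sub>R axis i 1) t) differentiable (at 0)"
    using assms unfolding C21_on_def by blast+
  then show "\<exists>q. (\<forall>\<^sub>F r in nhds 0. ((\<lambda>r. w (x + r *\<^sub>R axis i 1) t) has_real_derivative q r) (at r)) \<and>
     (q has_real_derivative deriv (deriv (\<lambda>r. w (x + r *\<^sub>R axis i 1) t)) 0) (at 0)"
    by (intro exI[of _ "deriv (\<lambda>r. w (x + r *\<^sub>R axis i 1) t)"])
      (simp add: DERIV_deriv_iff_real_differentiable)
qed

text \<open>The converse direction serves the constructed steady state, which must be exhibited as a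
  solution with continuous derivatives.\<close>

lemma C21_of_jet:
  assumes J: "\<And>x t. x \<in> \<Omega> \<Longrightarrow> 0 < t \<Longrightarrow> jet w x t (A x t) (B x t)"
    and A: "continuous_on (\<Omega> \<times> {0<..}) (\<lambda>(x, t). A x t)"
    and B: "\<And>i. continuous_on (\<Omega> \<times> {0<..}) (\<lambda>(x, t). B x t i)"
  shows "C21_on w \<Omega>" "\<And>x t. x \<in> \<Omega> \<Longrightarrow> 0 < t \<Longrightarrow> dpt w x t = A x t"
    "\<And>x t i. x \<in> \<Omega> \<Longrightarrow> 0 < t \<Longrightarrow> dxx w i x t = B x t i"
proof -
  have t: "(\<lambda>s. w x s) differentiable (at t)" "dpt w x t = A x t" if "x \<in> \<Omega>" "0 < t" for x t
    using J[OF that] unfolding jet_def dpt_def by (auto intro: DERIV_imp_deriv simp: real_differentiable_def)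
  have x: "(\<forall>\<^sub>F r in nhds 0. (\<lambda>r. w (x + r *\<^sub>R axis i 1) t) differentiable (at r)) \<and>
      (deriv (\<lambda>r. w (x + r *\<^sub>R axis i 1) t) has_real_derivative B x t i) (at 0)" if xt: "x \<in> \<Omega>" "0 < t" for x t i
  proof -
    obtain q where q: "\<forall>\<^sub>F r in nhds 0. ((\<lambda>r. w (x + r *\<^sub>R axis i 1) t) has_real_derivative q r) (at r)"
      "(q has_real_derivative B x t i) (at 0)"
      using J[OF xt] unfolding jet_def by blast
    have "\<forall>\<^sub>F r in nhds 0. (\<lambda>r. w (x + r *\<^sub>R axis i 1) t) differentiable (at r)"
      using q(1) by eventually_elim (auto simp: real_differentiable_def)
    moreover have "\<forall>\<^sub>F r in nhds 0. deriv (\<lambda>r. w (x + r *\<^sub>R axis i 1) t) r = q r"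
      using q(1) by eventually_elim (rule DERIV_imp_deriv)
    then have "(deriv (\<lambda>r. w (x + r *\<^sub>R axis i 1) t) has_real_derivative B x t i) (at 0)"
      using q(2) by (subst DERIV_cong_ev[OF refl _ refl]) auto
    ultimately show ?thesis by blast
  qed
  show dx: "dxx w i x t = B x t i" if "x \<in> \<Omega>" "0 < t" for x t i
    using x[OF that, of i] unfolding dxx_def by (blast intro: DERIV_imp_deriv)
  show "dpt w x t = A x t" if "x \<in> \<Omega>" "0 < t" for x t using t(2)[OF that] .
  have "continuous_on (\<Omega> \<times> {0<..}) (\<lambda>(x, t). dpt w x t)"
    using A by (rule continuous_on_eq) (auto simp: t)
  moreover have "continuous_on (\<Omega> \<times> {0<..}) (\<lambda>(x, t). dxx w i x t)" for i
    using B[of i] by (rule continuous_on_eq) (auto simp: dx)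
  ultimately show "C21_on w \<Omega>"
    unfolding C21_on_def using t(1) x by (fastforce simp: real_differentiable_def)
qed

lemma solves_H_mirrored:
  fixes u v :: "real^'n::finite \<Rightarrow> real \<Rightarrow> real"
  assumes "solves_H D d \<mu> \<nu> g f k u v"
  defines "u' \<equiv> \<lambda>x t. u (mirror k x) t"
  shows "pde k D g u'" "pde k d f v" "half_cont k u'" "half_cont k v"
    "flux k D \<mu> \<nu> u' v" "flux k d \<nu> \<mu> v u'"
proof -
  note H = assms(1)[unfolded solves_H_def]
  show "pde k D g u'" unfolding pde_def
  proof (intro allI impI)
    fix x :: "real^'n" and t :: real assume h: "0 < x $ k" "0 < t"
    then have "jet u' x t (dpt u (mirror k x) t) (\<lambda>i. dxx u i (mirror k x) t)"
      unfolding u'_def using H by (intro jet_mirror jet_of_C21[where \<Omega> = "{x. x $ k < 0}"]) auto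
    moreover have "dpt u (mirror k x) t - D * lap u (mirror k x) t = g (u' x t)"
      unfolding u'_def using H h by simp
    ultimately show "\<exists>a b. jet u' x t a b \<and> a - D * sum b UNIV = g (u' x t)" unfolding lap_def by blast
  qed
  show "pde k d f v" unfolding pde_def
  proof (intro allI impI)
    fix x :: "real^'n" and t :: real assume h: "0 < x $ k" "0 < t"
    then have "jet v x t (dpt v x t) (\<lambda>i. dxx v i x t)"
      using H by (intro jet_of_C21[where \<Omega> = "{x. x $ k > 0}"]) auto
    moreover have "dpt v x t - d * lap v x t = f (v x t)" using H h by simp
    ultimately show "\<exists>a b. jet v x t a b \<and> a - d * sum b UNIV = f (v x t)" unfolding lap_def by blast
  qed
  show "half_cont k v" using H by (simp add: half_cont_def)
  have "continuous_on ({x. x $ k \<le> 0} \<times> {0<..}) (\<lambda>z. u (fst z) (snd z))"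
    using H by (simp add: case_prod_beta)
  then have "continuous_on ({x. 0 \<le> x $ k} \<times> {0<..}) (\<lambda>z. (\<lambda>z. u (fst z) (snd z)) (mirror k (fst z), snd z))"
    by (rule continuous_on_compose2) (auto intro!: continuous_intros)
  then show "half_cont k u'" unfolding half_cont_def u'_def case_prod_beta by simp
  have fl: "\<exists>ux vx. ((\<lambda>s. u (x + s *\<^sub>R axis k 1) t) has_real_derivative ux) (at 0 within {..0}) \<and>
      ((\<lambda>s. v (x + s *\<^sub>R axis k 1) t) has_real_derivative vx) (at 0 within {0..}) \<and>
      D * ux = \<nu> * v x t - \<mu> * u x t \<and> - d * vx = \<mu> * u x t - \<nu> * v x t" if "x $ k = 0" "0 < t" for x t
    using H that by blast
  show "flux k D \<mu> \<nu> u' v" unfolding flux_def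
  proof (intro allI impI)
    fix x :: "real^'n" and t :: real assume h: "x $ k = 0" "0 < t"
    from fl[OF h] obtain ux where ux: "((\<lambda>s. u (x + s *\<^sub>R axis k 1) t) has_real_derivative ux) (at 0 within {..0})"
      "D * ux = \<nu> * v x t - \<mu> * u x t" by blast
    have "((\<lambda>s. u (x + s *\<^sub>R axis k 1) t) \<circ> uminus has_real_derivative ux * - 1) (at 0 within {0..})"
      by (rule DERIV_image_chain) (use ux in \<open>auto intro!: derivative_eq_intros\<close>)
    then show "\<exists>p. ((\<lambda>s. u' (x + s *\<^sub>R axis k 1) t) has_real_derivative p) (at 0 within {0..}) \<and> - D * p = \<nu> * v x t -
        \<mu> * u' x t"
      using ux(2) h unfolding u'_def by (intro exI[of _ "- ux"]) (simp add: mirror_add_axis mirror_eq_self o_def)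
  qed
  show "flux k d \<nu> \<mu> v u'" unfolding flux_def
  proof (intro allI impI)
    fix x :: "real^'n" and t :: real assume h: "x $ k = 0" "0 < t"
    from fl[OF h] show "\<exists>p. ((\<lambda>s. v (x + s *\<^sub>R axis k 1) t) has_real_derivative p) (at 0 within {0..}) \<and> - d * p = \<mu> *
        u' x t - \<nu> * v x t"
      using h unfolding u'_def by (auto simp: mirror_eq_self)
  qed
qed

section \<open>Truncated reactions\<close>

definition clamp1 :: "real \<Rightarrow> real \<Rightarrow> real \<Rightarrow> real" where
  "clamp1 a b s = max a (min b s)"

lemma clamp1_id: "a \<le> s \<Longrightarrow> s \<le> b \<Longrightarrow> clamp1 a b s = s"
  by (simp add: clamp1_def)

lemma lip_clamp:
  assumes "loc_lipschitz g" "a \<le> b"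
  shows "\<exists>L0. \<forall>L\<ge>L0. lip L (\<lambda>s. g (clamp1 a b s))"
proof -
  obtain L0 where L0: "L0-lipschitz_on {a..b} g" using assms(1) unfolding loc_lipschitz_def by blast
  show ?thesis
  proof (intro exI[of _ "max 1 L0"] allI impI)
    fix L assume L: "max 1 L0 \<le> L"
    have "\<bar>g (clamp1 a b s) - g (clamp1 a b r)\<bar> \<le> L * \<bar>s - r\<bar>" for s r
    proof -
      have "\<bar>g (clamp1 a b s) - g (clamp1 a b r)\<bar> \<le> L0 * \<bar>clamp1 a b s - clamp1 a b r\<bar>"
        using lipschitz_onD[OF L0, of "clamp1 a b s" "clamp1 a b r"] assms(2) by (simp add: dist_real_def clamp1_def)
      also have "\<dots> \<le> L * \<bar>s - r\<bar>"
        using L lipschitz_on_nonneg[OF L0] by (intro mult_mono) (auto simp: clamp1_def)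
      finally show ?thesis .
    qed
    then show "lip L (\<lambda>s. g (clamp1 a b s))" using L by (simp add: lip_def)
  qed
qed

text \<open>The lower clamp must be positive: \<open>g\<close> vanishes at 0, and only a clamp
  strictly between 0 and \<open>z\<close> extends the strict sign to all smaller arguments. This is
  what makes a positive eventual lower bound indispensable.\<close>

lemma kpp_sign_clamp:
  assumes "KPP_f g z" "0 < a" "a < z" "z < b"
  shows "kpp_sign z (\<lambda>s. g (clamp1 a b s))"
  using assms unfolding KPP_f_def kpp_sign_def clamp1_def by (auto simp: max_def min_def)

lemma pspeed_cong: "(\<And>r. 0 \<le> r \<Longrightarrow> r \<le> s \<Longrightarrow> h r = h' r) \<Longrightarrow> pspeed h s = pspeed h' s"
  unfolding pspeed_def by (metis (mono_tags, lifting) Henstock_Kurzweil_Integration.integral_cong atLeastAtMost_iff)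

lemma pslope_cong:
  assumes "\<And>s. min a z \<le> s \<Longrightarrow> s \<le> max a z \<Longrightarrow> g s = g' s"
  shows "pslope D g z a = pslope D g' z a"
proof (cases "a < z")
  case True
  then have "pspeed (\<lambda>r. g (z - r) / D) (z - a) = pspeed (\<lambda>r. g' (z - r) / D) (z - a)"
    by (intro pspeed_cong) (auto intro!: arg_cong2[where f = "(/)"] assms)
  then show ?thesis using True by (simp add: pslope_def)
next
  case False
  then have "pspeed (\<lambda>r. - g (z + r) / D) (a - z) = pspeed (\<lambda>r. - g' (z + r) / D) (a - z)"
    by (intro pspeed_cong) (auto intro!: arg_cong2[where f = "(/)"] assms)
  then show ?thesis using False by (simp add: pslope_def)
qed

section \<open>Profiles under a change of the reaction\<close>

lemma profileI:
  assumes "\<Phi> 0 = b"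
    "\<And>y. 0 \<le> y \<Longrightarrow> b < z \<Longrightarrow> b \<le> \<Phi> y" "\<And>y. 0 \<le> y \<Longrightarrow> b < z \<Longrightarrow> \<Phi> y < z"
    "\<And>y. 0 \<le> y \<Longrightarrow> z < b \<Longrightarrow> z < \<Phi> y" "\<And>y. 0 \<le> y \<Longrightarrow> z < b \<Longrightarrow> \<Phi> y \<le> b"
    "\<And>y. 0 \<le> y \<Longrightarrow> b = z \<Longrightarrow> \<Phi> y = z"
    "\<And>y. 0 \<le> y \<Longrightarrow> (\<Phi> has_real_derivative \<Phi>1 y) (at y)" "\<And>y. 0 \<le> y \<Longrightarrow> \<Phi>1 y = pslope D g z (\<Phi> y)"
    "\<And>y. 0 \<le> y \<Longrightarrow> (\<Phi>1 has_real_derivative - g (\<Phi> y) / D) (at y)"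
  shows "profile D g z b \<Phi> \<Phi>1"
  unfolding profile_def using assms by blast

lemma profileD:
  assumes "profile D g z b \<Phi> \<Phi>1"
  shows "\<Phi> 0 = b"
    "\<And>y. 0 \<le> y \<Longrightarrow> b < z \<Longrightarrow> b \<le> \<Phi> y" "\<And>y. 0 \<le> y \<Longrightarrow> b < z \<Longrightarrow> \<Phi> y < z"
    "\<And>y. 0 \<le> y \<Longrightarrow> z < b \<Longrightarrow> z < \<Phi> y" "\<And>y. 0 \<le> y \<Longrightarrow> z < b \<Longrightarrow> \<Phi> y \<le> b"
    "\<And>y. 0 \<le> y \<Longrightarrow> b = z \<Longrightarrow> \<Phi> y = z"
    "\<And>y. 0 \<le> y \<Longrightarrow> (\<Phi> has_real_derivative \<Phi>1 y) (at y)" "\<And>y. 0 \<le> y \<Longrightarrow> \<Phi>1 y = pslope D g z (\<Phi> y)"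
    "\<And>y. 0 \<le> y \<Longrightarrow> (\<Phi>1 has_real_derivative - g (\<Phi> y) / D) (at y)"
  using assms unfolding profile_def by blast+

lemma profile_range:
  assumes "profile D g z b \<Phi> \<Phi>1" "0 \<le> y"
  shows "min b z \<le> \<Phi> y" "\<Phi> y \<le> max b z"
  using profileD(2-6)[OF assms(1,2)] by (cases b z rule: linorder_cases; simp)+

lemma profile_cong:
  assumes P: "profile D g z b \<Phi> \<Phi>1" and eq: "\<And>s. min b z \<le> s \<Longrightarrow> s \<le> max b z \<Longrightarrow> g s = g' s"
  shows "profile D g' z b \<Phi> \<Phi>1"
proof (rule profileI)
  fix y :: real assume y: "0 \<le> y"
  note r = profile_range[OF P y]
  have "pslope D g z (\<Phi> y) = pslope D g' z (\<Phi> y)"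
    using r by (intro pslope_cong eq) auto
  then show "\<Phi>1 y = pslope D g' z (\<Phi> y)" using profileD(8)[OF P y] by simp
  show "(\<Phi>1 has_real_derivative - g' (\<Phi> y) / D) (at y)" using profileD(9)[OF P y] eq[OF r] by simp
qed (use profileD(1-7)[OF P] in blast)+

lemma pslope_uminus: "pslope D (\<lambda>s. - g (- s)) (- z) (- a) = - pslope D g z a"
  unfolding pslope_def by (cases a z rule: linorder_cases) (auto simp: algebra_simps)

lemma profile_uminus:
  assumes P: "profile D g z b \<Phi> \<Phi>1"
  shows "profile D (\<lambda>s. - g (- s)) (- z) (- b) (\<lambda>y. - \<Phi> y) (\<lambda>y. - \<Phi>1 y)"
proof (rule profileI)
  fix y :: real assume y: "0 \<le> y"
  show "((\<lambda>y. - \<Phi> y) has_real_derivative - \<Phi>1 y) (at y)" by (rule DERIV_minus[OF profileD(7)[OF P y]])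
  show "- \<Phi>1 y = pslope D (\<lambda>s. - g (- s)) (- z) (- \<Phi> y)" unfolding pslope_uminus using profileD(8)[OF P y] by simp
  show "((\<lambda>y. - \<Phi>1 y) has_real_derivative - (- g (- (- \<Phi> y))) / D) (at y)" using DERIV_minus[OF profileD(9)[OF P y]] by simp
qed (use profileD(1-6)[OF P] in auto)

lemma lip_uminus:
  assumes "lip L g"
  shows "lip L (\<lambda>s. - g (- s))"
proof -
  have "\<bar>- g (- a) - - g (- b)\<bar> \<le> L * \<bar>a - b\<bar>" for a b
    using lipD[OF assms, of "- b" "- a"] by simp
  then show ?thesis using lip_pos[OF assms] by (simp add: lip_def)
qed

lemma kpp_sign_uminus: "kpp_sign z g \<Longrightarrow> kpp_sign (- z) (\<lambda>s. - g (- s))"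
  unfolding kpp_sign_def by (auto simp: minus_less_iff less_minus_iff)

lemma pslope_sign:
  assumes "0 < D" "lip L g" "kpp_sign z g"
  shows "a \<le> z \<Longrightarrow> 0 \<le> pslope D g z a" "z \<le> a \<Longrightarrow> pslope D g z a \<le> 0"
    "0 \<le> pslope D g z a \<Longrightarrow> a \<le> z" "pslope D g z a \<le> 0 \<Longrightarrow> z \<le> a"
proof -
  have z: "pslope D g z z = 0" by (simp add: pslope_def)
  note m = pslope_strict_antimono[OF assms]
  show "a \<le> z \<Longrightarrow> 0 \<le> pslope D g z a" using m[of a z] z by (cases "a = z") auto
  show "z \<le> a \<Longrightarrow> pslope D g z a \<le> 0" using m[of z a] z by (cases "a = z") auto
  show "0 \<le> pslope D g z a \<Longrightarrow> a \<le> z" using m[of z a] z by fastforce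
  show "pslope D g z a \<le> 0 \<Longrightarrow> z \<le> a" using m[of a z] z by fastforce
qed

text \<open>The first flux equation determines \<open>b = B a\<close>; the second becomes
  \<open>E a = 0\<close>. At \<open>z1\<close> and at \<open>a1\<close>, the value balancing
  \<open>z2\<close>, the function \<open>E\<close> has opposite signs. The bounds on
  \<open>a\<close> and \<open>b\<close> involve only the zeros and the exchange rates, so a
  truncation can be fixed before the values are known.\<close>

lemma interface_values_exist:
  assumes pos: "0 < D" "0 < d" "0 < \<mu>" "0 < \<nu>"
    and g: "lip L g" "kpp_sign z1 g" and f: "lip L f" "kpp_sign z2 f"
  shows "\<exists>a b. - D * pslope D g z1 a = \<nu> * b - \<mu> * a \<and> - d * pslope d f z2 b = \<mu> * a - \<nu> * b \<and>
     min z1 (\<nu> * z2 / \<mu>) \<le> a \<and> a \<le> max z1 (\<nu> * z2 / \<mu>) \<and> min z2 (\<mu> * z1 / \<nu>) \<le> b \<and> b \<le> max z2 (\<mu> * z1 / \<nu>)"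
proof -
  define p where "p = (\<lambda>a. D * pslope D g z1 a)"
  define q where "q = (\<lambda>b. d * pslope d f z2 b)"
  define B where "B = (\<lambda>a. (\<mu> * a - p a) / \<nu>)"
  define E where "E = (\<lambda>a. p a + q (B a))"
  define a1 where "a1 = \<nu> * z2 / \<mu>"
  have cp: "continuous_on {x..y} p" "continuous_on {x..y} q" for x y
    unfolding p_def q_def by (intro continuous_intros pslope_continuous[OF pos(1) g] pslope_continuous[OF pos(2) f])+
  have cE: "continuous_on {x..y} E" for x y
  proof -
    have cB: "continuous_on {x..y} B" unfolding B_def using pos by (intro continuous_intros cp) auto
    then have "bounded (B ` {x..y})" by (intro compact_imp_bounded compact_continuous_image) auto
    then obtain M where M: "\<And>r. r \<in> B ` {x..y} \<Longrightarrow> \<bar>r\<bar> \<le> M"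
      unfolding bounded_iff real_norm_def by blast
    have "B ` {x..y} \<subseteq> {-M..M}"
    proof
      fix r assume "r \<in> B ` {x..y}"
      from M[OF this] show "r \<in> {-M..M}" by (auto simp: abs_le_iff)
    qed
    then show ?thesis unfolding E_def
      by (intro continuous_intros cp continuous_on_compose2[OF cp(2)[of "- M" M] cB])
  qed
  note ps = pslope_sign[OF pos(1) g] and qs = pslope_sign[OF pos(2) f]
  have p: "a \<le> z1 \<Longrightarrow> 0 \<le> p a" "z1 \<le> a \<Longrightarrow> p a \<le> 0" for a
    using ps(1,2)[of a] pos by (auto simp: p_def mult_nonneg_nonpos)
  have q: "b \<le> z2 \<Longrightarrow> 0 \<le> q b" "z2 \<le> b \<Longrightarrow> q b \<le> 0" "0 \<le> q b \<Longrightarrow> b \<le> z2" "q b \<le> 0 \<Longrightarrow> z2 \<le> b" for b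
  proof -
    have "0 \<le> q b \<longleftrightarrow> 0 \<le> pslope d f z2 b" "q b \<le> 0 \<longleftrightarrow> pslope d f z2 b \<le> 0"
      using pos(2) by (auto simp: q_def zero_le_mult_iff mult_le_0_iff)
    then show "b \<le> z2 \<Longrightarrow> 0 \<le> q b" "z2 \<le> b \<Longrightarrow> q b \<le> 0" "0 \<le> q b \<Longrightarrow> b \<le> z2" "q b \<le> 0 \<Longrightarrow> z2 \<le> b"
      using qs[of b] by blast+
  qed
  have pz: "p z1 = 0" by (simp add: p_def pslope_def)
  have B1: "B z1 = \<mu> * z1 / \<nu>" by (simp add: B_def pz)
  have "\<mu> * a1 = \<nu> * z2" using pos by (simp add: a1_def)
  then have B2: "B a1 = z2 - p a1 / \<nu>" using pos by (simp add: B_def diff_divide_distrib)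
  have Bnu: "\<nu> * B a = \<mu> * a - p a" for a using pos by (simp add: B_def)
  have fin: ?thesis if "E a = 0" "min z1 a1 \<le> a" "a \<le> max z1 a1" "min z2 (\<mu> * z1 / \<nu>) \<le> B a" "B a \<le> max z2
      (\<mu> * z1 / \<nu>)" for a
    using that Bnu[of a] unfolding E_def p_def q_def a1_def by (intro exI[of _ a] exI[of _ "B a"]) auto
  show ?thesis
  proof (cases "z1 \<le> a1")
    case True
    have "\<mu> * z1 / \<nu> \<le> z2" using True pos by (simp add: a1_def field_simps)
    then have "0 \<le> E z1" using q(1) B1 by (simp add: E_def pz)
    moreover have "E a1 \<le> 0"
    proof -
      have pa: "p a1 \<le> 0" using p(2) True .
      then have "p a1 / \<nu> \<le> 0" using pos by (simp add: divide_le_0_iff)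
      then have "z2 \<le> B a1" using B2 by simp
      then show ?thesis using q(2) pa by (simp add: E_def add_nonpos_nonpos)
    qed
    ultimately obtain a where a: "z1 \<le> a" "a \<le> a1" "E a = 0" using IVT2'[OF _ _ True cE] by blast
    have pa: "p a \<le> 0" using p(2) a(1) .
    then have "0 \<le> q (B a)" using a(3) by (simp add: E_def)
    then have b2: "B a \<le> z2" by (rule q(3))
    have "\<mu> * z1 \<le> \<mu> * a" using a(1) pos by simp
    then have "\<mu> * z1 / \<nu> \<le> B a" unfolding B_def using pa pos(4) by (intro divide_right_mono; linarith)
    then show ?thesis using a b2 True by (intro fin[of a]) auto
  next
    case False
    then have F: "a1 \<le> z1" by simp
    have "z2 \<le> \<mu> * z1 / \<nu>" using F pos by (simp add: a1_def field_simps)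
    then have "E z1 \<le> 0" using q(2) B1 by (simp add: E_def pz)
    moreover have "0 \<le> E a1"
    proof -
      have pa: "0 \<le> p a1" using p(1) F .
      then have "0 \<le> p a1 / \<nu>" using pos by simp
      then have "B a1 \<le> z2" using B2 by simp
      then show ?thesis using q(1) pa by (simp add: E_def)
    qed
    ultimately obtain a where a: "a1 \<le> a" "a \<le> z1" "E a = 0" using IVT2'[OF _ _ F cE] by blast
    have pa: "0 \<le> p a" using p(1) a(2) .
    then have "q (B a) \<le> 0" using a(3) by (simp add: E_def)
    then have b2: "z2 \<le> B a" by (rule q(4))
    have "\<mu> * a \<le> \<mu> * z1" using a(2) pos by simp
    then have "B a \<le> \<mu> * z1 / \<nu>" unfolding B_def using pa pos(4) by (intro divide_right_mono; linarith)
    then show ?thesis using a b2 F by (intro fin[of a]) auto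
  qed
qed

section \<open>Convergence\<close>

lemma KPP_g_imp_KPP_f: "KPP_g g \<Longrightarrow> KPP_f g 1"
  by (simp add: KPP_g_def KPP_f_def)

text \<open>The inequality \<open>0 < g s \<le> deriv g 0 * s\<close> forces a positive derivative
  at 0; this linear instability drives the hair-trigger effect.\<close>

lemma KPP_linear_lower_bound:
  assumes "KPP_f g z"
  shows "\<exists>m>0. \<exists>s0>0. \<forall>r. 0 \<le> r \<longrightarrow> r \<le> s0 \<longrightarrow> m * r \<le> g r"
proof -
  have z: "0 < z" "g 0 = 0" "g differentiable (at 0)"
    using assms by (auto simp: KPP_f_def)
  have mid: "0 < g s" "g s \<le> deriv g 0 * s" if "0 < s" "s < z" for s
    using assms that by (auto simp: KPP_f_def)
  define c where "c = deriv g 0"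
  have "0 < c * (z / 2)" using mid[of "z / 2"] z(1) unfolding c_def by linarith
  then have "0 < c" using z(1) by (simp add: zero_less_mult_iff)
  have "(g has_real_derivative c) (at 0)" using z(3) by (simp add: c_def DERIV_deriv_iff_real_differentiable)
  then have "((\<lambda>h. g h / h) \<longlongrightarrow> c) (at 0)" using z(2) by (simp add: DERIV_def)
  then have "\<forall>\<^sub>F h in at 0. c / 2 < g h / h" using \<open>0 < c\<close> by (intro order_tendstoD(1)) auto
  then obtain d where d: "0 < d" "\<And>h. h \<noteq> 0 \<Longrightarrow> \<bar>h\<bar> < d \<Longrightarrow> c / 2 < g h / h"
    unfolding eventually_at by (auto simp: dist_real_def)
  have "c / 2 * r \<le> g r" if "0 \<le> r" "r \<le> d / 2" for r
  proof (cases "r = 0")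
    case False
    then have "c / 2 < g r / r" using that d(1) by (intro d(2)) auto
    then show ?thesis using that False by (simp add: field_simps)
  qed (use z in simp)
  then show ?thesis using \<open>0 < c\<close> \<open>0 < d\<close> by (intro exI[of _ "c / 2"] conjI exI[of _ "d / 2"]) auto
qed

lemma loc_lipschitz_linear_bound:
  assumes "loc_lipschitz g" "g 0 = 0"
  shows "\<exists>L\<ge>0. \<forall>r. \<bar>r\<bar> \<le> B \<longrightarrow> \<bar>g r\<bar> \<le> L * \<bar>r\<bar>"
proof -
  obtain L where L: "L-lipschitz_on {-B..B} g" using assms(1) unfolding loc_lipschitz_def by blast
  have "\<bar>g r\<bar> \<le> L * \<bar>r\<bar>" if "\<bar>r\<bar> \<le> B" for r
    using lipschitz_onD[OF L, of r 0] that assms(2) by (simp add: dist_real_def abs_le_iff)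
  then show ?thesis using lipschitz_on_nonneg[OF L] by blast
qed

lemma KPP_nonneg:
  assumes "KPP_f g z" "0 \<le> r" "r \<le> z"
  shows "0 \<le> g r"
  using assms unfolding KPP_f_def by (cases "r = 0"; cases "r = z") (auto intro: less_imp_le)

lemma KPP_nonpos: "KPP_f g z \<Longrightarrow> z \<le> r \<Longrightarrow> g r \<le> 0"
  unfolding KPP_f_def by (cases "r = z") (auto intro: less_imp_le)

lemma lower_unif_mono: "lower_unif k w \<kappa> \<Longrightarrow> \<kappa>' \<le> \<kappa> \<Longrightarrow> lower_unif k w \<kappa>'"
  unfolding lower_unif_def by (meson order_trans)

lemma evpde_of_pde:
  assumes pde: "pde k D g w" and eq: "\<And>R. \<exists>T. \<forall>x t. 0 < x $ k \<longrightarrow> norm x \<le> R \<longrightarrow> T \<le> t \<longrightarrow> g (w x t) = g' (w x t)"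
  shows "evpde k D g' w"
  unfolding evpde_def
proof
  fix R
  obtain T where T: "\<And>x t. 0 < x $ k \<Longrightarrow> norm x \<le> R \<Longrightarrow> T \<le> t \<Longrightarrow> g (w x t) = g' (w x t)" using eq by blast
  have "\<exists>a b. jet w x t a b \<and> a - D * sum b UNIV = g' (w x t)" if "0 < x $ k" "norm x \<le> R" "max 1 T \<le> t" for x t
    using pde T[of x t] that unfolding pde_def by (metis dual_order.strict_trans1 max.bounded_iff zero_less_one)
  then show "\<exists>T. \<forall>x t. 0 < x $ k \<longrightarrow> norm x \<le> R \<longrightarrow> T \<le> t \<longrightarrow> (\<exists>a b. jet w x t a b \<and> a - D * sum b UNIV = g' (w x t))"
    by blast
qed

text \<open>Stated for a datum that is nontrivial in \<open>u\<close>: positivity spreads inside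
  that half-space, then down to the interface, then across it. The other case is the same with the
  roles exchanged.\<close>

lemma eventual_lower_bound:
  fixes u v :: "real^'n::finite \<Rightarrow> real \<Rightarrow> real"
  assumes pos: "0 < D" "0 < d" "0 < \<mu>" "0 < \<nu>" and kpp: "KPP_f g z1" "KPP_f f z2"
    and pde: "pde k D g u" "pde k d f v" and flux: "flux k D \<mu> \<nu> u v" "flux k d \<nu> \<mu> v u"
    and cont: "half_cont k u" "half_cont k v" "init_cont k u"
    and init: "\<And>x. 0 < x $ k \<Longrightarrow> 0 \<le> u x 0"
    and bd: "\<And>x t. 0 \<le> x $ k \<Longrightarrow> 0 < t \<Longrightarrow> 0 \<le> u x t \<and> u x t \<le> C" "\<And>x t. 0 \<le> x $ k \<Longrightarrow> 0 < t \<Longrightarrow> 0 \<le> v x t \<and> v x t \<le> C"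
    and C: "z1 \<le> C" "z2 \<le> C" and x0: "0 < x0 $ k" "0 < u x0 0"
  shows "\<exists>\<kappa>>0. lower_unif k u \<kappa> \<and> lower_unif k v \<kappa>"
proof -
  have z: "0 < z1" "0 < z2" "loc_lipschitz g" "g 0 = 0" using kpp by (auto simp: KPP_f_def)
  obtain L where L: "0 \<le> L" "\<And>r. \<bar>r\<bar> \<le> C \<Longrightarrow> \<bar>g r\<bar> \<le> L * \<bar>r\<bar>"
    using loc_lipschitz_linear_bound[OF z(3,4)] by metis
  obtain m s0 where ms: "0 < m" "0 < s0" "\<And>r. 0 \<le> r \<Longrightarrow> r \<le> s0 \<Longrightarrow> m * r \<le> g r"
    using KPP_linear_lower_bound[OF kpp(1)] by blast
  have nn: "0 \<le> u x t" if "0 < x $ k" "0 \<le> t" for x t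
    using init[of x] bd(1)[of x t] that by (cases "t = 0") auto
  have gL: "- L * r \<le> g r" if "0 \<le> r" "r \<le> C" for r using L(2)[of r] that by (simp add: abs_le_iff)
  have "0 < C" using z C by linarith
  have "\<exists>Y0>0. \<exists>\<kappa>>0. \<forall>R. \<exists>T. \<forall>x t. Y0 \<le> x $ k \<longrightarrow> norm x \<le> R \<longrightarrow> T \<le> t \<longrightarrow> \<kappa> \<le> u x t"
    by (rule hair_trigger[OF pos(1) pde(1) cont(3) nn gL \<open>0 < C\<close> L(1) ms(3,1,2) x0])
  then obtain Y0 \<kappa>0 where
    Y0: "0 < Y0" "0 < \<kappa>0" "\<And>R. \<exists>T. \<forall>x t. Y0 \<le> x $ k \<longrightarrow> norm x \<le> R \<longrightarrow> T \<le> t \<longrightarrow> \<kappa>0 \<le> u x t" by blast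
  \<comment> \<open>Clamping at 0 makes the reactions nonnegative at all arguments up to their
    zeros, negative ones included, as the affine barriers require.\<close>
  have ev: "evpde k D (\<lambda>s. g (clamp1 0 C s)) u" "evpde k d (\<lambda>s. f (clamp1 0 C s)) v"
    by (rule evpde_of_pde[OF pde(1)] evpde_of_pde[OF pde(2)], rule exI[of _ 1], use bd in \<open>auto simp: clamp1_id\<close>)+
  have n: "0 \<le> g (clamp1 0 C r)" if "r \<le> z1" for r
    using z C that by (intro KPP_nonneg[OF kpp(1)]) (auto simp: clamp1_def)
  have n2: "0 \<le> f (clamp1 0 C r)" if "r \<le> z2" for r
    using z C that by (intro KPP_nonneg[OF kpp(2)]) (auto simp: clamp1_def)
  obtain \<kappa>1 where \<kappa>1: "0 < \<kappa>1" "lower_unif k u \<kappa>1"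
    using lower_unif_near_interface[OF pos(1,3,4) z(1) cont(1) ev(1) flux(1) _ _ n Y0] bd by blast
  obtain \<kappa>2 where \<kappa>2: "0 < \<kappa>2" "lower_unif k v \<kappa>2"
    using lower_unif_across_interface[OF pos(2,3,4) z(2) \<kappa>1(1) cont(2) ev(2) flux(2) _ n2 \<kappa>1(2)] bd by blast
  show ?thesis
    using \<kappa>1 \<kappa>2 by (intro exI[of _ "min \<kappa>1 \<kappa>2"]) (auto elim: lower_unif_mono)
qed

text \<open>The global upper bound for \<open>(-u, -v)\<close> with \<open>A = 0\<close>; the local
  Lipschitz property at 0 gives the required linear bound of the reactions.\<close>

lemma solution_nonneg:
  fixes u v :: "real^'n::finite \<Rightarrow> real \<Rightarrow> real"
  assumes pos: "0 < D" "0 < d" "0 < \<mu>" "0 < \<nu>" and kpp: "KPP_f g z1" "KPP_f f z2"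
    and pde: "pde k D g u" "pde k d f v" and flux: "flux k D \<mu> \<nu> u v" "flux k d \<nu> \<mu> v u"
    and cont: "half_cont k u" "half_cont k v" "init_cont k u" "init_cont k v"
    and init: "\<And>x. 0 < x $ k \<Longrightarrow> 0 \<le> u x 0" "\<And>x. 0 < x $ k \<Longrightarrow> 0 \<le> v x 0"
    and bd: "\<And>x t. 0 \<le> x $ k \<Longrightarrow> 0 < t \<Longrightarrow> t \<le> T \<Longrightarrow> \<bar>u x t\<bar> \<le> B" "\<And>x t. 0 \<le> x $ k \<Longrightarrow> 0 < t \<Longrightarrow> t \<le> T \<Longrightarrow> \<bar>v x t\<bar> \<le> B"
    and x: "0 \<le> x $ k" "0 < t" "t \<le> T"
  shows "0 \<le> u x t"
proof -
  have z: "loc_lipschitz g" "g 0 = 0" "loc_lipschitz f" "f 0 = 0" using kpp by (auto simp: KPP_f_def)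
  obtain L1 where L1: "0 \<le> L1" "\<And>r. \<bar>r\<bar> \<le> B \<Longrightarrow> \<bar>g r\<bar> \<le> L1 * \<bar>r\<bar>"
    using loc_lipschitz_linear_bound[OF z(1,2)] by metis
  obtain L2 where L2: "0 \<le> L2" "\<And>r. \<bar>r\<bar> \<le> B \<Longrightarrow> \<bar>f r\<bar> \<le> L2 * \<bar>r\<bar>"
    using loc_lipschitz_linear_bound[OF z(3,4)] by metis
  define K where "K = max L1 L2"
  have K: "- g (- r) \<le> K * r" "- f (- r) \<le> K * r" if "0 \<le> r" "r \<le> B" for r
  proof -
    have "L1 * r \<le> K * r" "L2 * r \<le> K * r" using that by (auto simp: K_def intro: mult_right_mono)
    then show "- g (- r) \<le> K * r" "- f (- r) \<le> K * r" using L1(2)[of "- r"] L2(2)[of "- r"] that by (auto simp: abs_le_iff)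
  qed
  have b: "- u x t \<le> B" "- v x t \<le> B" if "0 \<le> x $ k" "0 < t" "t \<le> T" for x t
    using bd(1)[OF that] bd(2)[OF that] by auto
  have "- u x t \<le> \<nu> * 0"
    by (rule global_upper[OF pos, where u = "\<lambda>x t. - u x t" and v = "\<lambda>x t. - v x t" and g = "\<lambda>s. - g (- s)" and f =
        "\<lambda>s. - f (- s)" and K = K and C = B and T = T and A = 0])
      (use K b x L1(1) init in \<open>auto simp: K_def intro: pde_uminus[OF pde(1)] pde_uminus[OF pde(2)]
          flux_uminus[OF flux(1)] flux_uminus[OF flux(2)]
        half_cont_uminus[OF cont(1)] half_cont_uminus[OF cont(2)] init_cont_uminus[OF cont(3)] init_cont_uminus[OF cont(4)]\<close>)
  then show ?thesis by simp
qed

text \<open>Two truncations occur: \<kappa>0 and \<open>C0\<close> belong to the steady state and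
  must not depend on the solution, \<kappa>1 and \<open>C1\<close> are fitted to the solution. They
  share their profiles because both agree with the reaction between the interface values and the
  zeros.\<close>

lemma mirrored_convergence:
  fixes u v :: "real^'n::finite \<Rightarrow> real \<Rightarrow> real"
  assumes pos: "0 < D" "0 < d" "0 < \<mu>" "0 < \<nu>" and kpp: "KPP_f g z1" "KPP_f f z2"
    and pde: "pde k D g u" "pde k d f v" and flux: "flux k D \<mu> \<nu> u v" "flux k d \<nu> \<mu> v u"
    and cont: "half_cont k u" "half_cont k v" "init_cont k u" "init_cont k v"
    and init: "\<And>x. 0 < x $ k \<Longrightarrow> 0 \<le> u x 0 \<and> u x 0 \<le> U0" "\<And>x. 0 < x $ k \<Longrightarrow> 0 \<le> v x 0 \<and> v x 0 \<le> U0"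
    and bd: "\<And>T. \<exists>B. \<forall>x t. 0 \<le> x $ k \<longrightarrow> 0 < t \<longrightarrow> t \<le> T \<longrightarrow> \<bar>u x t\<bar> \<le> B \<and> \<bar>v x t\<bar> \<le> B"
    and x0: "0 < x0 $ k" "0 < u x0 0 \<or> 0 < v x0 0"
    and \<kappa>0: "0 < \<kappa>0" "\<kappa>0 < z1" "\<kappa>0 < z2" "\<kappa>0 < a" "\<kappa>0 < b" and C0: "z1 < C0" "z2 < C0" "a < C0" "b < C0"
    and steady: "- D * pslope D (\<lambda>s. g (clamp1 \<kappa>0 C0 s)) z1 a = \<nu> * b - \<mu> * a" "- d * pslope d
        (\<lambda>s. f (clamp1 \<kappa>0 C0 s)) z2 b = \<mu> * a - \<nu> * b"
    and P: "profile D (\<lambda>s. g (clamp1 \<kappa>0 C0 s)) z1 a \<Phi> \<Phi>1" "profile d (\<lambda>s. f (clamp1 \<kappa>0 C0 s)) z2 b \<Psi> \<Psi>1"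
    and "0 < \<epsilon>"
  shows "\<exists>T. \<forall>x t. 0 \<le> x $ k \<longrightarrow> norm x \<le> R \<longrightarrow> T \<le> t \<longrightarrow> \<bar>u x t - \<Phi> (x $ k)\<bar> \<le> \<epsilon> \<and> \<bar>v x t - \<Psi> (x $ k)\<bar> \<le> \<epsilon>"
proof -
  have z: "0 < z1" "0 < z2" "loc_lipschitz g" "loc_lipschitz f" using kpp by (auto simp: KPP_f_def)
  have uv0: "0 \<le> u x t" "0 \<le> v x t" if "0 \<le> x $ k" "0 < t" for x t
  proof -
    obtain B where B: "\<And>x s. 0 \<le> x $ k \<Longrightarrow> 0 < s \<Longrightarrow> s \<le> t \<Longrightarrow> \<bar>u x s\<bar> \<le> B" "\<And>x s. 0 \<le> x $ k \<Longrightarrow> 0 < s \<Longrightarrow> s \<le> t \<Longrightarrow> \<bar>v x s\<bar> \<le> B"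
      using bd by metis
    show "0 \<le> u x t" using init
      by (intro solution_nonneg[OF pos kpp pde flux cont _ _ B that order_refl]) auto
    show "0 \<le> v x t" using init
      by (intro solution_nonneg[OF pos(2,1,4,3) kpp(2,1) pde(2,1) flux(2,1) cont(2,1,4,3) _ _ B(2,1) that order_refl]) auto
  qed
  \<comment> \<open>The constant pair \<open>\<nu> * A\<close>, \<open>\<mu> * A\<close> balances
    the flux and lies above the data and above both zeros, so the reactions are nonpositive there
    and \<open>K = 0\<close> is allowed.\<close>
  define A where "A = max (max (z1 / \<nu>) (z2 / \<mu>)) (max (U0 / \<nu>) (U0 / \<mu>))"
  have "z1 / \<nu> \<le> A" "z2 / \<mu> \<le> A" "U0 / \<nu> \<le> A" "U0 / \<mu> \<le> A" by (auto simp: A_def)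
  then have A: "z1 \<le> \<nu> * A" "z2 \<le> \<mu> * A" "U0 \<le> \<nu> * A" "U0 \<le> \<mu> * A"
    using pos by (simp_all add: pos_divide_le_eq mult.commute)
  have up: "u x t \<le> \<nu> * A" "v x t \<le> \<mu> * A" if xt: "0 \<le> x $ k" "0 < t" for x t
  proof -
    obtain B where B: "\<And>x s. 0 \<le> x $ k \<Longrightarrow> 0 < s \<Longrightarrow> s \<le> t \<Longrightarrow> \<bar>u x s\<bar> \<le> B \<and> \<bar>v x s\<bar> \<le> B"
      using bd by metis
    have B': "u x s \<le> B" "v x s \<le> B" if "0 \<le> x $ k" "0 < s" "s \<le> t" for x s using B[OF that] by auto
    have i: "u x 0 \<le> \<nu> * A" "v x 0 \<le> \<mu> * A" if "0 < x $ k" for x using init(1)[OF that] init(2)[OF that] A by auto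
    have gf: "\<nu> * A \<le> r \<Longrightarrow> r \<le> B \<Longrightarrow> g r \<le> 0 * (r - \<nu> * A)" "\<mu> * A \<le> r \<Longrightarrow> r \<le> B \<Longrightarrow> f r \<le> 0 * (r - \<mu> * A)" for r
      using KPP_nonpos[OF kpp(1), of r] KPP_nonpos[OF kpp(2), of r] A by auto
    show "u x t \<le> \<nu> * A"
      by (rule global_upper[OF pos order_refl pde flux cont i B' gf xt order_refl])
    show "v x t \<le> \<mu> * A"
      by (rule global_upper[OF pos(2,1,4,3) order_refl pde(2,1) flux(2,1) cont(2,1,4,3) i(2,1) B'(2,1) gf(2,1) xt
          order_refl])
  qed
  define C where "C = max (\<nu> * A) (\<mu> * A)"
  have C: "z1 \<le> C" "z2 \<le> C" using A by (auto simp: C_def)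
  have b1: "0 \<le> u x t \<and> u x t \<le> C" "0 \<le> v x t \<and> v x t \<le> C" if "0 \<le> x $ k" "0 < t" for x t
    using uv0[OF that] up[OF that] by (auto simp: C_def)
  have "\<exists>\<kappa>>0. lower_unif k u \<kappa> \<and> lower_unif k v \<kappa>"
    using x0(2)
  proof
    assume "0 < u x0 0"
    then show ?thesis
      using init by (intro eventual_lower_bound[OF pos kpp pde flux cont(1,2,3) _ b1 C x0(1)]) auto
  next
    assume "0 < v x0 0"
    then have "\<exists>\<kappa>>0. lower_unif k v \<kappa> \<and> lower_unif k u \<kappa>"
      using init by (intro eventual_lower_bound[OF pos(2,1,4,3) kpp(2,1) pde(2,1) flux(2,1) cont(2,1,4) _ b1(2,1)
          C(2,1) x0(1)]) auto
    then show ?thesis by blast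
  qed
  then obtain \<kappa> where \<kappa>: "0 < \<kappa>" "lower_unif k u \<kappa>" "lower_unif k v \<kappa>" by blast
  define \<kappa>1 where "\<kappa>1 = min \<kappa> \<kappa>0"
  define C1 where "C1 = max C C0"
  define g1 where "g1 = (\<lambda>s. g (clamp1 \<kappa>1 C1 s))"
  define f1 where "f1 = (\<lambda>s. f (clamp1 \<kappa>1 C1 s))"
  have k1: "0 < \<kappa>1" "\<kappa>1 \<le> \<kappa>0" "\<kappa>1 \<le> \<kappa>" "C0 \<le> C1" "C \<le> C1" using \<kappa>(1) \<kappa>0(1) by (auto simp: \<kappa>1_def C1_def)
  have s1: "kpp_sign z1 g1" "kpp_sign z2 f1"
    unfolding g1_def f1_def using k1 \<kappa>0 C0 by (auto intro!: kpp_sign_clamp kpp)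
  have "\<kappa>1 \<le> C1" using k1 \<kappa>0 C0 by linarith
  then obtain L1 L2 where "\<And>L. L1 \<le> L \<Longrightarrow> lip L g1" "\<And>L. L2 \<le> L \<Longrightarrow> lip L f1"
    unfolding g1_def f1_def using lip_clamp[OF z(3)] lip_clamp[OF z(4)] by meson
  then have l1: "lip (max L1 L2) g1" "lip (max L1 L2) f1" by auto
  have cl: "w x t = clamp1 \<kappa>1 C1 (w x t)" if "\<kappa> \<le> w x t" "w x t \<le> C" for w and x :: "real^'n" and t :: real
    using that k1 by (simp add: clamp1_id)
  have ev: "evpde k D g1 u" "evpde k d f1 v"
  proof -
    show "evpde k D g1 u"
    proof (rule evpde_of_pde[OF pde(1)])
      fix R
      obtain T where T: "\<And>x t. 0 \<le> x $ k \<Longrightarrow> norm x \<le> R \<Longrightarrow> T \<le> t \<Longrightarrow> \<kappa> \<le> u x t" using \<kappa>(2) unfolding lower_unif_def by blast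
      show "\<exists>T. \<forall>x t. 0 < x $ k \<longrightarrow> norm x \<le> R \<longrightarrow> T \<le> t \<longrightarrow> g (u x t) = g1 (u x t)"
      proof (intro exI[of _ "max 1 T"] allI impI)
        fix x :: "real^'n" and t assume "0 < x $ k" "norm x \<le> R" "max 1 T \<le> t"
        then show "g (u x t) = g1 (u x t)" unfolding g1_def using cl[of u x t] T[of x t] b1(1)[of x t] by simp
      qed
    qed
    show "evpde k d f1 v"
    proof (rule evpde_of_pde[OF pde(2)])
      fix R
      obtain T where T: "\<And>x t. 0 \<le> x $ k \<Longrightarrow> norm x \<le> R \<Longrightarrow> T \<le> t \<Longrightarrow> \<kappa> \<le> v x t" using \<kappa>(3) unfolding lower_unif_def by blast
      show "\<exists>T. \<forall>x t. 0 < x $ k \<longrightarrow> norm x \<le> R \<longrightarrow> T \<le> t \<longrightarrow> f (v x t) = f1 (v x t)"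
      proof (intro exI[of _ "max 1 T"] allI impI)
        fix x :: "real^'n" and t assume "0 < x $ k" "norm x \<le> R" "max 1 T \<le> t"
        then show "f (v x t) = f1 (v x t)" unfolding f1_def using cl[of v x t] T[of x t] b1(2)[of x t] by simp
      qed
    qed
  qed
  have same: "g (clamp1 \<kappa>0 C0 s) = g1 s" "f (clamp1 \<kappa>0 C0 s) = f1 s" if "\<kappa>0 \<le> s" "s \<le> C0" for s
    using that k1 by (simp_all add: g1_def f1_def clamp1_id)
  have sg: "g (clamp1 \<kappa>0 C0 s) = g1 s" if "min a z1 \<le> s" "s \<le> max a z1" for s
    using that \<kappa>0 C0 by (intro same) auto
  have sf: "f (clamp1 \<kappa>0 C0 s) = f1 s" if "min b z2 \<le> s" "s \<le> max b z2" for s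
    using that \<kappa>0 C0 by (intro same) auto
  have P1: "profile D g1 z1 a \<Phi> \<Phi>1" by (rule profile_cong[OF P(1) sg])
  have P2: "profile d f1 z2 b \<Psi> \<Psi>1" by (rule profile_cong[OF P(2) sf])
  have st: "- D * pslope D g1 z1 a = \<nu> * b - \<mu> * a" "- d * pslope d f1 z2 b = \<mu> * a - \<nu> * b"
  proof -
    have "pslope D (\<lambda>s. g (clamp1 \<kappa>0 C0 s)) z1 a = pslope D g1 z1 a" by (rule pslope_cong, rule sg)
    then show "- D * pslope D g1 z1 a = \<nu> * b - \<mu> * a" using steady(1) by simp
    have "pslope d (\<lambda>s. f (clamp1 \<kappa>0 C0 s)) z2 b = pslope d f1 z2 b" by (rule pslope_cong, rule sf)
    then show "- d * pslope d f1 z2 b = \<mu> * a - \<nu> * b" using steady(2) by simp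
  qed
  have hb: "half_bounded k u C" "half_bounded k v C" unfolding half_bounded_def using b1 by auto
  have hb': "half_bounded k (\<lambda>x t. - u x t) C" "half_bounded k (\<lambda>x t. - v x t) C" using hb unfolding half_bounded_def by auto
  have st': "- D * pslope D (\<lambda>s. - g1 (- s)) (- z1) (- a) = \<nu> * - b - \<mu> * - a" "- d * pslope d (\<lambda>s. - f1 (- s)) (- z2)
      (- b) = \<mu> * - a - \<nu> * - b"
    unfolding pslope_uminus using st by auto
  note U = coupled_upper[OF pos \<open>0 < \<epsilon>\<close> cont(1) ev(1) flux(1) cont(2) ev(2) flux(2) hb l1(1) s1(1) l1(2) s1(2) st P1
      P2, of R]
  note V = coupled_upper[OF pos \<open>0 < \<epsilon>\<close> half_cont_uminus[OF cont(1)] evpde_uminus[OF ev(1)] flux_uminus[OF flux(1)]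
      half_cont_uminus[OF cont(2)] evpde_uminus[OF ev(2)] flux_uminus[OF flux(2)] hb'
      lip_uminus[OF l1(1)] kpp_sign_uminus[OF s1(1)] lip_uminus[OF l1(2)] kpp_sign_uminus[OF s1(2)] st'
          profile_uminus[OF P1] profile_uminus[OF P2], of R]
  obtain T1 where T1: "\<And>x t. 0 \<le> x $ k \<Longrightarrow> norm x \<le> R \<Longrightarrow> T1 \<le> t \<Longrightarrow> u x t \<le> \<Phi> (x $ k) + \<epsilon>" using U(1) by blast
  obtain T2 where T2: "\<And>x t. 0 \<le> x $ k \<Longrightarrow> norm x \<le> R \<Longrightarrow> T2 \<le> t \<Longrightarrow> v x t \<le> \<Psi> (x $ k) + \<epsilon>" using U(2) by blast
  obtain T3 where T3: "\<And>x t. 0 \<le> x $ k \<Longrightarrow> norm x \<le> R \<Longrightarrow> T3 \<le> t \<Longrightarrow> - u x t \<le> - \<Phi> (x $ k) + \<epsilon>" using V(1) by blast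
  obtain T4 where T4: "\<And>x t. 0 \<le> x $ k \<Longrightarrow> norm x \<le> R \<Longrightarrow> T4 \<le> t \<Longrightarrow> - v x t \<le> - \<Psi> (x $ k) + \<epsilon>" using V(2) by blast
  show ?thesis
  proof (intro exI[of _ "max (max T1 T2) (max T3 T4)"] allI impI)
    fix x :: "real^'n" and t assume "0 \<le> x $ k" "norm x \<le> R" "max (max T1 T2) (max T3 T4) \<le> t"
    then show "\<bar>u x t - \<Phi> (x $ k)\<bar> \<le> \<epsilon> \<and> \<bar>v x t - \<Psi> (x $ k)\<bar> \<le> \<epsilon>"
      using T1[of x t] T2[of x t] T3[of x t] T4[of x t] by (simp add: abs_le_iff)
  qed
qed

text \<open>The profiles solve the truncated equations and stay between the interface value and the
  zero, where truncated and original reactions coincide. The reflection changes the sign of the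
  slope in the lower half-space.\<close>

lemma steady_xN_of_profiles:
  fixes k :: "'n::finite"
  assumes pos: "0 < D" "0 < d" and lip: "lip L g0" "lip L f0"
    and P: "profile D g0 z1 a \<Phi> \<Phi>1" "profile d f0 z2 b \<Psi> \<Psi>1"
    and ab: "0 < a" "0 < b" "0 < z1" "0 < z2"
    and steady: "- D * pslope D g0 z1 a = \<nu> * b - \<mu> * a" "- d * pslope d f0 z2 b = \<mu> * a - \<nu> * b"
    and g: "\<And>s. min a z1 \<le> s \<Longrightarrow> s \<le> max a z1 \<Longrightarrow> g0 s = g s" and f: "\<And>s. min b z2 \<le> s \<Longrightarrow> s \<le> max b z2 \<Longrightarrow> f0 s = f s"
  shows "steady_xN D d \<mu> \<nu> g f k (\<lambda>z. \<Phi> (- z)) \<Psi>"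
proof -
  have J: "jet (\<lambda>x t. W (x $ k)) x t 0 (\<lambda>i. if i = k then - h (W (x $ k)) / e else 0)"
    if Q: "profile e h z c W W1" and x: "0 < x $ k" for e h z c W W1 x and t :: real
  proof -
    have "jet (\<lambda>x t. W (x $ k) + (0::real) * perp k x) x t (0 + 0 * perp k x)
        (\<lambda>i. if i = k then - h (W (x $ k)) / e + 0 * perp k x else 2 * 0)"
    proof (rule jet_perp[where F = "\<lambda>y t. W y" and G = "\<lambda>y t. 0" and ?G1.0 = "\<lambda>r. 0"])
      have "\<forall>\<^sub>F r in nhds (x $ k). 0 < r" using x by (intro order_tendstoD[OF filterlim_ident])
      then show "\<forall>\<^sub>F r in nhds (x $ k). (W has_real_derivative W1 r) (at r)"
        by eventually_elim (rule profileD(7)[OF Q], simp)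
      show "(W1 has_real_derivative - h (W (x $ k)) / e) (at (x $ k))" using profileD(9)[OF Q] x by simp
    qed auto
    then show ?thesis by (simp cong: if_cong)
  qed
  have cW: "continuous_on {0..} W" if Q: "profile e h z c W W1" for e h z c W W1
    by (intro continuous_at_imp_continuous_on ballI DERIV_isCont[OF profileD(7)[OF Q]]) simp
  define u where "u = (\<lambda>x t::real. \<Phi> (- (x $ k)))"
  define v where "v = (\<lambda>x t::real. \<Psi> (x $ k))"
  have Ju: "jet u x t 0 (\<lambda>i. if i = k then - g0 (\<Phi> (- (x $ k))) / D else 0)" if "x $ k < 0" for x t
    using jet_mirror[OF J[OF P(1), of "mirror k x" t]] that by (simp add: u_def cong: if_cong)
  have Jv: "jet v x t 0 (\<lambda>i. if i = k then - f0 (\<Psi> (x $ k)) / d else 0)" if "0 < x $ k" for x t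
    unfolding v_def using J[OF P(2) that] .
  have cu: "continuous_on ({x. x $ k \<le> 0} \<times> A) (\<lambda>(x, t). u x t)" for A
    unfolding u_def case_prod_beta by (rule continuous_on_compose2[OF cW[OF P(1)]]) (auto intro!: continuous_intros)
  have cv: "continuous_on ({x. 0 \<le> x $ k} \<times> A) (\<lambda>(x, t). v x t)" for A
    unfolding v_def case_prod_beta by (rule continuous_on_compose2[OF cW[OF P(2)]]) (auto intro!: continuous_intros)
  have cB: "continuous_on ({x. x $ k < 0} \<times> {0<..}) (\<lambda>(x, t::real). if i = k then - g0 (\<Phi> (- (x $ k))) / D else 0)" for i
  proof -
    have "continuous_on ({x. x $ k < 0} \<times> {0<..}) (\<lambda>z::(real^'n) \<times> real. g0 (\<Phi> (- (fst z $ k))))"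
      by (rule continuous_on_compose2[OF lip_continuous[OF lip(1), of UNIV]], rule continuous_on_compose2[OF cW[OF P(1)]])
        (auto intro!: continuous_intros)
    then show ?thesis using pos unfolding case_prod_beta by (cases "i = k") (auto intro!: continuous_intros)
  qed
  have cB': "continuous_on ({x. 0 < x $ k} \<times> {0<..}) (\<lambda>(x, t::real). if i = k then - f0 (\<Psi> (x $ k)) / d else 0)" for i
  proof -
    have "continuous_on ({x. 0 < x $ k} \<times> {0<..}) (\<lambda>z::(real^'n) \<times> real. f0 (\<Psi> (fst z $ k)))"
      by (rule continuous_on_compose2[OF lip_continuous[OF lip(2), of UNIV]], rule continuous_on_compose2[OF cW[OF P(2)]])
        (auto intro!: continuous_intros)
    then show ?thesis using pos unfolding case_prod_beta by (cases "i = k") (auto intro!: continuous_intros)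
  qed
  note Cu = C21_of_jet[where \<Omega> = "{x. x $ k < 0}" and w = u and A = "\<lambda>_ _. 0" and B = "\<lambda>x t i. if i = k then - g0
      (\<Phi> (- (x $ k))) / D else 0", OF Ju]
  note Cv = C21_of_jet[where \<Omega> = "{x. 0 < x $ k}" and w = v and A = "\<lambda>_ _. 0" and B = "\<lambda>x t i. if i = k then - f0
      (\<Psi> (x $ k)) / d else 0", OF Jv]
  have uC: "C21_on u {x. x $ k < 0}" by (rule Cu(1)) (use cB in auto)
  have ud: "dpt u x t = 0" "dxx u i x t = (if i = k then - g0 (\<Phi> (- (x $ k))) / D else 0)" if "x $ k < 0" "0 < t" for x t i
  proof -
    show "dpt u x t = 0" by (rule Cu(2)) (use cB that in auto)
    show "dxx u i x t = (if i = k then - g0 (\<Phi> (- (x $ k))) / D else 0)" by (rule Cu(3)) (use cB that in auto)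
  qed
  have vC: "C21_on v {x. 0 < x $ k}" by (rule Cv(1)) (use cB' in auto)
  have vd: "dpt v x t = 0" "dxx v i x t = (if i = k then - f0 (\<Psi> (x $ k)) / d else 0)" if "0 < x $ k" "0 < t" for x t i
  proof -
    show "dpt v x t = 0" by (rule Cv(2)) (use cB' that in auto)
    show "dxx v i x t = (if i = k then - f0 (\<Psi> (x $ k)) / d else 0)" by (rule Cv(3)) (use cB' that in auto)
  qed
  have "solves_H D d \<mu> \<nu> g f k u v" unfolding solves_H_def
  proof (intro conjI allI impI uC cu)
    show "C21_on v {x. 0 < x $ k}" by fact
    show "continuous_on ({x. 0 \<le> x $ k} \<times> {0<..}) (\<lambda>(x, t). v x t)" by (rule cv)
    fix x :: "real^'n" and t :: real assume t: "0 < t"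
    show "dpt u x t - D * lap u x t = g (u x t)" if "x $ k < 0"
    proof -
      have "lap u x t = - g0 (u x t) / D" using that t by (simp add: lap_def ud(2)) (simp add: u_def)
      moreover have "g0 (u x t) = g (u x t)"
        unfolding u_def using profile_range[OF P(1), of "- (x $ k)"] that by (intro g) auto
      ultimately show ?thesis using pos ud(1)[OF that t] by simp
    qed
    show "dpt v x t - d * lap v x t = f (v x t)" if "0 < x $ k"
    proof -
      have "lap v x t = - f0 (v x t) / d" using that t by (simp add: lap_def vd(2)) (simp add: v_def)
      moreover have "f0 (v x t) = f (v x t)"
        unfolding v_def using profile_range[OF P(2), of "x $ k"] that by (intro f) auto
      ultimately show ?thesis using pos vd(1)[OF that t] by simp
    qed
    assume x: "x $ k = 0"
    have "((\<lambda>s. \<Phi> (- s)) has_real_derivative \<Phi>1 0 * - 1) (at 0 within {..0})"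
      by (rule has_field_derivative_at_within, rule DERIV_chain2[where g = "\<lambda>s. - s"])
        (use profileD(7)[OF P(1), of 0] in \<open>auto intro!: derivative_eq_intros\<close>)
    moreover have "(\<Psi> has_real_derivative \<Psi>1 0) (at 0 within {0..})"
      by (rule has_field_derivative_at_within[OF profileD(7)[OF P(2) order_refl]])
    ultimately show "\<exists>ux vx. ((\<lambda>s. u (x + s *\<^sub>R axis k 1) t) has_real_derivative ux) (at 0 within {..0}) \<and>
         ((\<lambda>s. v (x + s *\<^sub>R axis k 1) t) has_real_derivative vx) (at 0 within {0..}) \<and>
         D * ux = \<nu> * v x t - \<mu> * u x t \<and> - d * vx = \<mu> * u x t - \<nu> * v x t"
      using x steady profileD(1)[OF P(1)] profileD(1)[OF P(2)] profileD(8)[OF P(1) order_refl]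
          profileD(8)[OF P(2) order_refl]
      by (intro exI[of _ "- \<Phi>1 0"] exI[of _ "\<Psi>1 0"]) (simp add: u_def v_def)
  qed
  moreover have "0 < \<Phi> (- z)" if "z \<le> 0" for z using profile_range[OF P(1), of "- z"] that ab by linarith
  moreover have "0 < \<Psi> z" if "0 \<le> z" for z using profile_range[OF P(2), of z] that ab by linarith
  moreover have "bounded ((\<lambda>z. \<Phi> (- z)) ` {..0})"
  proof (rule boundedI)
    fix r assume "r \<in> (\<lambda>z. \<Phi> (- z)) ` {..0}"
    then obtain z where "r = \<Phi> (- z)" "0 \<le> - z" by auto
    then show "norm r \<le> \<bar>min a z1\<bar> + \<bar>max a z1\<bar>"
      using profile_range[OF P(1), of "- z"] unfolding real_norm_def by linarith
  qed
  moreover have "bounded (\<Psi> ` {0..})"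
  proof (rule boundedI)
    fix r assume "r \<in> \<Psi> ` {0..}"
    then obtain z where "r = \<Psi> z" "0 \<le> z" by auto
    then show "norm r \<le> \<bar>min b z2\<bar> + \<bar>max b z2\<bar>"
      using profile_range[OF P(2), of z] unfolding real_norm_def by linarith
  qed
  ultimately show ?thesis unfolding steady_xN_def u_def v_def by blast
qed

lemma bounded_image_abs:
  fixes w :: "'a \<Rightarrow> real"
  assumes "bounded (w ` A)"
  obtains B where "\<And>x. x \<in> A \<Longrightarrow> \<bar>w x\<bar> \<le> B"
  using assms unfolding bounded_iff by auto

lemma solution_convergence:
  fixes u v :: "real^'n::finite \<Rightarrow> real \<Rightarrow> real"
  assumes pos: "0 < D" "0 < d" "0 < \<mu>" "0 < \<nu>" and kpp: "KPP_f g z1" "KPP_f f z2"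
    and u0: "bounded (u0 ` {x. x $ k < 0})" "\<forall>x. x $ k < 0 \<longrightarrow> 0 \<le> u0 x"
    and v0: "bounded (v0 ` {x. 0 < x $ k})" "\<forall>x. 0 < x $ k \<longrightarrow> 0 \<le> v0 x"
    and nz: "\<exists>x. (x $ k < 0 \<and> u0 x \<noteq> 0) \<or> (0 < x $ k \<and> v0 x \<noteq> 0)"
    and sol: "solves_H_init D d \<mu> \<nu> g f k u0 v0 u v"
    and \<kappa>0: "0 < \<kappa>0" "\<kappa>0 < z1" "\<kappa>0 < z2" "\<kappa>0 < a" "\<kappa>0 < b" and C0: "z1 < C0" "z2 < C0" "a < C0" "b < C0"
    and steady: "- D * pslope D (\<lambda>s. g (clamp1 \<kappa>0 C0 s)) z1 a = \<nu> * b - \<mu> * a" "- d * pslope d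
        (\<lambda>s. f (clamp1 \<kappa>0 C0 s)) z2 b = \<mu> * a - \<nu> * b"
    and P: "profile D (\<lambda>s. g (clamp1 \<kappa>0 C0 s)) z1 a \<Phi> \<Phi>1" "profile d (\<lambda>s. f (clamp1 \<kappa>0 C0 s)) z2 b \<Psi> \<Psi>1"
    and K: "compact K"
  shows "K \<subseteq> {x. x $ k \<le> 0} \<Longrightarrow> uniform_limit K (\<lambda>t x. u x t) (\<lambda>x. \<Phi> (- (x $ k))) at_top"
    "K \<subseteq> {x. 0 \<le> x $ k} \<Longrightarrow> uniform_limit K (\<lambda>t x. v x t) (\<lambda>x. \<Psi> (x $ k)) at_top"
proof -
  define w where "w = (\<lambda>x t. u (mirror k x) t)"
  have H: "solves_H D d \<mu> \<nu> g f k u v" using sol by (simp add: solves_H_init_def)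
  note M = solves_H_mirrored[OF H, folded w_def]
  have "continuous_on ({x. x $ k < 0} \<times> {0..}) (\<lambda>z. u (fst z) (snd z))"
    using sol by (simp add: solves_H_init_def case_prod_beta)
  then have "continuous_on ({x. 0 < x $ k} \<times> {0..}) (\<lambda>z. (\<lambda>z. u (fst z) (snd z)) (mirror k (fst z), snd z))"
    by (rule continuous_on_compose2) (auto intro!: continuous_intros)
  then have iw: "init_cont k w" unfolding init_cont_def w_def case_prod_beta by simp
  have iv: "init_cont k v" using sol by (simp add: solves_H_init_def init_cont_def)
  have w0: "w x 0 = u0 (mirror k x)" if "0 < x $ k" for x using sol that by (simp add: solves_H_init_def w_def)
  have vv0: "v x 0 = v0 x" if "0 < x $ k" for x using sol that by (simp add: solves_H_init_def)
  obtain U1 where U1: "\<And>x. x $ k < 0 \<Longrightarrow> \<bar>u0 x\<bar> \<le> U1" using bounded_image_abs[OF u0(1)] by auto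
  obtain U2 where U2: "\<And>x. 0 < x $ k \<Longrightarrow> \<bar>v0 x\<bar> \<le> U2" using bounded_image_abs[OF v0(1)] by auto
  have i1: "0 \<le> w x 0 \<and> w x 0 \<le> max U1 U2" if "0 < x $ k" for x
    using U1[of "mirror k x"] u0(2) that w0[OF that] by (auto simp: abs_le_iff)
  have i2: "0 \<le> v x 0 \<and> v x 0 \<le> max U1 U2" if "0 < x $ k" for x
    using U2[of x] v0(2) that vv0[OF that] by (auto simp: abs_le_iff)
  have bd: "\<exists>B. \<forall>x t. 0 \<le> x $ k \<longrightarrow> 0 < t \<longrightarrow> t \<le> T \<longrightarrow> \<bar>w x t\<bar> \<le> B \<and> \<bar>v x t\<bar> \<le> B" for T
  proof -
    have "bounded ((\<lambda>(x, t). u x t) ` ({x. x $ k \<le> 0} \<times> {0<..T}))" "bounded ((\<lambda>(x, t). v x t) ` ({x. 0 \<le> x $ k} \<times> {0<..T}))"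
      using sol unfolding solves_H_init_def by blast+
    then obtain B1 B2 where B: "\<And>z. z \<in> {x. x $ k \<le> 0} \<times> {0<..T} \<Longrightarrow> \<bar>case z of (x, t) \<Rightarrow> u x t\<bar> \<le> B1"
      "\<And>z. z \<in> {x. 0 \<le> x $ k} \<times> {0<..T} \<Longrightarrow> \<bar>case z of (x, t) \<Rightarrow> v x t\<bar> \<le> B2"
      using bounded_image_abs by metis
    show ?thesis
    proof (intro exI[of _ "max B1 B2"] allI impI)
      fix x :: "real^'n" and t assume "0 \<le> x $ k" "0 < t" "t \<le> T"
      then show "\<bar>w x t\<bar> \<le> max B1 B2 \<and> \<bar>v x t\<bar> \<le> max B1 B2"
        using B(1)[of "(mirror k x, t)"] B(2)[of "(x, t)"] by (simp add: w_def le_max_iff_disj)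
    qed
  qed
  have "\<exists>x0. 0 < x0 $ k \<and> (0 < w x0 0 \<or> 0 < v x0 0)"
  proof -
    obtain x where "(x $ k < 0 \<and> u0 x \<noteq> 0) \<or> (0 < x $ k \<and> v0 x \<noteq> 0)" using nz by blast
    then show ?thesis
    proof
      assume x: "x $ k < 0 \<and> u0 x \<noteq> 0"
      then have "0 < u0 x" using u0(2) by (metis less_eq_real_def)
      then show ?thesis using x w0[of "mirror k x"] by (intro exI[of _ "mirror k x"]) simp
    next
      assume x: "0 < x $ k \<and> v0 x \<noteq> 0"
      then have "0 < v0 x" using v0(2) by (metis less_eq_real_def)
      then show ?thesis using x vv0[of x] by (intro exI[of _ x]) simp
    qed
  qed
  then obtain x0 where x0: "0 < x0 $ k" "0 < w x0 0 \<or> 0 < v x0 0" by blast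
  obtain R where R: "\<And>x. x \<in> K \<Longrightarrow> norm x \<le> R" using compact_imp_bounded[OF K] unfolding bounded_iff by blast
  have conv: "\<exists>T. \<forall>x t. 0 \<le> x $ k \<longrightarrow> norm x \<le> R \<longrightarrow> T \<le> t \<longrightarrow> \<bar>w x t - \<Phi> (x $ k)\<bar> \<le> \<epsilon> \<and> \<bar>v x t - \<Psi> (x $ k)\<bar> \<le> \<epsilon>" if "0 < \<epsilon>" for \<epsilon>
    by (rule mirrored_convergence[OF pos kpp M(1,2,5,6,3,4) iw iv i1 i2 bd x0 \<kappa>0 C0 steady P that])
  show "uniform_limit K (\<lambda>t x. u x t) (\<lambda>x. \<Phi> (- (x $ k))) at_top" if "K \<subseteq> {x. x $ k \<le> 0}"
    unfolding uniform_limit_iff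
  proof (intro allI impI)
    fix e :: real assume "0 < e"
    then obtain T where T: "\<And>x t. 0 \<le> x $ k \<Longrightarrow> norm x \<le> R \<Longrightarrow> T \<le> t \<Longrightarrow> \<bar>w x t - \<Phi> (x $ k)\<bar> \<le> e / 2"
      using conv[of "e / 2"] by auto
    show "\<forall>\<^sub>F t in at_top. \<forall>x\<in>K. dist (u x t) (\<Phi> (- (x $ k))) < e"
      unfolding eventually_at_top_linorder
    proof (intro exI[of _ T] allI impI ballI)
      fix t x assume "T \<le> t" "x \<in> K"
      then show "dist (u x t) (\<Phi> (- (x $ k))) < e"
        using T[of "mirror k x" t] R[of x] that \<open>0 < e\<close> by (auto simp: w_def dist_real_def)
    qed
  qed
  show "uniform_limit K (\<lambda>t x. v x t) (\<lambda>x. \<Psi> (x $ k)) at_top" if "K \<subseteq> {x. 0 \<le> x $ k}"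
    unfolding uniform_limit_iff
  proof (intro allI impI)
    fix e :: real assume "0 < e"
    then obtain T where T: "\<And>x t. 0 \<le> x $ k \<Longrightarrow> norm x \<le> R \<Longrightarrow> T \<le> t \<Longrightarrow> \<bar>v x t - \<Psi> (x $ k)\<bar> \<le> e / 2"
      using conv[of "e / 2"] by auto
    show "\<forall>\<^sub>F t in at_top. \<forall>x\<in>K. dist (v x t) (\<Psi> (x $ k)) < e"
      unfolding eventually_at_top_linorder
    proof (intro exI[of _ T] allI impI ballI)
      fix t x assume "T \<le> t" "x \<in> K"
      then show "dist (v x t) (\<Psi> (x $ k)) < e"
        using T[of x t] R[of x] that \<open>0 < e\<close> by (auto simp: dist_real_def)
    qed
  qed
qed

lemma steady_xN_as_solution:
  fixes k :: "'n::finite"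
  assumes "steady_xN D d \<mu> \<nu> g f k \<Phi> \<Psi>"
  defines "u \<equiv> \<lambda>x::real^'n. \<Phi> (x $ k)" and "v \<equiv> \<lambda>x::real^'n. \<Psi> (x $ k)"
  shows "continuous_on {x. x $ k < 0} u \<and> bounded (u ` {x. x $ k < 0}) \<and> (\<forall>x. x $ k < 0 \<longrightarrow> u x \<ge> 0) \<and>
    continuous_on {x. x $ k > 0} v \<and> bounded (v ` {x. x $ k > 0}) \<and> (\<forall>x. x $ k > 0 \<longrightarrow> v x \<ge> 0) \<and>
    (\<exists>x. (x $ k < 0 \<and> u x \<noteq> 0) \<or> (x $ k > 0 \<and> v x \<noteq> 0)) \<and>
    solves_H_init D d \<mu> \<nu> g f k u v (\<lambda>x t. u x) (\<lambda>x t. v x)"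
proof -
  have H: "solves_H D d \<mu> \<nu> g f k (\<lambda>x t. u x) (\<lambda>x t. v x)" "\<And>z. z \<le> 0 \<Longrightarrow> 0 < \<Phi> z" "\<And>z. 0 \<le> z \<Longrightarrow> 0 < \<Psi> z"
    "bounded (\<Phi> ` {..0})" "bounded (\<Psi> ` {0..})"
    using assms(1) unfolding steady_xN_def u_def v_def by blast+
  have "continuous_on ({x. x $ k \<le> 0} \<times> {0<..}) (\<lambda>z::(real^'n) \<times> real. u (fst z))"
    "continuous_on ({x. 0 \<le> x $ k} \<times> {0<..}) (\<lambda>z::(real^'n) \<times> real. v (fst z))"
    using H(1) by (simp_all add: solves_H_def case_prod_beta)
  note cc = this
  have "continuous_on {x. x $ k \<le> 0} (\<lambda>x. (\<lambda>z. u (fst z)) (x, 1::real))"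
    by (rule continuous_on_compose2[OF cc(1)]) (auto intro!: continuous_intros)
  moreover have "continuous_on {x. 0 \<le> x $ k} (\<lambda>x. (\<lambda>z. v (fst z)) (x, 1::real))"
    by (rule continuous_on_compose2[OF cc(2)]) (auto intro!: continuous_intros)
  ultimately have c: "continuous_on {x. x $ k \<le> 0} u" "continuous_on {x. 0 \<le> x $ k} v" by simp_all
  have ci: "continuous_on ({x. x $ k < 0} \<times> {0..}) (\<lambda>z::(real^'n) \<times> real. u (fst z))"
    "continuous_on ({x. 0 < x $ k} \<times> {0..}) (\<lambda>z::(real^'n) \<times> real. v (fst z))"
    by (rule continuous_on_compose2[OF c(1)] continuous_on_compose2[OF c(2)]; auto intro!: continuous_intros)+
  have b: "bounded (u ` {x. x $ k < 0})" "bounded (v ` {x. 0 < x $ k})"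
    "bounded ((\<lambda>(x, t). u x) ` ({x. x $ k \<le> 0} \<times> {0<..T}))" "bounded ((\<lambda>(x, t). v x) ` ({x. 0 \<le> x $ k} \<times> {0<..T}))"
        for T :: real
    by (rule bounded_subset[OF H(4)] bounded_subset[OF H(5)]; force simp: u_def v_def)+
  have nz: "axis k (- 1) $ k < (0::real) \<and> u (axis k (- 1)) \<noteq> 0"
    using H(2)[of "- 1"] by (simp add: u_def)
  have "solves_H_init D d \<mu> \<nu> g f k u v (\<lambda>x t. u x) (\<lambda>x t. v x)"
    unfolding solves_H_init_def case_prod_beta using H(1) ci b(3,4) by (simp add: case_prod_beta)
  moreover have "continuous_on {x. x $ k < 0} u" "continuous_on {x. 0 < x $ k} v"
    by (rule continuous_on_subset[OF c(1)] continuous_on_subset[OF c(2)]; auto)+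
  moreover have "\<forall>x. x $ k < 0 \<longrightarrow> u x \<ge> 0" "\<forall>x. x $ k > 0 \<longrightarrow> v x \<ge> 0"
    using H(2,3) by (auto simp: u_def v_def intro: less_imp_le)
  ultimately show ?thesis using b(1,2) nz by blast
qed

theorem theorem2p3:
  fixes D d \<mu> \<nu> S :: real and g f :: "real \<Rightarrow> real" and k :: "'n::finite"
  assumes "CARD('n) \<ge> 2"
    and "D > 0" "d > 0" "\<mu> > 0" "\<nu> > 0"
    and "KPP_g g" and "KPP_f f S"
  shows "\<exists>\<Phi> \<Psi>. steady_xN D d \<mu> \<nu> g f k \<Phi> \<Psi> \<and>
      (\<forall>\<Phi>' \<Psi>'. steady_xN D d \<mu> \<nu> g f k \<Phi>' \<Psi>' \<longrightarrow>
          (\<forall>z\<le>0. \<Phi>' z = \<Phi> z) \<and> (\<forall>z\<ge>0. \<Psi>' z = \<Psi> z)) \<and>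
      (\<forall>(u0::real^'n \<Rightarrow> real) v0 u v.
         continuous_on {x. x $ k < 0} u0 \<and> bounded (u0 ` {x. x $ k < 0}) \<and>
         (\<forall>x. x $ k < 0 \<longrightarrow> u0 x \<ge> 0) \<and>
         continuous_on {x. x $ k > 0} v0 \<and> bounded (v0 ` {x. x $ k > 0}) \<and>
         (\<forall>x. x $ k > 0 \<longrightarrow> v0 x \<ge> 0) \<and>
         (\<exists>x. (x $ k < 0 \<and> u0 x \<noteq> 0) \<or> (x $ k > 0 \<and> v0 x \<noteq> 0)) \<and>
         solves_H_init D d \<mu> \<nu> g f k u0 v0 u v
         \<longrightarrow>
         (\<forall>K. compact K \<and> K \<subseteq> {x. x $ k \<le> 0} \<longrightarrow>
              uniform_limit K (\<lambda>t x. u x t) (\<lambda>x. \<Phi> (x $ k)) at_top) \<and>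
         (\<forall>K. compact K \<and> K \<subseteq> {x. x $ k \<ge> 0} \<longrightarrow>
              uniform_limit K (\<lambda>t x. v x t) (\<lambda>x. \<Psi> (x $ k)) at_top))"
proof -
  have pos: "0 < D" "0 < d" "0 < \<mu>" "0 < \<nu>" using assms by auto
  have kpp: "KPP_f g 1" "KPP_f f S" using assms KPP_g_imp_KPP_f by auto
  have loc: "loc_lipschitz g" "loc_lipschitz f" "0 < S" using kpp by (auto simp: KPP_f_def)
  \<comment> \<open>The values in flux balance with \<open>S\<close> and with 1. The interface
    values will lie between 1 and \<open>p\<close> and between \<open>S\<close> and
    \<open>q\<close>, so \<kappa>0 and \<open>C0\<close> enclose them with room to spare.\<close>
  define p q where "p = \<nu> * S / \<mu>" and "q = \<mu> * 1 / \<nu>"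
  have pq: "0 < p" "0 < q" using pos loc by (auto simp: p_def q_def)
  define \<kappa>0 where "\<kappa>0 = min (min 1 S) (min p q) / 2"
  define C0 where "C0 = max (max 1 S) (max p q) + 1"
  have \<kappa>0: "0 < \<kappa>0" "\<kappa>0 < 1" "\<kappa>0 < S" "\<kappa>0 < p" "\<kappa>0 < q" using pq loc by (auto simp: \<kappa>0_def)
  have C0: "1 < C0" "S < C0" "p < C0" "q < C0" by (auto simp: C0_def)
  define g0 where "g0 = (\<lambda>s. g (clamp1 \<kappa>0 C0 s))"
  define f0 where "f0 = (\<lambda>s. f (clamp1 \<kappa>0 C0 s))"
  have sgn: "kpp_sign 1 g0" "kpp_sign S f0"
    unfolding g0_def f0_def using \<kappa>0 C0 by (auto intro!: kpp_sign_clamp kpp)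
  have "\<kappa>0 \<le> C0" using \<kappa>0 C0 by linarith
  then obtain L1 L2 where "\<And>L. L1 \<le> L \<Longrightarrow> lip L g0" "\<And>L. L2 \<le> L \<Longrightarrow> lip L f0"
    unfolding g0_def f0_def using lip_clamp[OF loc(1)] lip_clamp[OF loc(2)] by meson
  then have lip: "lip (max L1 L2) g0" "lip (max L1 L2) f0" by auto
  obtain a b where ab: "- D * pslope D g0 1 a = \<nu> * b - \<mu> * a" "- d * pslope d f0 S b = \<mu> * a - \<nu> * b"
     "min 1 p \<le> a" "a \<le> max 1 p" "min S q \<le> b" "b \<le> max S q"
    using interface_values_exist[OF pos lip(1) sgn(1) lip(2) sgn(2)] unfolding p_def q_def by blast
  have k: "\<kappa>0 < a" "\<kappa>0 < b" "a < C0" "b < C0" using ab(3-6) \<kappa>0 C0 by auto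
  obtain \<Phi> \<Phi>1 where P1: "profile D g0 1 a \<Phi> \<Phi>1" using profile_of_kpp[OF pos(1) lip(1) sgn(1)] by blast
  obtain \<Psi> \<Psi>1 where P2: "profile d f0 S b \<Psi> \<Psi>1" using profile_of_kpp[OF pos(2) lip(2) sgn(2)] by blast
  have steady: "steady_xN D d \<mu> \<nu> g f k (\<lambda>z. \<Phi> (- z)) \<Psi>"
    by (rule steady_xN_of_profiles[OF pos(1,2) lip P1 P2 _ _ _ _ ab(1,2)])
      (use k \<kappa>0 C0 loc in \<open>auto simp: g0_def f0_def intro!: arg_cong[where f = g] arg_cong[where f = f] clamp1_id\<close>)
  note conv = solution_convergence[OF pos kpp _ _ _ _ _ _ \<kappa>0(1,2,3) k(1,2) C0(1,2) k(3,4)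
      ab(1,2)[unfolded g0_def f0_def] P1[unfolded g0_def] P2[unfolded f0_def]]
  have uniq: "(\<forall>z\<le>0. \<Phi>' z = \<Phi> (- z)) \<and> (\<forall>z\<ge>0. \<Psi>' z = \<Psi> z)" if st: "steady_xN D d \<mu> \<nu> g f k \<Phi>' \<Psi>'" for \<Phi>' \<Psi>'
  proof (intro conjI allI impI)
    note s = steady_xN_as_solution[OF st]
    fix z :: real
    define x where "x = z *\<^sub>R axis k (1::real)"
    have xk: "x $ k = z" by (simp add: x_def)
    show "\<Phi>' z = \<Phi> (- z)" if "z \<le> 0"
    proof -
      \<comment> \<open>A function constant in time equals its limit, so the one-point compact set
        \<open>{x}\<close> is enough.\<close>
      have "uniform_limit {x} (\<lambda>(t::real) x. \<Phi>' (x $ k)) (\<lambda>x. \<Phi> (- (x $ k))) at_top"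
        by (rule conv(1)) (use s xk that in auto)
      from tendsto_uniform_limitI[OF this, of x] show ?thesis by (simp add: xk tendsto_const_iff)
    qed
    show "\<Psi>' z = \<Psi> z" if "0 \<le> z"
    proof -
      have "uniform_limit {x} (\<lambda>(t::real) x. \<Psi>' (x $ k)) (\<lambda>x. \<Psi> (x $ k)) at_top"
        by (rule conv(2)) (use s xk that in auto)
      from tendsto_uniform_limitI[OF this, of x] show ?thesis by (simp add: xk tendsto_const_iff)
    qed
  qed
  show ?thesis
  proof (rule exI[of _ "\<lambda>z. \<Phi> (- z)"], rule exI[of _ \<Psi>], intro conjI steady)
    show "\<forall>\<Phi>' \<Psi>'. steady_xN D d \<mu> \<nu> g f k \<Phi>' \<Psi>' \<longrightarrow> (\<forall>z\<le>0. \<Phi>' z = \<Phi> (- z)) \<and> (\<forall>z\<ge>0. \<Psi>' z = \<Psi> z)"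
      using uniq by blast
    show "\<forall>(u0::real^'n \<Rightarrow> real) v0 u v.
         continuous_on {x. x $ k < 0} u0 \<and> bounded (u0 ` {x. x $ k < 0}) \<and>
         (\<forall>x. x $ k < 0 \<longrightarrow> u0 x \<ge> 0) \<and>
         continuous_on {x. x $ k > 0} v0 \<and> bounded (v0 ` {x. x $ k > 0}) \<and>
         (\<forall>x. x $ k > 0 \<longrightarrow> v0 x \<ge> 0) \<and>
         (\<exists>x. (x $ k < 0 \<and> u0 x \<noteq> 0) \<or> (x $ k > 0 \<and> v0 x \<noteq> 0)) \<and>
         solves_H_init D d \<mu> \<nu> g f k u0 v0 u v
         \<longrightarrow>
         (\<forall>K. compact K \<and> K \<subseteq> {x. x $ k \<le> 0} \<longrightarrow>
              uniform_limit K (\<lambda>t x. u x t) (\<lambda>x. \<Phi> (- (x $ k))) at_top) \<and>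
         (\<forall>K. compact K \<and> K \<subseteq> {x. x $ k \<ge> 0} \<longrightarrow>
              uniform_limit K (\<lambda>t x. v x t) (\<lambda>x. \<Psi> (x $ k)) at_top)"
      by (intro allI impI conjI; elim conjE; intro conv; assumption)
  qed
qed

end
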